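(* Let $X$ be a uniformly convex real Banach space whose norm is $C^1$ on $X\setminus\{0\}$, let $1<\alpha<\eta<\beta$, and let $N,A,B\in C^1(X)$ be even functionals that are $\eta$-homogeneous, $\alpha$-homogeneous and $\beta$-homogeneous, respectively. For $\lambda\in\mathbb{R}$ put $$\Phi_\lambda(u)=\frac1\eta N(u)-\frac\lambda\alpha A(u)-\frac1\beta B(u),\quad u\in X.$$ Assume that there exist $C,C'>0$ such that $C'\|u\|^\eta\ge N(u)\ge C^{-1}\|u\|^\eta$, $|A(u)|\le C\|u\|^\alpha$ and $|B(u)|\le C\|u\|^\beta$ for all $u\in X$. Assume also that whenever $(\lambda_n)\subset\mathbb{R}$ and $(u_n)\subset X$ are bounded sequences such that $(\Phi_{\lambda_n}(u_n))$ is bounded and $\Phi_{\lambda_n}'(u_n)\to0$, then $(u_n)$ has a convergent subsequence. Let $\mathcal{C}_A=\{u\in X:A(u)>0\}$ and $\mathcal{C}_B=\{u\in X:B(u)>0\}$. Then there exist $c^*<0<c^{**}$ such that: i) For any $1\le k\le\gamma(\mathcal{C}_A)$ and $c\in(c^*,0)$ there exist $\lambda_{c,k}^+>0$ and $v_{c,k}\in\mathcal{C}_A$ such that $\Phi_{\lambda_{c,k}^+}(v_{c,k})=c$ and $\Phi_{\lambda_{c,k}^+}'(v_{c,k})=0$. ii) For any $1\le k\le\gamma(\mathcal{C}_A)$ the map $c\mapsto\lambda_{c,k}^+$ is continuous and decreasing in $(c^*,0)$, and satisfies $\lim_{c\to0^-}\lambda_{c,k}^+=0$. iii) If $\gamma(\mathcal{C}_A)=\infty$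 then, for any $c\in(c^*,0)$, $0<\lambda_{c,k}^+\le\lambda_{c,k+1}^+$ for all $k$ and $\lambda_{c,k}^+\to\infty$ as $k\to\infty$. iv) If $\gamma(\mathcal{C}_A)=\infty$ then for each $\lambda>0$ there exist sequences $(v_n)\subset\mathcal{C}_A$, $(c_n)\subset(c^*,0)$ and $(k_n)\subset\mathbb{N}$ such that $c_n\to0$, $k_n\to\infty$, and $\lambda=\lambda_{c_n,k_n}^+$, $\Phi_{\lambda}(v_n)=c_n$, $\Phi_{\lambda}'(v_n)=0$ for every $n$. Moreover $v_n\to0$ in $X$, so $(\lambda,0)$ is a bifurcation point for any $\lambda>0$. v) For any $1\le k\le\gamma(\mathcal{C}_A\cap\mathcal{C}_B)$ and $c\in(c^*,c^{**})$ there exist $\lambda_{c,k}^->0$ and $u_{c,k}\in\mathcal{C}_A\cap\mathcal{C}_B$ such that $\Phi_{\lambda_{c,k}^-}(u_{c,k})=c$ and $\Phi_{\lambda_{c,k}^-}'(u_{c,k})=0$. Moreover $\lambda_{c,k}^+<\lambda_{c,k}^-$ for every $c\in(c^*,0)$. vi) For any $1\le k\le\gamma(\mathcal{C}_A\cap\mathcal{C}_B)$ the map $c\mapsto\lambda_{c,k}^-$ is continuous and decreasing in $(c^*,c^{**})$. vii) If $\gamma(\mathcal{C}_A\cap\mathcal{C}_B)=\infty$ then, for any $c\in(c^*,c^{**})$, $0<\lambda_{c,k}^-\le\lambda_{c,k+1}^-$ for all $k$ and $\lambda_{c,k}^-\to\infty$ as $k\to\infty$. (The families $(\lambda^{\pm}_{c,k})$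 in ii)--iv) and vi)--vii) are the ones whose existence is asserted in i) and v).)
   Context: $F$ is $q$-homogeneous if $F(tu)=t^qF(u)$ for all $t>0$, $u\in X$. "Decreasing" means strictly decreasing. For a symmetric open cone $\mathcal{C}\subset X\setminus\{0\}$, $\gamma(\mathcal{C})=\sup\{k\in\mathbb{N}:\text{there is a compact symmetric } M\subset\mathcal{C}\text{ with }\gamma(M)\ge k\}\in\{0,1,2,\dots\}\cup\{\infty\}$, where $\gamma(M)$ is the Krasnoselskii genus: the least $m$ such that there is an odd continuous map $M\to\mathbb{R}^m\setminus\{0\}$ ($\infty$ if none exists). When $\gamma(\mathcal{C})=\infty$, "$1\le k\le\gamma(\mathcal{C})$" means $k\in\mathbb{N}$. $(\lambda,0)$ is a bifurcation point if there are $(\lambda_n,u_n)\in\mathbb{R}\times(X\setminus\{0\})$ with $\Phi_{\lambda_n}'(u_n)=0$, $\lambda_n\to\lambda$ and $u_n\to0$ in $X$. *)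

theory Defs
  imports "HOL-Analysis.Analysis" "HOL-Library.Extended_Nat"
begin

definition uniformly_convex_space :: "'a::real_normed_vector itself \<Rightarrow> bool" where
  "uniformly_convex_space _ \<longleftrightarrow>
     (\<forall>\<epsilon>>0. \<exists>\<delta>>0. \<forall>x y :: 'a. norm x = 1 \<longrightarrow> norm y = 1 \<longrightarrow> norm (x - y) \<ge> \<epsilon>
        \<longrightarrow> norm ((1/2) *\<^sub>R (x + y)) \<le> 1 - \<delta>)"

text \<open>Frechet derivative as an element of the dual space, so that its norm is the operator
  norm. It is meaningful only where \<open>F\<close> is differentiable.\<close>
definition dual_deriv :: "('a::real_normed_vector \<Rightarrow> real) \<Rightarrow> 'a \<Rightarrow> ('a \<Rightarrow>\<^sub>L real)" where
  "dual_deriv F u = Blinfun (frechet_derivative F (at u))"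

text \<open>For open \<open>S\<close>; continuity of the derivative is with respect to the operator norm.\<close>
definition C1_on :: "('a::real_normed_vector \<Rightarrow> real) \<Rightarrow> 'a set \<Rightarrow> bool" where
  "C1_on F S \<longleftrightarrow> (\<forall>u\<in>S. F differentiable (at u)) \<and> continuous_on S (dual_deriv F)"

definition even_functional :: "('a::real_vector \<Rightarrow> real) \<Rightarrow> bool" where
  "even_functional F \<longleftrightarrow> (\<forall>u. F (- u) = F u)"

definition homogeneous :: "real \<Rightarrow> ('a::real_vector \<Rightarrow> real) \<Rightarrow> bool" where
  "homogeneous q F \<longleftrightarrow> (\<forall>t>0. \<forall>u. F (t *\<^sub>R u) = t powr q * F u)"

text \<open>Krasnoselskii genus. The space \<open>Euclidean_space m\<close> consists of the real sequences
  vanishing from index \<open>m\<close> on, so its origin is the zero sequence.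
  The infimum of the empty set is \<open>\<infinity>\<close>.\<close>
definition genus :: "'a::real_normed_vector set \<Rightarrow> enat" where
  "genus M = Inf {enat m | m. \<exists>f. continuous_map (top_of_set M) (Euclidean_space m) f
      \<and> (\<forall>x\<in>M. f (- x) = (\<lambda>i. - f x i)) \<and> (\<forall>x\<in>M. f x \<noteq> (\<lambda>i. 0))}"

definition cone_genus :: "'a::real_normed_vector set \<Rightarrow> enat" where
  "cone_genus K = Sup {enat k | k. \<exists>M. compact M \<and> (\<forall>x\<in>M. - x \<in> M) \<and> M \<subseteq> K \<and> enat k \<le> genus M}"

definition pos_cone :: "('a \<Rightarrow> real) \<Rightarrow> 'a set" where
  "pos_cone F = {u. F u > 0}"

definition Phi :: "real \<Rightarrow> real \<Rightarrow> real \<Rightarrow> ('a \<Rightarrow> real) \<Rightarrow> ('a \<Rightarrow> real) \<Rightarrow> ('a \<Rightarrow> real)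
    \<Rightarrow> real \<Rightarrow> 'a \<Rightarrow> real" where
  "Phi \<eta> \<alpha> \<beta> N A B lam u = 1 / \<eta> * N u - lam / \<alpha> * A u - 1 / \<beta> * B u"

definition bifurcation_point :: "(real \<Rightarrow> 'a::real_normed_vector \<Rightarrow> real) \<Rightarrow> real \<Rightarrow> bool" where
  "bifurcation_point \<Phi> lam \<longleftrightarrow>
     (\<exists>l u. (\<forall>n::nat. u n \<noteq> 0 \<and> dual_deriv (\<Phi> (l n)) (u n) = 0)
        \<and> l \<longlonglongrightarrow> lam \<and> u \<longlonglongrightarrow> 0)"

end

theory Submission
  imports Defs
begin

text \<open>For \<open>A u > 0\<close> the equation \<open>\<Phi>\<^sub>\<lambda>(u) = c\<close> can be solved for \<open>\<lambda>\<close>; its solution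
  \<open>\<lambda>\<^sub>c(u) = \<alpha> (N(u)/\<eta> - B(u)/\<beta> - c) / A(u)\<close> is a functional whose critical points are exactly
  those of \<open>\<Phi>\<^sub>\<lambda>\<close> with energy \<open>c\<close> and \<open>\<lambda> = \<lambda>\<^sub>c(u)\<close>. On each ray, \<open>t \<mapsto> \<lambda>\<^sub>c(t u)\<close> has for small
  negative \<open>c\<close> a local minimum at a radius below a uniform threshold and, if \<open>B u > 0\<close>, a local maximum
  beyond it. Taking these extremal values gives two even, 0-homogeneous functionals, and the numbers
  \<open>\<lambda>\<^sup>+\<close>, \<open>\<lambda>\<^sup>-\<close> are their minimax levels over compact symmetric sets of genus at least \<open>k\<close> in the unit
  sphere. No smoothness of the sphere is needed: since the functionals are 0-homogeneous, compact sets can be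
  deformed in the open cone and normalized afterwards, and the deformation flow is replaced by Ekeland's
  principle on the space of odd bounded continuous maps. Monotonicity and continuity in \<open>c\<close> come
  from comparing the functionals for two energies on the same ray.\<close>

section \<open>Ekeland's principle and the genus\<close>

text \<open>The thresholds come from uniformity over rays. Below the radius \<open>T\<close> the
  B-term takes at most half of the N-term on every ray at once; \<open>c_lo\<close> is the energy at
  which the resulting lower bound for the slope at \<open>T\<close> drops to zero, and
  \<open>c_hi\<close> bounds N/\<eta> - B/\<beta> from below at \<open>T\<close>. Both depend on the
  exponents and \<open>C\<close> alone, not on k. The obstacle is compactness: the Palais-Smale
  hypothesis concerns \<open>Phi\<close> at rescaled points, while the minimax runs over unit
  vectors in a cone that is only open. Lower bounds of the type const / (radius^\<alpha> A), and for
  maxima an estimate on B, keep radii in a compact subset of the positive half-line and sublevels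
  away from the boundary of the cone. The envelope argument asks only for continuity of the turning
  radius, not for its derivative. For unbounded levels, a neighbourhood of the critical set is cut
  out by finitely many odd functions, so only the genus lost by removing their nonzero sets matters.
  Continuity in c holds because the level decreases while level / (b - c) does not, with b = 0 or b
  = \<open>c_hi\<close>.\<close>

lemma ekeland_variational:
  fixes f :: "'b::metric_space \<Rightarrow> real"
  assumes E: "complete E" and lsc: "\<And>b. closed {x\<in>E. f x \<le> b}"
    and low: "\<And>x. x \<in> E \<Longrightarrow> m \<le> f x" and "x0 \<in> E" and "e > 0"
  obtains x where "x \<in> E" and "f x + e * dist x0 x \<le> f x0"
    and "\<And>y. y \<in> E \<Longrightarrow> y \<noteq> x \<Longrightarrow> f x < f y + e * dist x y"
proof -
  \<comment> \<open>\<open>S x\<close> collects the points below a cone of slope \<open>e\<close>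
    with tip at x. Membership is a partial order, and the point sought is one whose set is a
    singleton.\<close>
  define S where "S x = {y\<in>E. f y + e * dist x y \<le> f x}" for x
  have S_refl: "x \<in> S x" if "x \<in> E" for x
    using that by (simp add: S_def)
  have S_trans: "z \<in> S x" if "y \<in> S x" "z \<in> S y" for x y z
  proof -
    have "e * dist x z \<le> e * (dist x y + dist y z)"
      using \<open>e > 0\<close> by (intro mult_left_mono dist_triangle) auto
    with that show ?thesis
      by (simp add: S_def algebra_simps)
  qed
  have ex: "\<exists>y\<in>S x. \<forall>z\<in>S x. f y \<le> f z + d" if "x \<in> E" "d > 0" for x d
  proof -
    have bdd: "bdd_below (f ` S x)"
      using low by (auto simp: S_def intro!: bdd_belowI[of _ m])
    have ne: "f ` S x \<noteq> {}"
      using S_refl[OF that(1)] by auto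
    obtain y where y: "y \<in> S x" "f y < Inf (f ` S x) + d"
      using cInf_less_iff[OF ne bdd, of "Inf (f ` S x) + d"] \<open>d > 0\<close> by auto
    have "f y \<le> f z + d" if "z \<in> S x" for z
      using cInf_lower[OF _ bdd, of "f z"] that y(2) by auto
    with y(1) show ?thesis by blast
  qed
  have "\<exists>x. \<forall>n. (x n \<in> E \<and> (n = 0 \<longrightarrow> x n = x0)) \<and>
      (x (Suc n) \<in> S (x n) \<and> (\<forall>z\<in>S (x n). f (x (Suc n)) \<le> f z + (1/2)^n))"
  proof (rule dependent_nat_choice)
    show "\<exists>x. x \<in> E \<and> (0 = (0::nat) \<longrightarrow> x = x0)"
      using \<open>x0 \<in> E\<close> by blast
  next
    fix x :: 'b and n :: nat
    assume "x \<in> E \<and> (n = 0 \<longrightarrow> x = x0)"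
    then have "x \<in> E" by simp
    from ex[OF this, of "(1/2)^n"]
    show "\<exists>y. (y \<in> E \<and> (Suc n = 0 \<longrightarrow> y = x0)) \<and> y \<in> S x \<and> (\<forall>z\<in>S x. f y \<le> f z + (1/2)^n)"
      by (auto simp: S_def)
  qed
  then obtain x where x: "\<And>n. x n \<in> E" "x 0 = x0" "\<And>n. x (Suc n) \<in> S (x n)"
    "\<And>n z. z \<in> S (x n) \<Longrightarrow> f (x (Suc n)) \<le> f z + (1/2)^n"
    by blast
  have xS: "x p \<in> S (x n)" if "n \<le> p" for n p
    using that
  proof (induction p rule: dec_induct)
    case base
    then show ?case using S_refl x(1) by simp
  next
    case (step p)
    then show ?case using S_trans x(3) by blast
  qed
  \<comment> \<open>Such a point also lies in \<open>S (x n)\<close>, where \<open>x (Suc n)\<close>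
    is minimal up to (1/2)^n; so the nested sets shrink to a point.\<close>
  have est: "e * dist (x (Suc n)) y \<le> (1/2)^n" if "y \<in> S (x (Suc n))" for y n
  proof -
    have "y \<in> S (x n)" using that x(3) S_trans by blast
    with x(4)[OF this] that show ?thesis by (simp add: S_def)
  qed
  have pw: "(\<lambda>n. (1/2)^n / e) \<longlonglongrightarrow> 0"
    using tendsto_divide[OF LIMSEQ_power_zero[of "1/2::real"] tendsto_const[of e]] \<open>e > 0\<close> by simp
  have "Cauchy x"
  proof (rule metric_CauchyI)
    fix r :: real assume "r > 0"
    then obtain n where n: "(1/2)^n / e < r / 2"
      using order_tendstoD(2)[OF pw, of "r/2"] by (auto simp: eventually_sequentially)
    have "dist (x (Suc n)) (x p) < r / 2" if "p \<ge> Suc n" for p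
    proof -
      have "dist (x (Suc n)) (x p) \<le> (1/2)^n / e"
        using est[OF xS[OF that]] \<open>e > 0\<close> by (simp add: field_simps)
      with n show ?thesis by (rule le_less_trans[rotated])
    qed
    then have "\<forall>p\<ge>Suc n. \<forall>q\<ge>Suc n. dist (x p) (x q) < r"
      by (meson dist_triangle_half_r)
    then show "\<exists>M. \<forall>p\<ge>M. \<forall>q\<ge>M. dist (x p) (x q) < r" by blast
  qed
  with E x(1) obtain l where l: "l \<in> E" "x \<longlonglongrightarrow> l"
    unfolding complete_def by blast
  have lS: "l \<in> S (x n)" for n
  proof -
    \<comment> \<open>The level in the definition of \<open>S\<close> varies with the point, but
      closedness is given for fixed levels; the slack \<open>d\<close> lets one fixed level contain
      all late iterates.\<close>
    have "f l \<le> f (x n) - e * dist (x n) l + d" if "d > 0" for d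
    proof -
      have "(\<lambda>p. e * dist (x n) (x p)) \<longlonglongrightarrow> e * dist (x n) l"
        using l(2) by (intro tendsto_intros)
      from order_tendstoD(1)[OF this, of "e * dist (x n) l - d"] \<open>d > 0\<close>
      have "\<forall>\<^sub>F p in sequentially. e * dist (x n) l - d < e * dist (x n) (x p)" by simp
      then have "\<forall>\<^sub>F p in sequentially. x p \<in> {y\<in>E. f y \<le> f (x n) - e * dist (x n) l + d}"
        using eventually_ge_at_top[of n]
      proof eventually_elim
        case (elim p)
        then show ?case using xS[of n p] by (auto simp: S_def)
      qed
      then show ?thesis
        using Lim_in_closed_set[OF lsc _ _ l(2)] by auto
    qed
    then have "f l \<le> f (x n) - e * dist (x n) l"
      by (rule field_le_epsilon)
    with l(1) show ?thesis by (simp add: S_def)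
  qed
  show thesis
  proof
    show "l \<in> E" by (fact l(1))
    show "f l + e * dist x0 l \<le> f x0"
      using lS[of 0] x(2) by (simp add: S_def)
    fix y assume y: "y \<in> E" "y \<noteq> l"
    show "f l < f y + e * dist l y"
    proof (rule ccontr)
      assume "\<not> ?thesis"
      then have "y \<in> S l" using y by (simp add: S_def)
      then have "y \<in> S (x n)" for n using lS S_trans by blast
      then have "dist (x (Suc n)) y \<le> (1/2)^n / e" for n
        using est[of y n] \<open>e > 0\<close> by (simp add: field_simps)
      then have "(\<lambda>n. dist (x (Suc n)) y) \<longlonglongrightarrow> 0"
        by (intro tendsto_sandwich[OF _ _ tendsto_const pw]) auto
      then have "(\<lambda>n. x (Suc n)) \<longlonglongrightarrow> y"
        using tendsto_dist_iff by blast
      with LIMSEQ_Suc[OF l(2)] have "y = l" using LIMSEQ_unique by blast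
      with y show False by simp
    qed
  qed
qed

section \<open>Genus under odd maps and under removal of open sets\<close>

lemma enat_le_genus_iff:
  "enat k \<le> genus M \<longleftrightarrow> (\<forall>m f. continuous_map (top_of_set M) (Euclidean_space m) f
      \<and> (\<forall>x\<in>M. f (- x) = (\<lambda>i. - f x i)) \<and> (\<forall>x\<in>M. f x \<noteq> (\<lambda>i. 0)) \<longrightarrow> k \<le> m)"
    (is "_ \<longleftrightarrow> (\<forall>m f. ?P m f \<longrightarrow> k \<le> m)" is "_ \<longleftrightarrow> ?R")
proof
  assume L: "enat k \<le> genus M"
  show "?R"
  proof (intro allI impI)
    fix m f
    assume f: "?P m f"
    have "genus M \<le> enat m"
      unfolding genus_def by (rule Inf_lower) (use f in blast)
    with L have "enat k \<le> enat m" by (rule order_trans)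
    then show "k \<le> m" by simp
  qed
next
  assume R: "?R"
  show "enat k \<le> genus M"
    unfolding genus_def
  proof (rule Inf_greatest)
    fix x assume "x \<in> {enat m | m. \<exists>f. ?P m f}"
    then obtain m f where "x = enat m" "?P m f" by blast
    with R have "k \<le> m" by blast
    with \<open>x = enat m\<close> show "enat k \<le> x" by simp
  qed
qed

lemma genus_empty: "genus {} = 0"
proof -
  have "\<not> enat 1 \<le> genus ({}::'a::real_normed_vector set)"
    unfolding enat_le_genus_iff
    by (auto simp: topspace_subtopology intro!: exI[of _ 0])
  then show ?thesis
    by (metis enat_0 enat_ord_code(4) linorder_not_le one_enat_def iless_eSuc0 one_eSuc)
qed

text \<open>An odd nonvanishing map on the image pulls back along \<open>h\<close> to one on M with
  the same target dimension.\<close>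

lemma enat_le_genus_image:
  fixes M :: "'a::real_normed_vector set" and h :: "'a \<Rightarrow> 'b::real_normed_vector"
  assumes k: "enat k \<le> genus M" and h: "continuous_on M h" "\<And>x. x \<in> M \<Longrightarrow> h (- x) = - h x"
  shows "enat k \<le> genus (h ` M)"
  unfolding enat_le_genus_iff
proof (intro allI impI)
  fix m and f :: "'b \<Rightarrow> nat \<Rightarrow> real"
  assume f: "continuous_map (top_of_set (h ` M)) (Euclidean_space m) f
      \<and> (\<forall>x\<in>h ` M. f (- x) = (\<lambda>i. - f x i)) \<and> (\<forall>x\<in>h ` M. f x \<noteq> (\<lambda>i. 0))"
  have "continuous_map (top_of_set M) (top_of_set (h ` M)) h"
    using h(1) by auto
  then have "continuous_map (top_of_set M) (Euclidean_space m) (f \<circ> h)"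
    using f continuous_map_compose by blast
  then show "k \<le> m"
    using k[unfolded enat_le_genus_iff, rule_format, of m "f \<circ> h"] f h(2) by simp
qed

text \<open>Each odd function costs at most one dimension: an odd nonvanishing map on the common
  zero set is extended to M and completed by the \<open>m\<close> functions as further coordinates.
  This serves in place of subadditivity of the genus.\<close>

lemma enat_le_genus_remove:
  fixes M :: "'a::real_normed_vector set" and \<phi> :: "nat \<Rightarrow> 'a \<Rightarrow> real"
  assumes k: "enat (k + m) \<le> genus M" and sym: "\<And>x. x \<in> M \<Longrightarrow> - x \<in> M"
    and \<phi>: "\<And>j. continuous_on M (\<phi> j)" "\<And>j x. \<phi> j (- x) = - \<phi> j x"
  shows "enat k \<le> genus {x\<in>M. \<forall>j<m. \<phi> j x = 0}"
  unfolding enat_le_genus_iff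
proof (intro allI impI)
  let ?M = "{x\<in>M. \<forall>j<m. \<phi> j x = 0}"
  fix i and f :: "'a \<Rightarrow> nat \<Rightarrow> real"
  assume f: "continuous_map (top_of_set ?M) (Euclidean_space i) f
      \<and> (\<forall>x\<in>?M. f (- x) = (\<lambda>i. - f x i)) \<and> (\<forall>x\<in>?M. f x \<noteq> (\<lambda>i. 0))"
  have normal: "normal_space (top_of_set M)"
    by (intro metrizable_imp_normal_space metrizable_space_subtopology metrizable_space_euclidean)
  \<comment> \<open>One sum of absolute values encodes all \<open>m\<close> equations, so a single
    level set has to be closed.\<close>
  have "continuous_on M (\<lambda>x. \<Sum>j<m. \<bar>\<phi> j x\<bar>)"
    by (intro continuous_intros \<phi>(1))
  from continuous_closedin_preimage_constant[OF this, of 0]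
  have cl: "closedin (top_of_set M) ?M"
    by (simp add: sum_nonneg_eq_0_iff lessThan_def)
  have "\<exists>g. continuous_map (top_of_set M) euclideanreal g \<and> (\<forall>x\<in>?M. g x = f x j)" for j
  proof -
    have "continuous_map (top_of_set ?M) euclideanreal (\<lambda>x. f x j)"
      using f by (auto simp: Euclidean_space_def continuous_map_in_subtopology continuous_map_componentwise_UNIV)
    then have "continuous_map (subtopology (top_of_set M) ?M) euclideanreal (\<lambda>x. f x j)"
      by (simp add: subtopology_subtopology Collect_conj_eq flip: Int_assoc)
    then obtain g where "continuous_map (top_of_set M) euclideanreal g" "\<And>x. x \<in> ?M \<Longrightarrow> g x = f x j"
      by (rule Tietze_extension_realinterval[OF normal cl is_interval_univ UNIV_not_empty _ subset_UNIV]) (rule that)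
    then show ?thesis by blast
  qed
  then have "\<forall>j. \<exists>g. continuous_on M g \<and> (\<forall>x\<in>?M. g x = f x j)"
    by auto
  from choice[OF this] obtain g where g: "\<And>j. continuous_on M (g j)" "\<And>j x. x \<in> ?M \<Longrightarrow> g j x = f x j"
    by blast
  \<comment> \<open>The Tietze extension need not be odd, but its odd part still agrees with
    \<open>f\<close> on the symmetric zero set. Coordinates \<open>i\<close> to
    \<open>i + m - 1\<close> carry \<open>\<phi>\<close>; the others are 0, as membership in
    \<open>Euclidean_space\<close> demands.\<close>
  define F where "F x j = (if j < i then (g j x - g j (- x)) / 2 else if j < i + m then \<phi> (j - i) x else 0)" for x j
  have neg: "continuous_on M (\<lambda>x. g j (- x))" for j
    using sym by (intro continuous_on_compose2[OF g(1)] continuous_intros) auto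
  have contF: "continuous_on M (\<lambda>x. F x j)" for j
  proof -
    consider "j < i" | "\<not> j < i" "j < i + m" | "\<not> j < i" "\<not> j < i + m" by blast
    then show ?thesis
      by cases (use neg[of j] g(1)[of j] \<phi>(1)[of "j - i"] in \<open>auto simp: F_def intro!: continuous_intros\<close>)
  qed
  have "continuous_map (top_of_set M) (Euclidean_space (i + m)) F"
    unfolding Euclidean_space_def continuous_map_in_subtopology continuous_map_componentwise_UNIV
    using contF by simp (auto simp: F_def)
  moreover have "F (- x) = (\<lambda>j. - F x j)" for x
    by (rule ext) (simp add: F_def \<phi>(2) field_simps)
  moreover have "F x \<noteq> (\<lambda>j. 0)" if x: "x \<in> M" for x
  proof
    assume 0: "F x = (\<lambda>j. 0)"
    have "\<phi> j x = 0" if "j < m" for j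
      using fun_cong[OF 0, of "i + j"] that by (simp add: F_def)
    then have xM: "x \<in> ?M" using x by simp
    then have nxM: "- x \<in> ?M" using \<phi>(2) sym by simp
    have "f x j = 0" for j
    proof (cases "j < i")
      case True
      have "f (- x) j = - f x j" using f xM by simp
      then show ?thesis
        using fun_cong[OF 0, of j] True g(2)[OF xM, of j] g(2)[OF nxM, of j] by (simp add: F_def)
    next
      case False
      have "f x \<in> topspace (Euclidean_space i)"
        using continuous_map_image_subset_topspace[OF conjunct1[OF f]] xM by auto
      then show ?thesis using False by (simp add: topspace_Euclidean_space)
    qed
    then have "f x = (\<lambda>i. 0)" by (rule ext)
    then show False using f xM by blast
  qed
  ultimately have "k + m \<le> i + m"
    using k unfolding enat_le_genus_iff by blast
  then show "k \<le> i" by simp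
qed

section \<open>Minimax levels of even 0-homogeneous functionals\<close>

text \<open>Restricting to the unit sphere loses nothing for 0-homogeneous functionals, and it is on
  unit vectors that sublevels and Palais-Smale sequences are controlled.\<close>

definition minimax_sets :: "'a::real_normed_vector set \<Rightarrow> nat \<Rightarrow> 'a set set" where
  "minimax_sets K k = {M. compact M \<and> (\<forall>x\<in>M. - x \<in> M) \<and> M \<subseteq> K \<and> (\<forall>x\<in>M. norm x = 1) \<and> enat k \<le> genus M}"

text \<open>The infimum runs over upper bounds of \<open>J\<close> on M instead of over suprema, so
  no supremum has to exist.\<close>

definition minimax :: "'a::real_normed_vector set \<Rightarrow> ('a \<Rightarrow> real) \<Rightarrow> nat \<Rightarrow> real" where
  "minimax K J k = Inf {b. \<exists>M\<in>minimax_sets K k. \<forall>x\<in>M. J x \<le> b}"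

lemma minimax_sets_mono: "k \<le> l \<Longrightarrow> K \<subseteq> L \<Longrightarrow> minimax_sets K l \<subseteq> minimax_sets L k"
  unfolding minimax_sets_def using order_trans[of "enat k" "enat l"] by fastforce

lemma minimax_sets_nonempty: "M \<in> minimax_sets K k \<Longrightarrow> 1 \<le> k \<Longrightarrow> M \<noteq> {}"
  by (auto simp: minimax_sets_def genus_empty enat_0_iff zero_enat_def)

text \<open>The real infimum needs a lower bound: by \<open>1 \<le> k\<close> every admissible set
  is nonempty, so every upper bound is at least \<open>m\<close>.\<close>

lemma minimax_le:
  assumes "M \<in> minimax_sets K k" "1 \<le> k" "\<And>x. x \<in> M \<Longrightarrow> J x \<le> b" and low: "\<And>x. x \<in> K \<Longrightarrow> m \<le> J x"
  shows "minimax K J k \<le> b"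
  unfolding minimax_def
proof (rule cInf_lower)
  show "b \<in> {b. \<exists>M\<in>minimax_sets K k. \<forall>x\<in>M. J x \<le> b}" using assms by blast
  show "bdd_below {b. \<exists>M\<in>minimax_sets K k. \<forall>x\<in>M. J x \<le> b}"
  proof (rule bdd_belowI[of _ m])
    fix b assume "b \<in> {b. \<exists>M\<in>minimax_sets K k. \<forall>x\<in>M. J x \<le> b}"
    then obtain M where M: "M \<in> minimax_sets K k" "\<forall>x\<in>M. J x \<le> b" by blast
    then obtain x where "x \<in> M" using minimax_sets_nonempty \<open>1 \<le> k\<close> by blast
    then have "x \<in> K" using M by (auto simp: minimax_sets_def)
    from low[OF this] show "m \<le> b" using M \<open>x \<in> M\<close> by force
  qed
qed

lemma minimax_lessD:
  assumes ne: "minimax_sets K k \<noteq> {}" and J: "continuous_on K J" and b: "minimax K J k < b"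
  obtains M where "M \<in> minimax_sets K k" "\<And>x. x \<in> M \<Longrightarrow> J x < b"
proof -
  obtain M where M: "M \<in> minimax_sets K k" using ne by blast
  have "bounded (J ` M)"
    using M J by (intro compact_imp_bounded compact_continuous_image continuous_on_subset[OF J]) (auto simp: minimax_sets_def)
  then obtain c where "\<forall>y\<in>J ` M. \<bar>y\<bar> \<le> c"
    unfolding bounded_real by blast
  then have "\<forall>x\<in>M. J x \<le> c" by (auto dest: abs_le_D1)
  then have "{b. \<exists>M\<in>minimax_sets K k. \<forall>x\<in>M. J x \<le> b} \<noteq> {}" using M by blast
  from cInf_lessD[OF this b[unfolded minimax_def]] obtain z where z: "z < b" "\<exists>M\<in>minimax_sets K k. \<forall>x\<in>M. J x \<le> z"
    by blast
  then show thesis using that by fastforce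
qed

text \<open>The comparison is demanded only on a sublevel of \<open>J\<close>, since for the maxima
  along rays the gain is uniform only there. A negative \<open>d\<close> yields strict inequalities
  between levels.\<close>

lemma minimax_compare:
  assumes k: "1 \<le> k" "minimax_sets K k \<noteq> {}" "K \<subseteq> L" and J: "continuous_on K J"
    and low: "\<And>x. x \<in> L \<Longrightarrow> m \<le> I x" and l: "minimax K J k < l"
    and le: "\<And>x. x \<in> K \<Longrightarrow> norm x = 1 \<Longrightarrow> J x \<le> l \<Longrightarrow> I x \<le> J x + d"
  shows "minimax L I k \<le> minimax K J k + d"
proof (rule field_le_epsilon)
  fix e :: real assume "e > 0"
  then have "minimax K J k < min l (minimax K J k + e)" using l by simp
  then obtain M where M: "M \<in> minimax_sets K k" "\<And>x. x \<in> M \<Longrightarrow> J x < min l (minimax K J k + e)"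
    using minimax_lessD[OF k(2) J] by blast
  show "minimax L I k \<le> minimax K J k + d + e"
  proof (rule minimax_le)
    show "M \<in> minimax_sets L k" using M(1) minimax_sets_mono[OF order_refl k(3)] by blast
    fix x assume x: "x \<in> M"
    then have "I x \<le> J x + d" using M by (intro le) (auto simp: minimax_sets_def less_imp_le)
    then show "I x \<le> minimax K J k + d + e" using M(2)[OF x] by simp
  qed (use k low in auto)
qed

text \<open>Multiplicative counterpart; it supplies the ratio bound that, together with
  monotonicity, forces continuity in the energy.\<close>

lemma minimax_compare_mult:
  assumes k: "1 \<le> k" "minimax_sets K k \<noteq> {}" and J: "continuous_on K J" and "r > 0"
    and low: "\<And>x. x \<in> K \<Longrightarrow> m \<le> I x" and le: "\<And>x. x \<in> K \<Longrightarrow> norm x = 1 \<Longrightarrow> I x \<le> r * J x"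
  shows "minimax K I k \<le> r * minimax K J k"
proof (rule field_le_epsilon)
  fix e :: real assume "e > 0"
  then have "minimax K J k < minimax K J k + e / r" using \<open>r > 0\<close> by simp
  then obtain M where M: "M \<in> minimax_sets K k" "\<And>x. x \<in> M \<Longrightarrow> J x < minimax K J k + e / r"
    using minimax_lessD[OF k(2) J] by blast
  show "minimax K I k \<le> r * minimax K J k + e"
  proof (rule minimax_le[OF M(1) k(1) _ low])
    fix x assume x: "x \<in> M"
    then have "I x \<le> r * J x" using M by (intro le) (auto simp: minimax_sets_def)
    also have "\<dots> \<le> r * (minimax K J k + e / r)"
      using M(2)[OF x] \<open>r > 0\<close> by (intro mult_left_mono) auto
    also have "\<dots> = r * minimax K J k + e" using \<open>r > 0\<close> by (simp add: distrib_left)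
    finally show "I x \<le> r * minimax K J k + e" .
  qed
qed

text \<open>An odd map into the cone can be followed by radial projection without losing genus, so
  deformations need not preserve the sphere.\<close>

lemma minimax_sets_normalize:
  fixes M :: "'a::real_normed_vector set"
  assumes "compact M" "\<And>x. x \<in> M \<Longrightarrow> - x \<in> M" and k: "enat k \<le> genus M"
    and h: "continuous_on M h" "\<And>x. x \<in> M \<Longrightarrow> h (- x) = - h x" "h ` M \<subseteq> K" and "0 \<notin> K"
    and scale: "\<And>x t. x \<in> K \<Longrightarrow> t > 0 \<Longrightarrow> t *\<^sub>R x \<in> K"
  shows "(\<lambda>x. inverse (norm (h x)) *\<^sub>R h x) ` M \<in> minimax_sets K k"
proof -
  have nz: "h x \<noteq> 0" if "x \<in> M" for x using that assms by auto
  have c: "continuous_on M (\<lambda>x. inverse (norm (h x)) *\<^sub>R h x)"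
    using nz by (intro continuous_intros h) auto
  have "enat k \<le> genus ((\<lambda>x. inverse (norm (h x)) *\<^sub>R h x) ` M)"
    using h(2) by (intro enat_le_genus_image[OF k c]) auto
  moreover have "- (inverse (norm (h x)) *\<^sub>R h x) \<in> (\<lambda>x. inverse (norm (h x)) *\<^sub>R h x) ` M" if "x \<in> M" for x
    using assms(2)[OF that] h(2)[OF that] by (intro image_eqI[of _ _ "- x"]) auto
  moreover have "inverse (norm (h x)) *\<^sub>R h x \<in> K" if "x \<in> M" for x
    using nz[OF that] h(3) that by (intro scale) auto
  ultimately show ?thesis
    using nz compact_continuous_image[OF c \<open>compact M\<close>] by (auto simp: minimax_sets_def)
qed

lemma minimax_sets_cone_genus:
  fixes K :: "'a::real_normed_vector set"
  assumes k: "1 \<le> k" "enat k \<le> cone_genus K" and K: "0 \<notin> K" "\<And>x t. x \<in> K \<Longrightarrow> t > 0 \<Longrightarrow> t *\<^sub>R x \<in> K"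
  shows "minimax_sets K k \<noteq> {}"
proof -
  let ?S = "{enat k | k. \<exists>M. compact M \<and> (\<forall>x\<in>M. - x \<in> M) \<and> M \<subseteq> K \<and> enat k \<le> genus M}"
  \<comment> \<open>Stepping down to \<open>k - 1\<close> makes the inequality strict, so some
    member of the set exceeds it whether or not the supremum is attained.\<close>
  have "enat (k - 1) < Sup ?S"
    using k unfolding cone_genus_def[symmetric] by (intro less_le_trans[OF _ k(2)]) auto
  then obtain l where "l \<in> ?S" "enat (k - 1) < l"
    unfolding less_Sup_iff by blast
  then obtain j M where M: "compact M" "\<forall>x\<in>M. - x \<in> M" "M \<subseteq> K" "enat j \<le> genus M" "k \<le> j"
    using k(1) by auto
  have "enat k \<le> genus M" using M(4,5) order_trans[of "enat k" "enat j"] by simp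
  from minimax_sets_normalize[OF M(1) _ this, of id K] M K show ?thesis by auto
qed

text \<open>\<open>strict_deriv\<close>, with both points varying, is the form that the envelope
  argument delivers, and it already implies continuity of \<open>G\<close>. Closedness of sublevels
  in the whole space says that no sequence with bounded values leaves K in the limit. The full
  derivative replaces a tangential one because \<open>J\<close> is constant along rays.\<close>

locale even_cone_functional =
  fixes K :: "'a::banach set" and J :: "'a \<Rightarrow> real" and G :: "'a \<Rightarrow> 'a \<Rightarrow>\<^sub>L real"
  assumes open_K: "open K" and zero_K: "0 \<notin> K"
    and sym_K: "x \<in> K \<Longrightarrow> - x \<in> K" and scale_K: "x \<in> K \<Longrightarrow> t > 0 \<Longrightarrow> t *\<^sub>R x \<in> K"
    and J_even: "x \<in> K \<Longrightarrow> J (- x) = J x"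
    and J_scale: "x \<in> K \<Longrightarrow> t > 0 \<Longrightarrow> J (t *\<^sub>R x) = J x"
    and G_scale: "x \<in> K \<Longrightarrow> t > 0 \<Longrightarrow> G (t *\<^sub>R x) = (1 / t) *\<^sub>R G x"
    and strict_deriv: "x \<in> K \<Longrightarrow> e > 0 \<Longrightarrow>
          \<exists>d>0. \<forall>y\<in>ball x d. \<forall>z\<in>ball x d. \<bar>J y - J z - G x (y - z)\<bar> \<le> e * norm (y - z)"
    and J_nonneg: "x \<in> K \<Longrightarrow> 0 \<le> J x"
    and closed_sublevel: "closed {x\<in>K. norm x = 1 \<and> J x \<le> L}"
    and palais_smale: "(\<And>n. xs n \<in> K \<and> norm (xs n) = 1) \<Longrightarrow> (\<lambda>n. J (xs n)) \<longlonglongrightarrow> l \<Longrightarrow>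
          (\<lambda>n. G (xs n)) \<longlonglongrightarrow> 0 \<Longrightarrow> \<exists>r y. strict_mono (r :: nat \<Rightarrow> nat) \<and> (xs \<circ> r) \<longlonglongrightarrow> y"
begin

section \<open>Critical point theory on an open symmetric cone\<close>

lemma normalized_in_K: "x \<in> K \<Longrightarrow> inverse (norm x) *\<^sub>R x \<in> K"
  using scale_K[of x "inverse (norm x)"] zero_K by fastforce

lemma norm_normalized: "x \<in> K \<Longrightarrow> norm (inverse (norm x) *\<^sub>R x) = 1"
  using zero_K by (cases "x = 0") auto

lemma J_normalized: "x \<in> K \<Longrightarrow> J (inverse (norm x) *\<^sub>R x) = J x"
  using J_scale[of x "inverse (norm x)"] zero_K by fastforce

text \<open>Comparing two linear approximations along a short multiple of w and dividing by its
  length bounds their difference. Continuity and oddness of \<open>G\<close> both reduce to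
  this.\<close>

lemma deriv_close:
  assumes x: "x \<in> K" and d: "d > 0" and e: "0 \<le> e"
    and l: "\<And>y z. y \<in> ball x d \<Longrightarrow> z \<in> ball x d \<Longrightarrow> \<bar>J y - J z - blinfun_apply l (y - z)\<bar> \<le> e * norm (y - z)"
  shows "norm (G x - l) \<le> e"
proof (rule field_le_epsilon)
  fix e' :: real assume e': "e' > 0"
  obtain d' where d': "d' > 0" "\<And>y z. y \<in> ball x d' \<Longrightarrow> z \<in> ball x d' \<Longrightarrow>
      \<bar>J y - J z - G x (y - z)\<bar> \<le> e' * norm (y - z)"
    using strict_deriv[OF x e'] by blast
  show "norm (G x - l) \<le> e + e'"
  proof (rule norm_blinfun_bound)
    show "0 \<le> e + e'" using e e' by simp
    fix w
    show "norm (blinfun_apply (G x - l) w) \<le> (e + e') * norm w"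
    proof (cases "w = 0")
      case True
      then show ?thesis by (simp add: blinfun.zero_right)
    next
      case False
      define s where "s = min d d' / (2 * norm w)"
      have s: "s > 0" using d d' False by (simp add: s_def)
      have "norm (s *\<^sub>R w) < d" "norm (s *\<^sub>R w) < d'"
        using s d d' False by (auto simp: s_def min_def)
      then have "x + s *\<^sub>R w \<in> ball x d" "x + s *\<^sub>R w \<in> ball x d'"
        by (simp_all add: dist_norm)
      from l[OF this(1), of x] d'(2)[OF this(2), of x] d d'(1)
      have "\<bar>J (x + s *\<^sub>R w) - J x - l (s *\<^sub>R w)\<bar> \<le> e * norm (s *\<^sub>R w)"
        "\<bar>J (x + s *\<^sub>R w) - J x - G x (s *\<^sub>R w)\<bar> \<le> e' * norm (s *\<^sub>R w)"
        by simp_all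
      then have "\<bar>G x (s *\<^sub>R w) - l (s *\<^sub>R w)\<bar> \<le> e * norm (s *\<^sub>R w) + e' * norm (s *\<^sub>R w)"
        by linarith
      then have "\<bar>s * (G x w - l w)\<bar> \<le> (e + e') * norm (s *\<^sub>R w)"
        by (simp only: blinfun.scaleR_right real_scaleR_def right_diff_distrib distrib_right)
      then have "s * \<bar>G x w - l w\<bar> \<le> s * ((e + e') * norm w)"
        using s by (simp add: abs_mult mult.left_commute)
      then show ?thesis
        using s by (simp add: blinfun.diff_left)
    qed
  qed
qed

text \<open>The strict estimate at x, with \<open>G x\<close>, remains valid on a ball around every
  nearby y.\<close>

lemma continuous_G: "continuous_on K G"
  unfolding continuous_on_iff
proof (intro ballI allI impI)
  fix x and e :: real assume x: "x \<in> K" "e > 0"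
  obtain d where d: "d > 0" "\<And>y z. y \<in> ball x d \<Longrightarrow> z \<in> ball x d \<Longrightarrow>
      \<bar>J y - J z - G x (y - z)\<bar> \<le> e / 2 * norm (y - z)"
    using strict_deriv[of x "e / 2"] x by auto
  have "dist (G y) (G x) < e" if y: "y \<in> K" "dist y x < d / 2" for y
  proof -
    have "ball y (d / 2) \<subseteq> ball x d"
    proof
      fix z assume "z \<in> ball y (d / 2)"
      then have "dist y z < d / 2" by simp
      with y(2) show "z \<in> ball x d"
        using dist_triangle[of x z y] by (simp add: dist_commute)
    qed
    then have "norm (G y - G x) \<le> e / 2"
      using d(1) x(2) by (intro deriv_close[OF y(1), of "d / 2"] d(2)) auto
    then show ?thesis using x(2) by (simp add: dist_norm)
  qed
  then show "\<exists>d>0. \<forall>y\<in>K. dist y x < d \<longrightarrow> dist (G y) (G x) < e"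
    using d(1) half_gt_zero by blast
qed

text \<open>Reflecting the strict estimate at x through the origin makes \<open>- G x\<close> an
  approximate derivative at \<open>- x\<close> with arbitrarily small error.\<close>

lemma G_odd: assumes x: "x \<in> K" shows "G (- x) = - G x"
proof -
  have "norm (G (- x) - (- G x)) \<le> 0 + e" if e: "e > 0" for e
  proof -
    obtain d where d: "d > 0" "\<And>y z. y \<in> ball x d \<Longrightarrow> z \<in> ball x d \<Longrightarrow>
      \<bar>J y - J z - G x (y - z)\<bar> \<le> e * norm (y - z)"
      using strict_deriv[OF x e] by auto
    obtain d1 where d1: "d1 > 0" "ball (-x) d1 \<subseteq> K"
      using open_K sym_K[OF x] open_contains_ball by blast
    have "norm (G (- x) - (- G x)) \<le> e"
    proof (rule deriv_close[OF sym_K[OF x], of "min d d1"])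
      show "0 < min d d1" "0 \<le> e" using d d1 e by auto
      fix y z assume yz: "y \<in> ball (- x) (min d d1)" "z \<in> ball (- x) (min d d1)"
      have "y \<in> K" "z \<in> K" using yz d1 by auto
      then have "J (- y) = J y" "J (- z) = J z" using J_even by auto
      moreover have "- y \<in> ball x d" "- z \<in> ball x d"
        using yz norm_minus_cancel[of "x + y"] norm_minus_cancel[of "x + z"] by (auto simp: dist_norm)
      ultimately have "\<bar>J y - J z - G x (- y - - z)\<bar> \<le> e * norm (- y - - z)"
        using d(2)[of "- y" "- z"] by simp
      moreover have "G x (- y - - z) = (- G x) (y - z)"
        by (simp add: blinfun.bilinear_simps)
      moreover have "norm (- y - - z) = norm (y - z)"
        by (metis minus_diff_minus norm_minus_cancel)
      ultimately show "\<bar>J y - J z - (- G x) (y - z)\<bar> \<le> e * norm (y - z)" by simp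
    qed
    then show ?thesis by simp
  qed
  then have "norm (G (- x) - (- G x)) \<le> 0" by (rule field_le_epsilon)
  then show ?thesis by (simp add: eq_neg_iff_add_eq_0)
qed

lemma continuous_J: "continuous_on K J"
  unfolding continuous_on_eq_continuous_at[OF open_K]
proof
  fix x assume x: "x \<in> K"
  obtain d where d: "d > 0" "\<And>y z. y \<in> ball x d \<Longrightarrow> z \<in> ball x d \<Longrightarrow>
      \<bar>J y - J z - G x (y - z)\<bar> \<le> 1 * norm (y - z)"
    using strict_deriv[OF x, of 1] by auto
  have "((\<lambda>y. J y - J x) \<longlongrightarrow> 0) (at x)"
  proof (rule Lim_null_comparison)
    have "\<forall>\<^sub>F y in at x. y \<in> ball x d"
      using d(1) by (intro eventually_at_in_open') auto
    then show "\<forall>\<^sub>F y in at x. norm (J y - J x) \<le> \<bar>G x (y - x)\<bar> + norm (y - x)"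
    proof eventually_elim
      case (elim y)
      then show ?case using d(2)[of y x] d(1) by simp
    qed
    show "((\<lambda>y. \<bar>G x (y - x)\<bar> + norm (y - x)) \<longlongrightarrow> 0) (at x)"
      by (auto intro!: tendsto_eq_intros simp: blinfun.zero_right)
  qed
  then show "isCont J x"
    unfolding isCont_def using Lim_null by blast
qed

text \<open>The maps in the Ekeland argument leave the sphere, so closedness is needed off it. It is
  pulled back along a radial map which the maximum with 1/2 keeps continuous at 0.\<close>

lemma closed_annulus_sublevel: "closed {x\<in>K. norm x \<ge> 1/2 \<and> J x \<le> L}"
proof -
  define \<rho> where "\<rho> x = inverse (max (norm x) (1/2)) *\<^sub>R x" for x :: 'a
  have "continuous_on UNIV \<rho>"
    unfolding \<rho>_def by (intro continuous_intros) auto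
  then have "closed (\<rho> -` {x\<in>K. norm x = 1 \<and> J x \<le> L})"
    by (intro continuous_closed_vimage closed_sublevel) (auto simp: continuous_on_eq_continuous_at)
  moreover have "closed {x::'a. norm x \<ge> 1/2}"
    by (intro closed_Collect_le continuous_intros)
  ultimately have "closed ({x. norm x \<ge> 1/2} \<inter> \<rho> -` {x\<in>K. norm x = 1 \<and> J x \<le> L})"
    by (rule closed_Int[rotated])
  also have "{x. norm x \<ge> 1/2} \<inter> \<rho> -` {x\<in>K. norm x = 1 \<and> J x \<le> L} = {x\<in>K. norm x \<ge> 1/2 \<and> J x \<le> L}"
  proof -
    have "(\<rho> x \<in> K \<and> norm (\<rho> x) = 1 \<and> J (\<rho> x) \<le> L) \<longleftrightarrow> x \<in> K \<and> J x \<le> L" if "norm x \<ge> 1/2" for x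
    proof -
      have \<rho>: "\<rho> x = inverse (norm x) *\<^sub>R x" using that by (simp add: \<rho>_def)
      have pos: "norm x > 0" using that by linarith
      have "x \<in> K" if "\<rho> x \<in> K"
        using scale_K[OF that pos] pos by (simp add: \<rho>)
      then show ?thesis
        using normalized_in_K norm_normalized J_normalized \<rho> by metis
    qed
    then show ?thesis by auto
  qed
  finally show ?thesis .
qed

text \<open>A sublevel slightly above \<open>l\<close> is closed and contains all late terms, so the
  limit lies in K, where \<open>J\<close> and \<open>G\<close> are continuous.\<close>

lemma critical_limit:
  assumes x: "\<And>n. x n \<in> K" "\<And>n. norm (x n) = 1" and J: "(\<lambda>n. J (x n)) \<longlonglongrightarrow> l" and G: "(\<lambda>n. G (x n)) \<longlonglongrightarrow> 0"
  obtains r y where "strict_mono (r :: nat \<Rightarrow> nat)" "(x \<circ> r) \<longlonglongrightarrow> y" "y \<in> K" "norm y = 1" "J y = l" "G y = 0"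
proof -
  obtain r y where r: "strict_mono (r :: nat \<Rightarrow> nat)" "(x \<circ> r) \<longlonglongrightarrow> y"
    using palais_smale[of x l] x J G by blast
  have "\<forall>\<^sub>F n in sequentially. J (x n) \<le> l + 1"
    using order_tendstoD(2)[OF J, of "l + 1"] by (auto elim: eventually_mono)
  then have "\<forall>\<^sub>F n in sequentially. (x \<circ> r) n \<in> {x\<in>K. norm x = 1 \<and> J x \<le> l + 1}"
    using x eventually_subseq[OF r(1)] by simp
  from Lim_in_closed_set[OF closed_sublevel this _ r(2)]
  have y: "y \<in> K" "norm y = 1" by auto
  have "isCont J y" "isCont G y"
    using continuous_J continuous_G y(1) open_K by (auto simp: continuous_on_eq_continuous_at)
  then have "(\<lambda>n. J ((x \<circ> r) n)) \<longlonglongrightarrow> J y" "(\<lambda>n. G ((x \<circ> r) n)) \<longlonglongrightarrow> G y"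
    using r(2) isCont_tendsto_compose by blast+
  moreover have "(\<lambda>n. J ((x \<circ> r) n)) \<longlonglongrightarrow> l" "(\<lambda>n. G ((x \<circ> r) n)) \<longlonglongrightarrow> 0"
    using LIMSEQ_subseq_LIMSEQ[OF J r(1)] LIMSEQ_subseq_LIMSEQ[OF G r(1)] by (simp_all add: comp_def)
  ultimately have "J y = l" "G y = 0" using LIMSEQ_unique by blast+
  with r y that show thesis by blast
qed

text \<open>Near each y a fixed unit direction has slope above \<open>e\<close>; averaging these
  directions with bump weights and antisymmetrising gives an odd field. The antipodal terms keep the
  estimate because \<open>G\<close> is odd.\<close>

lemma odd_descent_field:
  assumes P: "compact P" "P \<subseteq> K" "P \<noteq> {}" and e: "e > 0" and G: "\<And>y. y \<in> P \<Longrightarrow> norm (G y) > e"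
  obtains V where "continuous_on UNIV V" "\<And>z. V (- z) = - V z" "\<And>z. norm (V z) \<le> 1"
    "\<And>y. y \<in> P \<Longrightarrow> G y (V y) \<ge> e"
proof -
  have "\<exists>r w. r > 0 \<and> norm w = 1 \<and> (\<forall>z\<in>ball y r. z \<in> K \<and> G z w > e)" if y: "y \<in> P" for y
  proof -
    obtain w where w: "\<bar>G y w\<bar> > e * norm w"
      using norm_blinfun_bound[of e "G y"] G[OF y] e by (metis less_imp_le not_le real_norm_def)
    then have w0: "norm w > 0" by (auto simp: blinfun.zero_right)
    \<comment> \<open>The sign makes the slope along \<open>w'\<close> positive, the division makes
      \<open>w'\<close> a unit vector.\<close>
    define w' where "w' = (sgn (G y w) / norm w) *\<^sub>R w"
    have "G y w \<noteq> 0" using w mult_pos_pos[OF e w0] by auto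
    then have "norm w' = 1"
      using w0 by (simp add: w'_def abs_sgn_eq)
    have "G y w' = \<bar>G y w\<bar> / norm w"
      by (simp add: w'_def blinfun.scaleR_right abs_sgn mult.commute)
    then have Gw: "G y w' > e" using w w0 by (simp add: pos_less_divide_eq)
    have "continuous_on K (\<lambda>z. G z w')"
      by (intro continuous_intros continuous_G)
    from continuous_open_preimage[OF this open_K open_greaterThan[of e]]
    have "open {z\<in>K. G z w' \<in> {e<..}}" by (simp add: vimage_def Int_def)
    moreover have "y \<in> {z\<in>K. G z w' \<in> {e<..}}" using Gw y P by auto
    ultimately obtain r where "r > 0" "ball y r \<subseteq> {z\<in>K. G z w' \<in> {e<..}}"
      using open_contains_ball by blast
    with \<open>norm w' = 1\<close> show ?thesis by blast
  qed
  then have "\<forall>y\<in>P. \<exists>r w. r > 0 \<and> norm w = 1 \<and> (\<forall>z\<in>ball y r. z \<in> K \<and> G z w > e)" by blast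
  then obtain r w where rw: "\<And>y. y \<in> P \<Longrightarrow> r y > 0" "\<And>y. y \<in> P \<Longrightarrow> norm (w y) = 1"
    "\<And>y z. y \<in> P \<Longrightarrow> z \<in> ball y (r y) \<Longrightarrow> z \<in> K" "\<And>y z. y \<in> P \<Longrightarrow> z \<in> ball y (r y) \<Longrightarrow> G z (w y) > e"
    by (metis (no_types))
  have "P \<subseteq> (\<Union>y\<in>P. ball y (r y))" using rw(1) by force
  then obtain I where I: "I \<subseteq> P" "finite I" "P \<subseteq> (\<Union>y\<in>I. ball y (r y))"
    using compactE_image[OF P(1), of P "\<lambda>y. ball y (r y)"] by auto
  define \<phi> where "\<phi> y z = max 0 (r y - dist y z)" for y z
  define W where "W z = (\<Sum>y\<in>I. (\<phi> y z - \<phi> y (- z)) *\<^sub>R w y)" for z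
  define \<Psi> where "\<Psi> z = (\<Sum>y\<in>I. \<phi> y z + \<phi> y (- z))" for z
  have \<phi>0: "\<phi> y z \<ge> 0" for y z by (simp add: \<phi>_def)
  have c\<phi>: "continuous_on UNIV (\<phi> y)" for y
    unfolding \<phi>_def by (intro continuous_intros)
  have c\<phi>': "continuous_on UNIV (\<lambda>z. \<phi> y (- z))" for y
    unfolding \<phi>_def by (intro continuous_intros)
  have cW: "continuous_on UNIV W" and c\<Psi>: "continuous_on UNIV \<Psi>"
    unfolding W_def \<Psi>_def by (intro continuous_intros c\<phi> c\<phi>')+
  have Wn: "norm (W z) \<le> \<Psi> z" for z
    unfolding W_def \<Psi>_def
  proof (rule sum_norm_le)
    fix y assume "y \<in> I"
    then show "norm ((\<phi> y z - \<phi> y (- z)) *\<^sub>R w y) \<le> \<phi> y z + \<phi> y (- z)"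
      using I(1) rw(2)[of y] \<phi>0[of y z] \<phi>0[of y "- z"] by auto
  qed
  have \<Psi>pos: "\<Psi> z > 0" if z: "z \<in> P" for z
  proof -
    obtain y where "y \<in> I" "z \<in> ball y (r y)" using I(3) z by blast
    then have "\<phi> y z + \<phi> y (- z) > 0" using \<phi>0[of y "- z"] by (simp add: \<phi>_def add_pos_nonneg)
    then show ?thesis
      unfolding \<Psi>_def using \<open>y \<in> I\<close> I(2) \<phi>0 by (intro sum_pos2[of I y]) auto
  qed
  obtain z0 where z0: "z0 \<in> P" "\<And>z. z \<in> P \<Longrightarrow> \<Psi> z0 \<le> \<Psi> z"
    using continuous_attains_inf[OF P(1,3) continuous_on_subset[OF c\<Psi>]] by auto
  define \<mu> where "\<mu> = \<Psi> z0"
  have \<mu>: "\<mu> > 0" using \<Psi>pos z0 by (simp add: \<mu>_def)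
  \<comment> \<open>\<open>\<mu>\<close> is the least total weight on P; bounding the denominator
    below by it makes V continuous everywhere without changing it on P.\<close>
  define V where "V z = inverse (max (\<Psi> z) \<mu>) *\<^sub>R W z" for z
  show thesis
  proof
    show "continuous_on UNIV V"
      unfolding V_def using \<mu> by (intro continuous_intros c\<Psi> cW) auto
    fix z :: 'a
    have "\<Psi> (- z) = \<Psi> z" by (simp add: \<Psi>_def add.commute)
    moreover have "W (- z) = - W z"
      unfolding W_def by (simp add: scaleR_left_diff_distrib flip: sum_negf)
    ultimately show "V (- z) = - V z" by (simp add: V_def)
    show "norm (V z) \<le> 1"
      using Wn[of z] \<mu> by (simp add: V_def field_simps)
  next
    fix z assume z: "z \<in> P"
    have "(\<Sum>y\<in>I. (\<phi> y z + \<phi> y (- z)) * e) \<le> (\<Sum>y\<in>I. (\<phi> y z - \<phi> y (- z)) * G z (w y))"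
    proof (rule sum_mono)
      fix y assume y: "y \<in> I"
      have a: "\<phi> y z * e \<le> \<phi> y z * G z (w y)"
      proof (cases "z \<in> ball y (r y)")
        case True
        then show ?thesis using rw(4)[of y z] y I(1) \<phi>0 by (intro mult_left_mono) auto
      qed (simp add: \<phi>_def)
      have b: "\<phi> y (- z) * e \<le> - (\<phi> y (- z) * G z (w y))"
      proof (cases "- z \<in> ball y (r y)")
        case True
        have "e < G (- z) (w y)" using rw(4)[of y "- z"] True y I(1) by auto
        also have "G (- z) = - G z" using z P by (intro G_odd) auto
        finally have "e \<le> - G z (w y)" by (simp add: blinfun.minus_left)
        then have "\<phi> y (- z) * e \<le> \<phi> y (- z) * (- G z (w y))" using \<phi>0 by (intro mult_left_mono)
        then show ?thesis by simp
      qed (simp add: \<phi>_def)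
      show "(\<phi> y z + \<phi> y (- z)) * e \<le> (\<phi> y z - \<phi> y (- z)) * G z (w y)"
        using a b by (simp add: algebra_simps)
    qed
    also have "\<dots> = G z (W z)"
      by (simp add: W_def blinfun.bilinear_simps blinfun.sum_right)
    finally have "\<Psi> z * e \<le> G z (W z)"
      by (simp add: \<Psi>_def sum_distrib_right)
    moreover have "V z = inverse (\<Psi> z) *\<^sub>R W z"
      using z0(2)[OF z] by (simp add: V_def \<mu>_def max_absorb1)
    ultimately show "G z (V z) \<ge> e"
      using \<Psi>pos[OF z] by (simp add: blinfun.scaleR_right field_simps)
  qed
qed

text \<open>An infinitesimal step along the descent field lowers the maximum of \<open>J \<circ> h\<close> at rate at least
  \<open>e\<close>; the argument is Danskin's, by passing to the limit in a sequence of bad points.\<close>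
lemma descent_step:
  fixes h V :: "'a \<Rightarrow> 'a"
  assumes M: "compact M" and h: "continuous_on M h" "h ` M \<subseteq> K" and V: "continuous_on UNIV V"
    "\<And>z. norm (V z) \<le> 1"
    and le: "\<And>x. x \<in> M \<Longrightarrow> J (h x) \<le> b" and e: "e > 0"
    and desc: "\<And>x. x \<in> M \<Longrightarrow> J (h x) = b \<Longrightarrow> G (h x) (V (h x)) \<ge> 2 * e" and s0: "s0 > 0"
  obtains s where "0 < s" "s < s0" "\<And>x. x \<in> M \<Longrightarrow> h x - s *\<^sub>R V (h x) \<in> K"
    "\<And>x. x \<in> M \<Longrightarrow> J (h x - s *\<^sub>R V (h x)) \<le> b - e * s"
proof -
  \<comment> \<open>Trial step sizes tending to 0. If each had a bad point, compactness of M would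
    give these points a limit along a subsequence.\<close>
  define s where "s n = s0 / (real n + 2)" for n
  have s: "s n > 0" "s n < s0" for n using s0 by (simp_all add: s_def field_simps add_pos_nonneg)
  have s_lim: "s \<longlonglongrightarrow> 0"
    unfolding s_def by real_asymp
  have "\<exists>n. \<forall>x\<in>M. h x - s n *\<^sub>R V (h x) \<in> K \<and> J (h x - s n *\<^sub>R V (h x)) \<le> b - e * s n"
  proof (rule ccontr)
    assume "\<not> ?thesis"
    then have "\<forall>n. \<exists>x. x \<in> M \<and> \<not> (h x - s n *\<^sub>R V (h x) \<in> K \<and> J (h x - s n *\<^sub>R V (h x)) \<le> b - e * s n)"
      by blast
    from choice[OF this] obtain x where x: "\<And>n. x n \<in> M"
      "\<And>n. \<not> (h (x n) - s n *\<^sub>R V (h (x n)) \<in> K \<and> J (h (x n) - s n *\<^sub>R V (h (x n))) \<le> b - e * s n)"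
      by blast
    obtain l r where lr: "l \<in> M" "strict_mono (r :: nat \<Rightarrow> nat)" "(x \<circ> r) \<longlonglongrightarrow> l"
      using M x(1) unfolding compact_def by meson
    define y where "y n = h (x (r n))" for n
    define z where "z n = y n - s (r n) *\<^sub>R V (y n)" for n
    define p where "p = h l"
    have pK: "p \<in> K" using lr h by (auto simp: p_def)
    have sr: "(\<lambda>n. s (r n)) \<longlonglongrightarrow> 0"
      using LIMSEQ_subseq_LIMSEQ[OF s_lim lr(2)] by (simp add: comp_def)
    have y: "y \<longlonglongrightarrow> p"
      unfolding y_def p_def using lr x(1) h(1)
      by (intro continuous_on_tendsto_compose[OF h(1)]) (auto simp: comp_def)
    have Vy: "(\<lambda>n. V (y n)) \<longlonglongrightarrow> V p"
      using V(1) y by (auto simp: continuous_on_eq_continuous_at intro: isCont_tendsto_compose)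
    have "z \<longlonglongrightarrow> p - 0 *\<^sub>R V p"
      unfolding z_def by (intro tendsto_intros y sr Vy)
    then have z: "z \<longlonglongrightarrow> p" by simp
    have zK: "\<forall>\<^sub>F n in sequentially. z n \<in> K"
      using topological_tendstoD[OF z open_K pK] .
    have Jp: "isCont J p"
      using continuous_J pK open_K by (auto simp: continuous_on_eq_continuous_at)
    have zb: "\<forall>\<^sub>F n in sequentially. b - e * s (r n) \<le> J (z n)"
      using zK
    proof eventually_elim
      case (elim n)
      then show ?case using x(2)[of "r n"] by (simp add: z_def y_def)
    qed
    have "(\<lambda>n. b - e * s (r n)) \<longlonglongrightarrow> b - e * 0" by (intro tendsto_intros sr)
    \<comment> \<open>Bad points have values at least b - e s, so their limit attains the maximum
      \<open>b\<close>; only there is the descent hypothesis available.\<close>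
    from tendsto_le[OF _ isCont_tendsto_compose[OF Jp z] this zb] have "b - e * 0 \<le> J p" by simp
    then have "J (h l) = b" using le[OF lr(1)] by (simp add: p_def)
    then have Gp: "G p (V p) \<ge> 2 * e" using desc[OF lr(1)] by (simp add: p_def)
    \<comment> \<open>With error e/3 and slope above 5/3 e along V, a step of size t lowers the
      value by at least 4/3 e t, more than the e t that a bad point permits.\<close>
    have "e / 3 > 0" using e by simp
    from strict_deriv[OF pK this] obtain d where d: "d > 0"
      "\<And>y z. y \<in> ball p d \<Longrightarrow> z \<in> ball p d \<Longrightarrow> \<bar>J y - J z - G p (y - z)\<bar> \<le> e / 3 * norm (y - z)"
      by blast
    have "\<forall>\<^sub>F n in sequentially. y n \<in> ball p d" "\<forall>\<^sub>F n in sequentially. z n \<in> ball p d"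
      using topological_tendstoD[OF y, of "ball p d"] topological_tendstoD[OF z, of "ball p d"] d(1) by auto
    moreover have "(\<lambda>n. G p (V (y n))) \<longlonglongrightarrow> G p (V p)"
      by (intro tendsto_intros Vy)
    then have "\<forall>\<^sub>F n in sequentially. G p (V (y n)) > 5/3 * e"
      using Gp e by (intro order_tendstoD(1)) auto
    ultimately have "\<forall>\<^sub>F n in sequentially. False"
      using zK
    proof eventually_elim
      case (elim n)
      define t where "t = s (r n)"
      have t: "t > 0" using s by (simp add: t_def)
      have yz: "y n - z n = t *\<^sub>R V (y n)" by (simp add: z_def t_def)
      have "norm (y n - z n) \<le> t" using V(2)[of "y n"] t by (simp add: yz)
      then have "e / 3 * norm (y n - z n) \<le> e / 3 * t" using e by (intro mult_left_mono) auto
      moreover have "\<bar>J (y n) - J (z n) - G p (y n - z n)\<bar> \<le> e / 3 * norm (y n - z n)"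
        using d(2) elim by blast
      moreover have "G p (y n - z n) \<ge> t * (5/3 * e)"
        unfolding yz using elim t by (simp add: blinfun.scaleR_right)
      moreover have "J (y n) \<le> b" using le x(1) by (simp add: y_def)
      moreover have "J (z n) > b - e * t"
        using x(2)[of "r n"] elim by (simp add: z_def y_def t_def)
      moreover have "e * t > 0" using e t by simp
      ultimately show False by (simp add: algebra_simps)
    qed
    then show False by simp
  qed
  then show thesis using s that by blast
qed

text \<open>Ekeland's principle for the maximum of \<open>J \<circ> h\<close> over M, on odd bounded
  maps with the supremum metric. Slope e and initial excess e^2 give a map within e of the identity
  on M. Were \<open>G\<close> large at all its maximum points, a descent step would contradict its
  minimality. The distance to M in the conclusion allows critical points to be localised.\<close>

lemma near_critical:
  assumes M: "compact M" "M \<noteq> {}" "M \<subseteq> K" "\<And>x. x \<in> M \<Longrightarrow> norm x = 1"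
    and e: "0 < e" "e < 1/2" and low: "\<And>x. x \<in> M \<Longrightarrow> J x \<le> a + e\<^sup>2"
    and link: "\<And>h. continuous_on UNIV h \<Longrightarrow> (\<And>x. h (- x) = - h x) \<Longrightarrow> h ` M \<subseteq> K \<Longrightarrow> \<exists>x\<in>M. a \<le> J (h x)"
  obtains v where "v \<in> K" "norm v = 1" "\<exists>x\<in>M. dist x v \<le> 2 * e" "a \<le> J v" "J v \<le> a + e\<^sup>2" "norm (G v) \<le> 3 * e"
proof -
  define b where "b = a + e\<^sup>2"
  define Z where "Z L = {x\<in>K. norm x \<ge> 1/2 \<and> J x \<le> L}" for L
  \<comment> \<open>Staying off the origin and below level \<open>b\<close> are closed conditions
    under uniform convergence, which makes \<open>E\<close> complete.\<close>
  define E where "E = {h :: 'a \<Rightarrow>\<^sub>C 'a. (\<forall>x. h (- x) = - h x) \<and> (\<forall>x\<in>M. h x \<in> Z b)}"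
  define f where "f h = Sup ((\<lambda>x. J (apply_bcontfun h x)) ` M)" for h :: "'a \<Rightarrow>\<^sub>C 'a"
  have ev: "continuous_on UNIV (\<lambda>h :: 'a \<Rightarrow>\<^sub>C 'a. h x)" for x
    unfolding continuous_on_iff by (meson UNIV_I dist_fun_lt_imp_dist_val_lt)
  have EK: "h x \<in> K" if "h \<in> E" "x \<in> M" for h x using that by (auto simp: E_def Z_def)
  have EJ: "J (h x) \<le> b" if "h \<in> E" "x \<in> M" for h x using that by (auto simp: E_def Z_def)
  have bdd: "bdd_above ((\<lambda>x. J (apply_bcontfun h x)) ` M)" if "h \<in> E" for h
    using EJ[OF that] by (auto intro!: bdd_aboveI2)
  have f_le: "f h \<le> L \<longleftrightarrow> (\<forall>x\<in>M. J (h x) \<le> L)" if "h \<in> E" for h L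
    unfolding f_def using M(2) bdd[OF that] by (subst cSup_le_iff) auto
  have fx: "J (h x) \<le> f h" if "h \<in> E" "x \<in> M" for h x
    using f_le[OF that(1)] that(2) by blast
  have closed_odd: "closed {h :: 'a \<Rightarrow>\<^sub>C 'a. \<forall>x. h (- x) = - h x}"
    by (intro closed_Collect_all closed_Collect_eq continuous_intros ev)
  have closed_Z: "closed {h :: 'a \<Rightarrow>\<^sub>C 'a. \<forall>x\<in>M. h x \<in> Z L}" for L
  proof -
    have "closed ((\<lambda>h :: 'a \<Rightarrow>\<^sub>C 'a. h x) -` Z L)" for x
      unfolding Z_def using ev[of x]
      by (intro continuous_closed_vimage closed_annulus_sublevel) (auto simp: continuous_on_eq_continuous_at)
    then have "closed (\<Inter>x\<in>M. (\<lambda>h :: 'a \<Rightarrow>\<^sub>C 'a. h x) -` Z L)" by blast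
    moreover have "{h :: 'a \<Rightarrow>\<^sub>C 'a. \<forall>x\<in>M. h x \<in> Z L} = (\<Inter>x\<in>M. (\<lambda>h. apply_bcontfun h x) -` Z L)" by auto
    ultimately show ?thesis by simp
  qed
  have E_sub: "{h\<in>E. f h \<le> L} = {h :: 'a \<Rightarrow>\<^sub>C 'a. \<forall>x. h (- x) = - h x} \<inter> {h :: 'a \<Rightarrow>\<^sub>C 'a. \<forall>x\<in>M. h x \<in> Z (min b L)}" for L
  proof -
    have "h \<in> E \<and> f h \<le> L \<longleftrightarrow> h \<in> E \<and> (\<forall>x\<in>M. J (h x) \<le> L)" for h using f_le by blast
    then show ?thesis by (auto simp: E_def Z_def)
  qed
  have lsc: "closed {h\<in>E. f h \<le> L}" for L
    unfolding E_sub by (intro closed_Int closed_odd closed_Z)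
  have "E = {h :: 'a \<Rightarrow>\<^sub>C 'a. \<forall>x. h (- x) = - h x} \<inter> {h :: 'a \<Rightarrow>\<^sub>C 'a. \<forall>x\<in>M. h x \<in> Z b}" by (auto simp: E_def)
  then have "closed E" using closed_Int[OF closed_odd closed_Z[of b]] by simp
  then have complete: "complete E" by (simp add: complete_eq_closed)
  have fa: "a \<le> f h" if h: "h \<in> E" for h
  proof -
    obtain x where "x \<in> M" "a \<le> J (h x)"
      using link[of h] h EK[OF h] by (auto simp: E_def)
    then show ?thesis using fx[OF h] by force
  qed
  \<comment> \<open>A bounded odd map that fixes the unit ball, hence M: the starting point in place
    of the identity.\<close>
  define i where "i x = inverse (max 1 (norm x)) *\<^sub>R x" for x :: 'a
  have "i \<in> bcontfun"
    unfolding i_def by (intro bcontfun_normI[of _ 1] continuous_intros) (auto simp: field_simps max_def)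
  then have h0: "apply_bcontfun (Bcontfun i) = i" by (rule Bcontfun_inverse)
  define h0 where "h0 = Bcontfun i"
  have h0x: "h0 x = x" if "x \<in> M" for x using M(4)[OF that] by (simp add: h0_def h0 i_def)
  have h0E: "h0 \<in> E"
    using M low by (auto simp: E_def Z_def h0x b_def) (simp add: h0_def h0 i_def)
  obtain h where hE: "h \<in> E" and h1: "f h + e * dist h0 h \<le> f h0"
    and h2: "\<And>g. g \<in> E \<Longrightarrow> g \<noteq> h \<Longrightarrow> f h < f g + e * dist h g"
    using ekeland_variational[OF complete lsc fa h0E e(1)] by blast
  have "f h0 \<le> b" using EJ[OF h0E] f_le[OF h0E] by blast
  then have "e * dist h0 h \<le> e * e" using h1 fa[OF hE] by (simp add: b_def power2_eq_square)
  then have dh: "dist h0 h \<le> e" using e by simp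
  have close: "dist x (h x) \<le> e" if "x \<in> M" for x
    using dist_bounded[of h0 x h] dh h0x[OF that] by simp
  have nrm: "\<bar>norm (h x) - 1\<bar> \<le> e" if "x \<in> M" for x
    using close[OF that] M(4)[OF that] norm_triangle_ineq3[of "h x" x] by (simp add: dist_norm norm_minus_commute)
  have cJh: "continuous_on M (\<lambda>x. J (h x))"
    using EK[OF hE] by (intro continuous_on_compose2[OF continuous_J]) auto
  define Q where "Q = {x\<in>M. J (h x) = f h}"
  obtain q where "q \<in> M" "\<And>x. x \<in> M \<Longrightarrow> J (h x) \<le> J (h q)"
    using continuous_attains_sup[OF M(1,2) cJh] by blast
  then have q: "q \<in> Q"
    using fx[OF hE, of q] f_le[OF hE, of "J (h q)"] by (auto simp: Q_def)
  have "closedin (top_of_set M) Q"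
    unfolding Q_def by (rule continuous_closedin_preimage_constant[OF cJh])
  then have cQ: "compact Q" using M(1) closedin_compact by blast
  have "\<exists>x\<in>Q. norm (G (h x)) \<le> 2 * e"
  proof (rule ccontr)
    assume "\<not> ?thesis"
    then have big: "\<And>y. y \<in> h ` Q \<Longrightarrow> norm (G y) > 2 * e" by fastforce
    have "compact (h ` Q)" by (intro compact_continuous_image cQ) simp
    moreover have "h ` Q \<subseteq> K" using EK[OF hE] by (auto simp: Q_def)
    ultimately obtain V where V: "continuous_on UNIV V" "\<And>z. V (- z) = - V z" "\<And>z. norm (V z) \<le> 1"
      "\<And>y. y \<in> h ` Q \<Longrightarrow> G y (V y) \<ge> 2 * e"
      using odd_descent_field[of "h ` Q" "2 * e"] q big e by auto
    have hMK: "h ` M \<subseteq> K" using EK[OF hE] by auto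
    \<comment> \<open>On M the norm of h x is at least 1 - e, so a step shorter than 1/2 - e stays
      in the annulus and the new map stays in \<open>E\<close>.\<close>
    obtain s where s: "0 < s" "s < 1/2 - e" "\<And>x. x \<in> M \<Longrightarrow> h x - s *\<^sub>R V (h x) \<in> K"
      "\<And>x. x \<in> M \<Longrightarrow> J (h x - s *\<^sub>R V (h x)) \<le> f h - e * s"
      by (rule descent_step[OF M(1) _ hMK V(1,3) fx[OF hE] e(1), where ?s0.0 = "1/2 - e"])
        (use V(4) e in \<open>auto simp: Q_def\<close>)
    define g where "g x = h x - s *\<^sub>R V (h x)" for x
    have sV: "norm (s *\<^sub>R V (h x)) \<le> s" for x using V(3)[of "h x"] s(1) by simp
    obtain B where B: "\<And>x. norm (h x) \<le> B" using norm_bounded by blast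
    have "g \<in> bcontfun"
    proof (rule bcontfun_normI)
      show "continuous_on UNIV g"
        unfolding g_def by (intro continuous_intros continuous_on_compose2[OF V(1)]) auto
      show "norm (g x) \<le> B + s" for x
      proof -
        show ?thesis
          unfolding g_def using sV[of x] B[of x] norm_triangle_ineq4[of "h x" "s *\<^sub>R V (h x)"] by linarith
      qed
    qed
    then have g: "apply_bcontfun (Bcontfun g) = g" by (rule Bcontfun_inverse)
    have gd: "dist h (Bcontfun g) \<le> s"
    proof (rule dist_bound)
      fix x
      show "dist (h x) (Bcontfun g x) \<le> s"
        unfolding g using sV[of x] by (simp add: g_def dist_norm)
    qed
    have es: "e * s > 0" using e s by simp
    have gJ: "J (g x) \<le> f h - e * s" if "x \<in> M" for x
      using s(4)[OF that] by (simp add: g_def)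
    have fb: "f h \<le> b" using f_le[OF hE] EJ[OF hE] by blast
    have gE: "Bcontfun g \<in> E"
      unfolding E_def Z_def
    proof (intro CollectI conjI ballI allI)
      show "Bcontfun g (- x) = - Bcontfun g x" for x
        unfolding g using hE V(2) by (auto simp: g_def E_def)
      fix x assume x: "x \<in> M"
      show "Bcontfun g x \<in> K" using s(3)[OF x] by (simp add: g g_def)
      show "J (Bcontfun g x) \<le> b" using gJ[OF x] fb es by (simp add: g)
      have "norm (h x) \<le> norm (g x) + s"
        using sV[of x] norm_triangle_sub[of "h x" "g x"] unfolding g_def by simp
      then show "1/2 \<le> norm (Bcontfun g x)"
        using nrm[OF x] s(2) by (simp add: g)
    qed
    have "f (Bcontfun g) \<le> f h - e * s"
      using f_le[OF gE] gJ by (simp add: g)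
    moreover have "e * dist h (Bcontfun g) \<le> e * s" using gd e by simp
    ultimately show False
      using h2[OF gE] es by force
  qed
  then obtain x where x: "x \<in> M" "J (h x) = f h" "norm (G (h x)) \<le> 2 * e" by (auto simp: Q_def)
  define v where "v = inverse (norm (h x)) *\<^sub>R h x"
  have hxK: "h x \<in> K" using EK hE x by blast
  have n0: "norm (h x) > 0" using nrm[OF x(1)] e by linarith
  have "norm (h x - v) \<le> e"
  proof -
    have "h x - v = (1 - inverse (norm (h x))) *\<^sub>R h x" by (simp add: v_def scaleR_left_diff_distrib)
    then have "norm (h x - v) = \<bar>(1 - inverse (norm (h x))) * norm (h x)\<bar>"
      by (simp add: abs_mult)
    also have "(1 - inverse (norm (h x))) * norm (h x) = norm (h x) - 1"
      using n0 by (simp add: left_diff_distrib)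
    finally show ?thesis using nrm[OF x(1)] by simp
  qed
  then have "dist x v \<le> 2 * e"
    using close[OF x(1)] dist_triangle[of x v "h x"] by (simp add: dist_norm)
  \<comment> \<open>\<open>G\<close> is homogeneous of degree -1 and the norm of h x is at most 3/2,
    which turns 2e into 3e.\<close>
  moreover have "norm (G v) \<le> 3 * e"
  proof -
    have "G v = norm (h x) *\<^sub>R G (h x)"
      unfolding v_def using G_scale[OF hxK, of "inverse (norm (h x))"] n0 by (simp add: divide_inverse)
    then have "norm (G v) = norm (h x) * norm (G (h x))" by simp
    also have "\<dots> \<le> (3/2) * (2 * e)"
      using nrm[OF x(1)] x(3) e by (intro mult_mono) auto
    finally show ?thesis by simp
  qed
  ultimately show thesis
    using that[of v] x fa[OF hE] EJ[OF hE x(1)] normalized_in_K[OF hxK] norm_normalized[OF hxK] J_normalized[OF hxK]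
    by (auto simp: v_def b_def)
qed

text \<open>The odd image normalises to an admissible set on which \<open>J\<close> takes the same
  values, so its maximum cannot lie below the level.\<close>

lemma minimax_link:
  assumes M: "M \<in> minimax_sets K k" and k: "1 \<le> k"
    and h: "continuous_on M h" "\<And>x. x \<in> M \<Longrightarrow> h (- x) = - h x" "h ` M \<subseteq> K"
  shows "\<exists>x\<in>M. minimax K J k \<le> J (h x)"
proof -
  let ?h = "\<lambda>x. inverse (norm (h x)) *\<^sub>R h x"
  have hM: "?h ` M \<in> minimax_sets K k"
    using M h zero_K scale_K by (intro minimax_sets_normalize) (auto simp: minimax_sets_def)
  have "continuous_on M (\<lambda>x. J (h x))"
    using h by (intro continuous_on_compose2[OF continuous_J]) auto
  moreover have "compact M" using M by (simp add: minimax_sets_def)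
  ultimately obtain x where x: "x \<in> M" "\<And>y. y \<in> M \<Longrightarrow> J (h y) \<le> J (h x)"
    using continuous_attains_sup[of M "\<lambda>x. J (h x)"] minimax_sets_nonempty[OF M k] by blast
  have "minimax K J k \<le> J (h x)"
  proof (rule minimax_le[OF hM k _ J_nonneg])
    fix z assume "z \<in> ?h ` M"
    then obtain y where "y \<in> M" "z = ?h y" by blast
    then show "J z \<le> J (h x)" using x(2) h(3) J_normalized[of "h y"] by auto
  qed
  with x(1) show ?thesis by blast
qed

lemma minimax_le_level:
  assumes "1 \<le> k" "k \<le> l" "minimax_sets K l \<noteq> {}"
  shows "minimax K J k \<le> minimax K J l"
proof (rule field_le_epsilon)
  fix e :: real assume "e > 0"
  then obtain M where M: "M \<in> minimax_sets K l" "\<And>x. x \<in> M \<Longrightarrow> J x < minimax K J l + e"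
    using minimax_lessD[OF assms(3) continuous_J, of "minimax K J l + e"] by auto
  then have "M \<in> minimax_sets K k" using minimax_sets_mono[OF assms(2) order_refl] by blast
  then show "minimax K J k \<le> minimax K J l + e"
    using M(2) assms(1) J_nonneg by (intro minimax_le) (auto intro: less_imp_le)
qed

text \<open>Admissible sets within e^2 of the level give almost critical points; for e tending to 0
  they form a Palais-Smale sequence at the level.\<close>

theorem minimax_critical:
  assumes k: "1 \<le> k" "minimax_sets K k \<noteq> {}"
  obtains x where "x \<in> K" "norm x = 1" "J x = minimax K J k" "G x = 0"
proof -
  define e where "e n = 1 / (real n + 3)" for n
  have e: "0 < e n" "e n < 1/2" for n by (auto simp: e_def field_simps)
  have e0: "e \<longlonglongrightarrow> 0" unfolding e_def by real_asymp
  let ?a = "minimax K J k"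
  have "\<exists>v. v \<in> K \<and> norm v = 1 \<and> ?a \<le> J v \<and> J v \<le> ?a + (e n)\<^sup>2 \<and> norm (G v) \<le> 3 * e n" for n
  proof -
    have "?a < ?a + (e n)\<^sup>2" using e[of n] by simp
    from minimax_lessD[OF k(2) continuous_J this] obtain M where
      M: "M \<in> minimax_sets K k" "\<And>x. x \<in> M \<Longrightarrow> J x < ?a + (e n)\<^sup>2" by blast
    have link: "\<exists>x\<in>M. ?a \<le> J (h x)" if "continuous_on UNIV h" "\<And>x. h (- x) = - h x" "h ` M \<subseteq> K" for h
      by (intro minimax_link[OF M(1) k(1)] continuous_on_subset[OF that(1)] that subset_UNIV)
    have M': "compact M" "M \<subseteq> K" "\<And>x. x \<in> M \<Longrightarrow> norm x = 1"
      using M(1) by (auto simp: minimax_sets_def)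
    obtain v where "v \<in> K" "norm v = 1" "?a \<le> J v" "J v \<le> ?a + (e n)\<^sup>2" "norm (G v) \<le> 3 * e n"
      by (rule near_critical[OF M'(1) minimax_sets_nonempty[OF M(1) k(1)] M'(2,3) e less_imp_le[OF M(2)] link]) blast+
    then show ?thesis by blast
  qed
  then have "\<forall>n. \<exists>v. v \<in> K \<and> norm v = 1 \<and> ?a \<le> J v \<and> J v \<le> ?a + (e n)\<^sup>2 \<and> norm (G v) \<le> 3 * e n" by blast
  from choice[OF this] obtain v where v: "\<And>n. v n \<in> K" "\<And>n. norm (v n) = 1"
    "\<And>n. ?a \<le> J (v n)" "\<And>n. J (v n) \<le> ?a + (e n)\<^sup>2" "\<And>n. norm (G (v n)) \<le> 3 * e n" by blast
  have "(\<lambda>n. J (v n)) \<longlonglongrightarrow> ?a"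
  proof (rule tendsto_sandwich[OF _ _ tendsto_const])
    show "(\<lambda>n. ?a + (e n)\<^sup>2) \<longlonglongrightarrow> ?a" using e0 by (auto intro!: tendsto_eq_intros)
  qed (use v in auto)
  moreover have "(\<lambda>n. G (v n)) \<longlonglongrightarrow> 0"
  proof (rule Lim_null_comparison)
    show "(\<lambda>n. 3 * e n) \<longlonglongrightarrow> 0" using e0 by (auto intro!: tendsto_eq_intros)
  qed (use v in auto)
  ultimately obtain r x where "x \<in> K" "norm x = 1" "J x = ?a" "G x = 0"
    by (rule critical_limit[OF v(1,2)])
  then show thesis by (rule that)
qed

text \<open>Bounded levels would converge to some L with compact critical set \<open>Cr\<close>.
  Cutting a neighbourhood of \<open>Cr\<close> out of almost optimal sets costs a fixed amount of
  genus and leaves levels close to L; the almost critical points near the remainder would then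
  accumulate in \<open>Cr\<close>, which the cut excludes.\<close>

theorem minimax_at_top:
  assumes ne: "\<And>k. minimax_sets K k \<noteq> {}"
  shows "filterlim (minimax K J) at_top sequentially"
proof -
  \<comment> \<open>Shifted by one because levels are known to be monotone from index 1 on.\<close>
  define c where "c k = minimax K J (Suc k)" for k
  have inc: "incseq c"
    unfolding c_def by (intro incseq_SucI minimax_le_level ne) auto
  have "filterlim c at_top sequentially"
  proof (rule ccontr)
    assume "\<not> ?thesis"
    then obtain B where "\<exists>\<^sub>F k in sequentially. \<not> c k \<ge> B"
      unfolding filterlim_at_top frequently_def by auto
    then have "c k \<le> B" for k
      using inc unfolding frequently_sequentially incseq_def by (meson le_cases order_trans)
    from incseq_convergent[OF inc] this obtain L where L: "c \<longlonglongrightarrow> L" "\<And>k. c k \<le> L" by blast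
    define Cr where "Cr = {x\<in>K. norm x = 1 \<and> J x = L \<and> G x = 0}"
    have "compact Cr"
      unfolding compact_def
    proof (intro allI impI)
      fix x :: "nat \<Rightarrow> 'a" assume x: "\<forall>n. x n \<in> Cr"
      have "\<And>n. x n \<in> K" "\<And>n. norm (x n) = 1" "(\<lambda>n. J (x n)) \<longlonglongrightarrow> L" "(\<lambda>n. G (x n)) \<longlonglongrightarrow> 0"
        using x by (auto simp: Cr_def)
      then obtain r y where "strict_mono (r :: nat \<Rightarrow> nat)" "(x \<circ> r) \<longlonglongrightarrow> y" "y \<in> K" "norm y = 1" "J y = L" "G y = 0"
        by (rule critical_limit)
      then show "\<exists>l\<in>Cr. \<exists>r. strict_mono r \<and> (x \<circ> r) \<longlonglongrightarrow> l" by (auto simp: Cr_def)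
    qed
    then obtain I where I: "I \<subseteq> Cr" "finite I" "Cr \<subseteq> (\<Union>y\<in>I. ball y (1/2))"
      using compactE_image[of Cr Cr "\<lambda>y. ball y (1/2)"] by force
    obtain m :: nat and p where p: "I = p ` {i. i < m}"
      using finite_imp_nat_seg_image_inj_on[OF I(2)] by blast
    \<comment> \<open>Unit vectors have distance 2 from their antipodes, so for x in
      \<open>Cr\<close> near \<open>p j\<close> the second bump vanishes and the difference is
      positive; hence \<open>Cr \<subseteq> U\<close>.\<close>
    define \<phi> where "\<phi> j x = max 0 (1/2 - dist (p j) x) - max 0 (1/2 - dist (p j) (- x))" for j x
    define U where "U = (\<Union>j\<in>{..<m}. {x. \<phi> j x \<noteq> 0})"
    have c\<phi>: "continuous_on S (\<phi> j)" for S j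
      unfolding \<phi>_def by (intro continuous_intros)
    have odd\<phi>: "\<phi> j (- x) = - \<phi> j x" for j x by (simp add: \<phi>_def)
    have "open U"
      unfolding U_def using c\<phi> by (intro open_UN ballI open_Collect_neq continuous_intros)
    have "Cr \<subseteq> U"
    proof
      fix x assume x: "x \<in> Cr"
      then obtain j where j: "j < m" "dist (p j) x < 1/2" using I(3) p by auto
      have "dist x (- x) = 2"
        using x by (simp add: Cr_def dist_norm flip: scaleR_2)
      then have "dist (p j) (- x) > 1/2"
        using j(2) dist_triangle[of x "- x" "p j"] by (simp add: dist_commute)
      then have "\<phi> j x \<noteq> 0" using j(2) by (simp add: \<phi>_def)
      with j(1) show "x \<in> U" by (auto simp: U_def)
    qed
    define e where "e n = 1 / (real n + 3)" for n
    have e: "0 < e n" "e n < 1/2" for n by (auto simp: e_def field_simps)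
    have e0: "e \<longlonglongrightarrow> 0" unfolding e_def by real_asymp
    have "\<exists>v. v \<in> K \<and> norm v = 1 \<and> (\<exists>x. x \<notin> U \<and> dist x v \<le> 2 * e n) \<and>
        L - (e n)\<^sup>2 / 2 \<le> J v \<and> J v \<le> L + (e n)\<^sup>2 / 2 \<and> norm (G v) \<le> 3 * e n" for n
    proof -
      have e2: "(e n)\<^sup>2 > 0" using e[of n] by simp
      have "\<forall>\<^sub>F k in sequentially. L - (e n)\<^sup>2 / 2 < c k"
        using e2 by (intro order_tendstoD(1)[OF L(1)]) simp
      then obtain k where k: "L - (e n)\<^sup>2 / 2 < minimax K J (Suc k)"
        unfolding c_def by (auto simp: eventually_sequentially)
      \<comment> \<open>The reserve \<open>m\<close> pays for the removal of \<open>U\<close>: M is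
        taken at index \<open>Suc k + m\<close>, and the rest still links at index
        \<open>Suc k\<close>. Both levels are within e^2/2 of L, which makes up the gap e^2 required
        by \<open>near_critical\<close>.\<close>
      have "minimax K J (Suc k + m) < L + (e n)\<^sup>2 / 2"
        using L(2)[of "k + m"] e2 unfolding c_def add_Suc by linarith
      from minimax_lessD[OF ne continuous_J this] obtain M where M: "M \<in> minimax_sets K (Suc k + m)"
        "\<And>x. x \<in> M \<Longrightarrow> J x < L + (e n)\<^sup>2 / 2" by blast
      define M' where "M' = {x\<in>M. \<forall>j<m. \<phi> j x = 0}"
      have g: "enat (Suc k) \<le> genus M'"
        unfolding M'_def using M(1) c\<phi> odd\<phi> by (intro enat_le_genus_remove) (auto simp: minimax_sets_def)
      have "M' = M - U" by (auto simp: M'_def U_def)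
      then have "compact M'" using M(1) \<open>open U\<close> by (simp add: minimax_sets_def compact_diff)
      then have M'k: "M' \<in> minimax_sets K (Suc k)"
        using g M(1) odd\<phi> by (auto simp: minimax_sets_def M'_def)
      have link: "\<exists>x\<in>M'. L - (e n)\<^sup>2 / 2 \<le> J (h x)"
        if h: "continuous_on UNIV h" "\<And>x. h (- x) = - h x" "h ` M' \<subseteq> K" for h
      proof -
        have "\<exists>x\<in>M'. minimax K J (Suc k) \<le> J (h x)"
          by (intro minimax_link[OF M'k] continuous_on_subset[OF h(1)] h subset_UNIV) simp
        then show ?thesis using k by force
      qed
      have top: "J x \<le> L - (e n)\<^sup>2 / 2 + (e n)\<^sup>2" if "x \<in> M'" for x
        using M(2)[of x] that by (simp add: M'_def)
      have M'': "compact M'" "M' \<subseteq> K" "\<And>x. x \<in> M' \<Longrightarrow> norm x = 1" "M' \<noteq> {}"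
        using M'k minimax_sets_nonempty[OF M'k] by (auto simp: minimax_sets_def)
      obtain v where v: "v \<in> K" "norm v = 1" "\<exists>x\<in>M'. dist x v \<le> 2 * e n" "L - (e n)\<^sup>2 / 2 \<le> J v"
          "J v \<le> L - (e n)\<^sup>2 / 2 + (e n)\<^sup>2" "norm (G v) \<le> 3 * e n"
        by (rule near_critical[OF M''(1,4,2,3) e top link])
      from v(3) have "\<exists>x. x \<notin> U \<and> dist x v \<le> 2 * e n" using \<open>M' = M - U\<close> by blast
      with v show ?thesis by (intro exI[of _ v]) auto
    qed
    then have "\<forall>n. \<exists>v. v \<in> K \<and> norm v = 1 \<and> (\<exists>x. x \<notin> U \<and> dist x v \<le> 2 * e n) \<and>
        L - (e n)\<^sup>2 / 2 \<le> J v \<and> J v \<le> L + (e n)\<^sup>2 / 2 \<and> norm (G v) \<le> 3 * e n" by blast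
    from choice[OF this] obtain v where v: "\<And>n. v n \<in> K" "\<And>n. norm (v n) = 1"
      "\<And>n. \<exists>x. x \<notin> U \<and> dist x (v n) \<le> 2 * e n"
      "\<And>n. L - (e n)\<^sup>2 / 2 \<le> J (v n)" "\<And>n. J (v n) \<le> L + (e n)\<^sup>2 / 2" "\<And>n. norm (G (v n)) \<le> 3 * e n" by blast
    have "(\<lambda>n. J (v n)) \<longlonglongrightarrow> L"
    proof (rule tendsto_sandwich)
      show "(\<lambda>n. L - (e n)\<^sup>2 / 2) \<longlonglongrightarrow> L" "(\<lambda>n. L + (e n)\<^sup>2 / 2) \<longlonglongrightarrow> L"
        using e0 by (auto intro!: tendsto_eq_intros)
    qed (use v in auto)
    moreover have "(\<lambda>n. G (v n)) \<longlonglongrightarrow> 0"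
    proof (rule Lim_null_comparison)
      show "(\<lambda>n. 3 * e n) \<longlonglongrightarrow> 0" using e0 by (auto intro!: tendsto_eq_intros)
    qed (use v in auto)
    ultimately obtain r y where y: "strict_mono (r :: nat \<Rightarrow> nat)" "(v \<circ> r) \<longlonglongrightarrow> y" "y \<in> K" "norm y = 1"
      "J y = L" "G y = 0"
      by (rule critical_limit[OF v(1,2)])
    then have "y \<in> U" using \<open>Cr \<subseteq> U\<close> by (auto simp: Cr_def)
    then obtain d where d: "d > 0" "ball y d \<subseteq> U" using \<open>open U\<close> open_contains_ball by blast
    have "(\<lambda>n. e (r n)) \<longlonglongrightarrow> 0" using LIMSEQ_subseq_LIMSEQ[OF e0 y(1)] by (simp add: comp_def)
    then have "(\<lambda>n. 2 * e (r n) + dist ((v \<circ> r) n) y) \<longlonglongrightarrow> 2 * 0 + dist y y"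
      by (intro tendsto_intros y(2))
    from order_tendstoD(2)[OF this, of d] d(1) obtain n where n: "2 * e (r n) + dist (v (r n)) y < d"
      by (auto simp: eventually_sequentially)
    obtain x where x: "x \<notin> U" "dist x (v (r n)) \<le> 2 * e (r n)" using v(3) by blast
    have "dist y x < d" using n x(2) dist_triangle[of x y "v (r n)"] by (simp add: dist_commute)
    then show False using d(2) x(1) by auto
  qed
  then show ?thesis
    unfolding c_def by (subst (asm) filterlim_sequentially_Suc)
qed

end

section \<open>Reduction along rays\<close>

lemma C1_on_has_derivative:
  assumes "C1_on F S" "u \<in> S"
  shows "(F has_derivative blinfun_apply (dual_deriv F u)) (at u)"
proof -
  have "(F has_derivative frechet_derivative F (at u)) (at u)"
    using assms by (simp add: C1_on_def frechet_derivative_works)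
  then show ?thesis
    unfolding dual_deriv_def by (subst bounded_linear_Blinfun_apply) (auto dest: has_derivative_bounded_linear)
qed

lemma dual_deriv_eqI:
  assumes "(F has_derivative blinfun_apply l) (at u)"
  shows "dual_deriv F u = l"
  unfolding dual_deriv_def frechet_derivative_at[OF assms, symmetric] by (rule blinfun_apply_inverse)

text \<open>Mean value inequality on a ball where f' stays within e of its value at p.\<close>

lemma strict_differentiability:
  fixes f :: "'a::real_normed_vector \<Rightarrow> real" and f' :: "'a \<Rightarrow> 'a \<Rightarrow>\<^sub>L real"
  assumes S: "open S" "p \<in> S" and f: "\<And>x. x \<in> S \<Longrightarrow> (f has_derivative f' x) (at x)"
    and f': "continuous_on S f'" and e: "e > 0"
  obtains d where "d > 0" "ball p d \<subseteq> S"
    "\<And>y z. y \<in> ball p d \<Longrightarrow> z \<in> ball p d \<Longrightarrow> \<bar>f y - f z - f' p (y - z)\<bar> \<le> e * norm (y - z)"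
proof -
  obtain d1 where d1: "d1 > 0" "ball p d1 \<subseteq> S" using S open_contains_ball by blast
  obtain d2 where d2: "d2 > 0" "\<And>y. y \<in> S \<Longrightarrow> dist y p < d2 \<Longrightarrow> dist (f' y) (f' p) < e"
    using f' S(2) e unfolding continuous_on_iff by blast
  define d where "d = min d1 d2"
  have d: "d > 0" "ball p d \<subseteq> S" using d1 d2 by (auto simp: d_def)
  moreover have "\<bar>f y - f z - f' p (y - z)\<bar> \<le> e * norm (y - z)" if yz: "y \<in> ball p d" "z \<in> ball p d" for y z
  proof -
    have "norm (f y - f z - f' p (y - z)) \<le> norm (y - z) * e"
    proof (rule differentiable_bound_linearization[where S = "ball p d"])
      fix t :: real assume t: "t \<in> {0..1}"
      have "z + t *\<^sub>R (y - z) = (1 - t) *\<^sub>R z + t *\<^sub>R y" by (simp add: algebra_simps)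
      also have "\<dots> \<in> ball p d"
        using t yz by (intro convexD[OF convex_ball]) auto
      finally show "z + t *\<^sub>R (y - z) \<in> ball p d" .
    next
      fix x assume x: "x \<in> ball p d"
      then have "x \<in> S" "dist x p < d2" using d by (auto simp: d_def dist_commute)
      then show "(f has_derivative f' x) (at x within ball p d)"
        using f has_derivative_at_withinI by blast
      have "onorm (\<lambda>w. f' x w - f' p w) = norm (f' x - f' p)"
        by (simp add: norm_blinfun.rep_eq minus_blinfun.rep_eq fun_diff_def)
      then show "onorm (blinfun_apply (f' x) - blinfun_apply (f' p)) \<le> e"
        using d2(2)[OF \<open>x \<in> S\<close> \<open>dist x p < d2\<close>] by (simp add: dist_norm fun_diff_def)
    qed (use d in auto)
    then show ?thesis by (simp add: mult.commute)
  qed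
  ultimately show thesis by (rule that)
qed

locale homogeneous_functionals =
  fixes N A B :: "'a::banach \<Rightarrow> real" and \<alpha> \<eta> \<beta> C :: real
  assumes exponents: "1 < \<alpha>" "\<alpha> < \<eta>" "\<eta> < \<beta>"
    and C1: "C1_on N UNIV" "C1_on A UNIV" "C1_on B UNIV"
    and even: "even_functional N" "even_functional A" "even_functional B"
    and homog: "homogeneous \<eta> N" "homogeneous \<alpha> A" "homogeneous \<beta> B"
    and C_pos: "C > 0"
    and bounds: "N u \<le> C * norm u powr \<eta>" "N u \<ge> inverse C * norm u powr \<eta>"
      "\<bar>A u\<bar> \<le> C * norm u powr \<alpha>" "\<bar>B u\<bar> \<le> C * norm u powr \<beta>"
    and PS: "bounded (range l) \<Longrightarrow> bounded (range us) \<Longrightarrow>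
           bounded (range (\<lambda>n. Phi \<eta> \<alpha> \<beta> N A B (l n) (us n))) \<Longrightarrow>
           (\<lambda>n. dual_deriv (Phi \<eta> \<alpha> \<beta> N A B (l n)) (us n)) \<longlonglongrightarrow> 0 \<Longrightarrow>
           \<exists>r x. strict_mono (r :: nat \<Rightarrow> nat) \<and> (us \<circ> r) \<longlonglongrightarrow> x"
begin

lemma even_eq [simp]: "N (- u) = N u" "A (- u) = A u" "B (- u) = B u"
  using even by (auto simp: even_functional_def)

lemma homog_eq:
  assumes "t > 0"
  shows "N (t *\<^sub>R u) = t powr \<eta> * N u" "A (t *\<^sub>R u) = t powr \<alpha> * A u" "B (t *\<^sub>R u) = t powr \<beta> * B u"
  using homog assms by (auto simp: homogeneous_def)

lemmas deriv_NAB = C1_on_has_derivative[OF C1(1) UNIV_I] C1_on_has_derivative[OF C1(2) UNIV_I]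
  C1_on_has_derivative[OF C1(3) UNIV_I]

lemma continuous_deriv: "continuous_on S (dual_deriv N)" "continuous_on S (dual_deriv A)" "continuous_on S (dual_deriv B)"
  using C1 by (auto simp: C1_on_def intro: continuous_on_subset)

lemma continuous_NAB: "continuous_on S N" "continuous_on S A" "continuous_on S B"
  by (auto intro!: continuous_at_imp_continuous_on has_derivative_continuous deriv_NAB)

lemma dual_deriv_Phi:
  "dual_deriv (Phi \<eta> \<alpha> \<beta> N A B l) u
     = (1 / \<eta>) *\<^sub>R dual_deriv N u - (l / \<alpha>) *\<^sub>R dual_deriv A u - (1 / \<beta>) *\<^sub>R dual_deriv B u"
  using exponents by (intro dual_deriv_eqI)
    (auto simp: Phi_def[abs_def] blinfun.bilinear_simps intro!: derivative_eq_intros deriv_NAB)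

text \<open>The functional \<open>\<lambda>\<^sub>c\<close>; it has the junk value 0 where \<open>A u = 0\<close>.\<close>
definition energy_param :: "real \<Rightarrow> 'a \<Rightarrow> real" where
  "energy_param c u = \<alpha> * (N u / \<eta> - B u / \<beta> - c) / A u"

lemma Phi_energy_param:
  assumes "A u \<noteq> 0"
  shows "Phi \<eta> \<alpha> \<beta> N A B (energy_param c u) u = c"
  using assms exponents by (simp add: Phi_def energy_param_def field_simps)

text \<open>By the quotient rule, with the quotient itself reinserted as the parameter, this is the
  derivative of \<open>energy_param c\<close> where A u is nonzero. So its zeros are critical points
  of \<open>Phi\<close> at energy c.\<close>

definition energy_deriv :: "real \<Rightarrow> 'a \<Rightarrow> 'a \<Rightarrow>\<^sub>L real" where
  "energy_deriv c u = (\<alpha> / A u) *\<^sub>R dual_deriv (Phi \<eta> \<alpha> \<beta> N A B (energy_param c u)) u"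

lemma has_derivative_energy_param:
  assumes "A u \<noteq> 0"
  shows "(energy_param c has_derivative blinfun_apply (energy_deriv c u)) (at u)"
proof -
  have "((\<lambda>v. \<alpha> * (N v / \<eta> - B v / \<beta> - c) / A v) has_derivative blinfun_apply (energy_deriv c u)) (at u)"
    using assms exponents
    by (auto intro!: derivative_eq_intros deriv_NAB ext simp: energy_deriv_def dual_deriv_Phi
        energy_param_def blinfun.bilinear_simps divide_simps) (simp add: algebra_simps)
  then show ?thesis by (simp add: energy_param_def[abs_def])
qed

lemma continuous_energy: 
  assumes "\<And>u. u \<in> S \<Longrightarrow> A u \<noteq> 0"
  shows "continuous_on S (energy_param c)" "continuous_on S (energy_deriv c)"
proof -
  show *: "continuous_on S (energy_param c)"
    unfolding energy_param_def[abs_def] using assms exponents by (intro continuous_intros continuous_NAB) auto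
  show "continuous_on S (energy_deriv c)"
    unfolding energy_deriv_def[abs_def] dual_deriv_Phi using assms exponents
    by (intro continuous_intros continuous_NAB continuous_deriv *) auto
qed

definition fiber :: "real \<Rightarrow> 'a \<Rightarrow> real \<Rightarrow> real" where
  "fiber c u t = t powr (\<eta> - \<alpha>) * N u / \<eta> - t powr (\<beta> - \<alpha>) * B u / \<beta> - c * t powr (- \<alpha>)"

text \<open>For t > 0 this is t^(\<alpha> + 1) times the derivative of \<open>fiber\<close>: the
  same sign, but the energy now enters as an additive constant.\<close>

definition slope :: "real \<Rightarrow> 'a \<Rightarrow> real \<Rightarrow> real" where
  "slope c u t = (\<eta> - \<alpha>) / \<eta> * t powr \<eta> * N u - (\<beta> - \<alpha>) / \<beta> * t powr \<beta> * B u + \<alpha> * c"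

lemma energy_param_scale:
  assumes "t > 0"
  shows "energy_param c (t *\<^sub>R u) = \<alpha> / A u * fiber c u t"
  using assms by (simp add: energy_param_def fiber_def homog_eq powr_diff powr_minus divide_simps)

lemma DERIV_fiber:
  assumes "t > 0"
  shows "(fiber c u has_real_derivative t powr (- \<alpha> - 1) * slope c u t) (at t)"
proof -
  have "(fiber c u has_real_derivative (\<eta> - \<alpha>) * t powr (\<eta> - \<alpha> - 1) * N u / \<eta>
      - (\<beta> - \<alpha>) * t powr (\<beta> - \<alpha> - 1) * B u / \<beta> - c * (- \<alpha> * t powr (- \<alpha> - 1))) (at t)"
    unfolding fiber_def[abs_def] using assms exponents
    by (auto intro!: derivative_eq_intros)
  moreover have "t powr (\<eta> - \<alpha> - 1) = t powr (- \<alpha> - 1) * t powr \<eta>" "t powr (\<beta> - \<alpha> - 1) = t powr (- \<alpha> - 1) * t powr \<beta>"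
    by (simp_all add: algebra_simps flip: powr_add)
  ultimately show ?thesis
    by (simp add: slope_def algebra_simps)
qed

lemma slope_scale:
  assumes "s > 0" "t > 0"
  shows "slope c (s *\<^sub>R u) t = slope c u (s * t)"
  using assms by (simp add: slope_def homog_eq powr_mult mult_ac)

lemma continuous_slope: "continuous_on S (\<lambda>u. slope c u t)"
  unfolding slope_def by (intro continuous_intros continuous_NAB)

text \<open>The sign \<open>\<sigma>\<close> is \<open>1\<close> for a minimum and \<open>-1\<close> for a maximum of \<open>energy_param c\<close> along the ray of \<open>u\<close>;
  \<open>W\<close> is the window of admissible radii, so that parameters of rescaled points correspond.\<close>
definition is_turn :: "real \<Rightarrow> real \<Rightarrow> real set \<Rightarrow> 'a \<Rightarrow> real \<Rightarrow> bool" where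
  "is_turn c \<sigma> W u t \<longleftrightarrow> t * norm u \<in> W \<and>
     (\<forall>s. s * norm u \<in> W \<longrightarrow> (s < t \<longrightarrow> \<sigma> * slope c u s < 0) \<and> (t < s \<longrightarrow> 0 < \<sigma> * slope c u s))"

definition turn :: "real \<Rightarrow> real \<Rightarrow> real set \<Rightarrow> 'a \<Rightarrow> real" where
  "turn c \<sigma> W u = (SOME t. is_turn c \<sigma> W u t)"

definition reduced :: "real \<Rightarrow> real \<Rightarrow> real set \<Rightarrow> 'a \<Rightarrow> real" where
  "reduced c \<sigma> W u = energy_param c (turn c \<sigma> W u *\<^sub>R u)"

definition reduced_deriv :: "real \<Rightarrow> real \<Rightarrow> real set \<Rightarrow> 'a \<Rightarrow> 'a \<Rightarrow>\<^sub>L real" where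
  "reduced_deriv c \<sigma> W u = turn c \<sigma> W u *\<^sub>R energy_deriv c (turn c \<sigma> W u *\<^sub>R u)"

end

text \<open>Common frame for minima and maxima along rays. Turning points are assumed on unit
  vectors only, scaling supplies the rest; openness of \<open>W\<close> lets nearby radii compete,
  and the interval property gives uniqueness.\<close>

locale fibering = homogeneous_functionals +
  fixes c \<sigma> :: real and W :: "real set" and K :: "'a set"
  assumes W: "open W" "is_interval W" "W \<subseteq> {0<..}" and \<sigma>: "\<sigma> = 1 \<or> \<sigma> = - 1"
    and K: "open K" "\<And>u. u \<in> K \<Longrightarrow> - u \<in> K" "\<And>u t. u \<in> K \<Longrightarrow> t > 0 \<Longrightarrow> t *\<^sub>R u \<in> K" "\<And>u. u \<in> K \<Longrightarrow> A u > 0"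
    and turning: "u \<in> K \<Longrightarrow> norm u = 1 \<Longrightarrow> \<exists>t. is_turn c \<sigma> W u t"
begin

abbreviation "\<tau> \<equiv> turn c \<sigma> W"
abbreviation "J \<equiv> reduced c \<sigma> W"
abbreviation "G \<equiv> reduced_deriv c \<sigma> W"

section \<open>Regularity of the extremal values along rays\<close>

lemma K_nz: "u \<in> K \<Longrightarrow> u \<noteq> 0"
  using K(4)[of u] bounds(3)[of 0] exponents by auto

lemma turn_pos: "u \<in> K \<Longrightarrow> is_turn c \<sigma> W u t \<Longrightarrow> t > 0"
  using W(3) K_nz[of u] by (auto simp: is_turn_def zero_less_mult_iff dest!: subsetD)

lemma turn_scale:
  assumes "u \<in> K" "s > 0" "is_turn c \<sigma> W u t"
  shows "is_turn c \<sigma> W (s *\<^sub>R u) (t / s)"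
  unfolding is_turn_def
proof (intro conjI allI impI)
  show "t / s * norm (s *\<^sub>R u) \<in> W" using assms by (simp add: is_turn_def)
  fix r assume r: "r * norm (s *\<^sub>R u) \<in> W"
  then have rW: "(s * r) * norm u \<in> W" using assms(2) by (simp add: ac_simps)
  then have "s * r > 0"
    using W(3) K_nz[OF assms(1)] by (auto simp: zero_less_mult_iff dest!: subsetD)
  then have "r > 0" using assms(2) by (simp add: zero_less_mult_iff)
  then have *: "slope c (s *\<^sub>R u) r = slope c u (s * r)" by (intro slope_scale assms(2))
  show "\<sigma> * slope c (s *\<^sub>R u) r < 0" if "r < t / s"
    using assms rW that by (simp add: * is_turn_def field_simps)
  show "0 < \<sigma> * slope c (s *\<^sub>R u) r" if "t / s < r"
    using assms rW that by (simp add: * is_turn_def field_simps)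
qed

lemma turn: assumes u: "u \<in> K" shows "is_turn c \<sigma> W u (\<tau> u)"
proof -
  have n: "norm u > 0" using K_nz[OF u] by simp
  let ?v = "inverse (norm u) *\<^sub>R u"
  have v: "?v \<in> K" "norm ?v = 1" using K(3)[OF u] n by auto
  obtain t where "is_turn c \<sigma> W ?v t" using turning[OF v] by blast
  from turn_scale[OF v(1) n this] have "is_turn c \<sigma> W u (t / norm u)" using n by simp
  then show ?thesis unfolding turn_def by (rule someI)
qed

text \<open>Midway between two turning points the slope would need both signs.\<close>

lemma turn_unique:
  assumes u: "u \<in> K" and "is_turn c \<sigma> W u s" "is_turn c \<sigma> W u t"
  shows "s = t"
proof -
  have False if st: "is_turn c \<sigma> W u s" "is_turn c \<sigma> W u t" "s < t" for s t
  proof -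
    have "s * norm u \<in> W" "t * norm u \<in> W" using st by (auto simp: is_turn_def)
    moreover have "s * norm u \<le> (s + t) / 2 * norm u" "(s + t) / 2 * norm u \<le> t * norm u"
      using st(3) by (intro mult_right_mono; simp)+
    ultimately have "(s + t) / 2 * norm u \<in> W" using mem_is_interval_1_I[OF W(2)] by blast
    moreover have "s < (s + t) / 2" "(s + t) / 2 < t" using st(3) by auto
    ultimately show False using st(1,2) unfolding is_turn_def by (meson less_asym)
  qed
  then show ?thesis using assms by (meson linorder_neqE_linordered_idom)
qed

lemma \<tau>_pos: "u \<in> K \<Longrightarrow> \<tau> u > 0"
  using turn turn_pos by blast

lemma \<tau>_W: "u \<in> K \<Longrightarrow> \<tau> u * norm u \<in> W"
  using turn by (simp add: is_turn_def)

lemma \<tau>_eqI: "u \<in> K \<Longrightarrow> is_turn c \<sigma> W u t \<Longrightarrow> \<tau> u = t"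
  using turn turn_unique by blast

lemma \<tau>_scale: "u \<in> K \<Longrightarrow> s > 0 \<Longrightarrow> \<tau> (s *\<^sub>R u) = \<tau> u / s"
  by (intro \<tau>_eqI K(3) turn_scale turn)

lemma \<tau>_minus: "u \<in> K \<Longrightarrow> \<tau> (- u) = \<tau> u"
  using turn[of u] by (intro \<tau>_eqI K(2)) (auto simp: is_turn_def slope_def)

text \<open>The strict signs of \<open>slope\<close> on both sides of the turning point survive
  small changes of u and trap the new turning point.\<close>

lemma continuous_\<tau>: "continuous_on K \<tau>"
  unfolding continuous_on_eq_continuous_at[OF K(1)]
proof
  fix u assume u: "u \<in> K"
  have n: "norm u > 0" using K_nz[OF u] by simp
  show "isCont \<tau> u"
    unfolding isCont_def tendsto_iff
  proof (intro allI impI)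
    fix e :: real assume e: "e > 0"
    have "open ((\<lambda>t. t * norm u) -` W)"
      by (intro continuous_open_vimage W(1)) (auto intro!: continuous_intros)
    moreover have "\<tau> u \<in> (\<lambda>t. t * norm u) -` W" using \<tau>_W[OF u] by simp
    ultimately obtain d where d: "d > 0" "ball (\<tau> u) d \<subseteq> (\<lambda>t. t * norm u) -` W"
      using open_contains_ball by blast
    define d' where "d' = min d e / 2"
    define s where "s = \<tau> u - d'"
    define t where "t = \<tau> u + d'"
    have d': "d' > 0" "d' < d" "d' < e" using d(1) e by (auto simp: d'_def)
    then have "s \<in> ball (\<tau> u) d" "t \<in> ball (\<tau> u) d" by (auto simp: s_def t_def dist_real_def)
    then have stW: "s * norm u \<in> W" "t * norm u \<in> W" using d(2) by auto
    have sl: "\<sigma> * slope c u s < 0" "0 < \<sigma> * slope c u t"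
      using turn[OF u] stW d' by (auto simp: is_turn_def s_def t_def)
    have lim: "((\<lambda>v. \<sigma> * slope c v r) \<longlongrightarrow> \<sigma> * slope c u r) (at u)" for r
      using continuous_slope[of UNIV c r] by (intro tendsto_intros) (auto simp: continuous_on_def)
    have limn: "((\<lambda>v. r * norm v) \<longlongrightarrow> r * norm u) (at u)" for r :: real
      by (intro tendsto_intros)
    have "\<forall>\<^sub>F v in at u. v \<in> K" using u K(1) by (rule eventually_at_in_open'[rotated])
    then show "\<forall>\<^sub>F v in at u. dist (\<tau> v) (\<tau> u) < e"
      using topological_tendstoD[OF limn W(1) stW(1)] topological_tendstoD[OF limn W(1) stW(2)]
        order_tendstoD(2)[OF lim sl(1)] order_tendstoD(1)[OF lim sl(2)]
    proof eventually_elim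
      case (elim v)
      have "is_turn c \<sigma> W v (\<tau> v)" by (rule turn[OF elim(1)])
      then have "\<not> \<tau> v < s" "\<not> t < \<tau> v"
        using elim unfolding is_turn_def by (meson less_asym)+
      then show ?case using d' by (auto simp: s_def t_def dist_real_def)
    qed
  qed
qed

text \<open>By the mean value theorem \<open>fiber\<close> is monotone on either side of the turning
  point; the factor \<open>\<sigma>\<close> treats minima and maxima alike.\<close>

lemma optimal:
  assumes u: "u \<in> K" and s: "s * norm u \<in> W"
  shows "\<sigma> * J u \<le> \<sigma> * energy_param c (s *\<^sub>R u)"
proof -
  have n: "norm u > 0" using K_nz[OF u] by simp
  have pos: "r > 0" if "r * norm u \<in> W" for r
    using W(3) that n by (auto simp: zero_less_mult_iff dest!: subsetD)
  have tu: "is_turn c \<sigma> W u (\<tau> u)" by (rule turn[OF u])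
  have mid: "r * norm u \<in> W" if "a * norm u \<in> W" "b * norm u \<in> W" "a \<le> r" "r \<le> b" for a b r
    using mem_is_interval_1_I[OF W(2) that(1,2)] that(3,4) n by (simp add: mult_right_mono)
  have mvt: "\<exists>z. a < z \<and> z < b \<and> fiber c u b - fiber c u a = (b - a) * (z powr (- \<alpha> - 1) * slope c u z)"
    if "a * norm u \<in> W" "a < b" for a b
    using pos[OF that(1)] that(2) by (intro MVT2 DERIV_fiber) auto
  have "\<sigma> * fiber c u (\<tau> u) \<le> \<sigma> * fiber c u s"
  proof (cases s "\<tau> u" rule: linorder_cases)
    case less
    obtain z where z: "s < z" "z < \<tau> u"
      "fiber c u (\<tau> u) - fiber c u s = (\<tau> u - s) * (z powr (- \<alpha> - 1) * slope c u z)"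
      using mvt[OF s less] by blast
    have "z * norm u \<in> W" using mid[OF s \<tau>_W[OF u]] z by simp
    then have "\<sigma> * slope c u z \<le> 0" using tu z(2) by (simp add: is_turn_def less_imp_le)
    then have "(\<tau> u - s) * z powr (- \<alpha> - 1) * (\<sigma> * slope c u z) \<le> 0"
      using less by (intro mult_nonneg_nonpos[OF _ \<open>\<sigma> * slope c u z \<le> 0\<close>]) auto
    moreover have "\<sigma> * (fiber c u (\<tau> u) - fiber c u s) = (\<tau> u - s) * z powr (- \<alpha> - 1) * (\<sigma> * slope c u z)"
      unfolding z(3) by simp
    ultimately show ?thesis by (simp add: right_diff_distrib)
  next
    case greater
    obtain z where z: "\<tau> u < z" "z < s"
      "fiber c u s - fiber c u (\<tau> u) = (s - \<tau> u) * (z powr (- \<alpha> - 1) * slope c u z)"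
      using mvt[OF \<tau>_W[OF u] greater] by blast
    have "z * norm u \<in> W" using mid[OF \<tau>_W[OF u] s] z by simp
    then have "\<sigma> * slope c u z \<ge> 0" using tu z(1) by (simp add: is_turn_def less_imp_le)
    then have "(s - \<tau> u) * z powr (- \<alpha> - 1) * (\<sigma> * slope c u z) \<ge> 0"
      using greater by (intro mult_nonneg_nonneg[OF _ \<open>\<sigma> * slope c u z \<ge> 0\<close>]) auto
    moreover have "\<sigma> * (fiber c u s - fiber c u (\<tau> u)) = (s - \<tau> u) * z powr (- \<alpha> - 1) * (\<sigma> * slope c u z)"
      unfolding z(3) by simp
    ultimately show ?thesis by (simp add: right_diff_distrib)
  qed simp
  then have "\<alpha> / A u * (\<sigma> * fiber c u (\<tau> u)) \<le> \<alpha> / A u * (\<sigma> * fiber c u s)"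
    using K(4)[OF u] exponents by (intro mult_left_mono[of "\<sigma> * fiber c u (\<tau> u)"]) auto
  then show ?thesis
    using \<tau>_pos[OF u] pos[OF s] by (simp add: reduced_def energy_param_scale mult.left_commute)
qed

lemma J_minus: "u \<in> K \<Longrightarrow> J (- u) = J u"
  by (simp add: reduced_def \<tau>_minus energy_param_def)

lemma J_scale: "u \<in> K \<Longrightarrow> t > 0 \<Longrightarrow> J (t *\<^sub>R u) = J u"
  by (simp add: reduced_def \<tau>_scale)

lemma G_scale: "u \<in> K \<Longrightarrow> t > 0 \<Longrightarrow> G (t *\<^sub>R u) = (1 / t) *\<^sub>R G u"
  by (simp add: reduced_deriv_def \<tau>_scale)

lemma \<tau>_K: "u \<in> K \<Longrightarrow> \<tau> u *\<^sub>R u \<in> K"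
  by (intro K(3) \<tau>_pos)

lemma continuous_J: "continuous_on K J"
proof -
  have A0: "A u \<noteq> 0" if "u \<in> K" for u using K(4)[OF that] by simp
  have "continuous_on K (\<lambda>u. \<tau> u *\<^sub>R u)" by (intro continuous_intros continuous_\<tau>)
  from continuous_on_compose2[OF continuous_energy(1)[of K, OF A0] this]
  have "continuous_on K (\<lambda>u. energy_param c (\<tau> u *\<^sub>R u))" using \<tau>_K by blast
  then show ?thesis by (simp add: reduced_def[abs_def])
qed

text \<open>The envelope argument: replacing the optimal ray parameter of one point by that of the other
  bounds the increment of \<open>J\<close> from both sides by increments of \<open>energy_param\<close>.\<close>
lemma strict_deriv_J:
  assumes x: "x \<in> K" and e: "e > 0"
  shows "\<exists>d>0. \<forall>y\<in>ball x d. \<forall>z\<in>ball x d. \<bar>J y - J z - G x (y - z)\<bar> \<le> e * norm (y - z)"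
proof -
  define T where "T = \<tau> x"
  define p where "p = T *\<^sub>R x"
  define D where "D = energy_deriv c p"
  have T: "T > 0" using \<tau>_pos[OF x] by (simp add: T_def)
  have eT: "e / (4 * T) > 0" using e T by simp
  have pK: "p \<in> K" unfolding p_def T_def by (rule \<tau>_K[OF x])
  have A0: "A u \<noteq> 0" if "u \<in> K" for u using K(4)[OF that] by simp
  obtain d' where d': "d' > 0" "ball p d' \<subseteq> K"
    "\<And>y z. y \<in> ball p d' \<Longrightarrow> z \<in> ball p d' \<Longrightarrow>
      \<bar>energy_param c y - energy_param c z - D (y - z)\<bar> \<le> e / (4 * T) * norm (y - z)"
    unfolding D_def
    using strict_differentiability[OF K(1) pK has_derivative_energy_param[OF A0, where c = c] continuous_energy(2)[OF A0, where c = c] eT]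
    by metis
  \<comment> \<open>The first bound keeps nearby radii below 2T, so the error e/(4T) becomes at most
    e/2; the second pays the other e/2 for replacing these radii by T in front of D.\<close>
  define \<kappa> where "\<kappa> = min T (e / (2 * (norm D + 1)))"
  have \<kappa>: "\<kappa> > 0" using T e norm_ge_zero[of D] by (auto simp: \<kappa>_def intro!: divide_pos_pos add_nonneg_pos)
  have ct: "(\<tau> \<longlongrightarrow> T) (nhds x)"
    using continuous_\<tau> x K(1) by (auto simp: continuous_on_eq_continuous_at isCont_def T_def tendsto_nhds_iff)
  \<comment> \<open>The radius of one point is applied to another, so the estimates must hold
    uniformly over pairs of points.\<close>
  let ?F = "nhds x \<times>\<^sub>F nhds x"
  have l1: "((\<lambda>q. \<tau> (fst q)) \<longlongrightarrow> T) ?F"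
    by (rule filterlim_compose[OF ct filterlim_fst])
  have l2: "((\<lambda>q. snd q) \<longlongrightarrow> x) ?F" by (rule filterlim_snd)
  have l3: "((\<lambda>q. \<tau> (fst q) *\<^sub>R snd q) \<longlongrightarrow> p) ?F"
    unfolding p_def by (intro tendsto_intros l1 l2)
  have l4: "((\<lambda>q. \<tau> (fst q) * norm (snd q)) \<longlongrightarrow> T * norm x) ?F"
    by (intro tendsto_intros l1 l2)
  have "\<forall>\<^sub>F q in ?F. snd q \<in> K \<and> \<tau> (fst q) *\<^sub>R snd q \<in> ball p d' \<and> \<tau> (fst q) * norm (snd q) \<in> W
      \<and> dist (\<tau> (fst q)) T < \<kappa>"
    using topological_tendstoD[OF l2 K(1) x] topological_tendstoD[OF l3 open_ball, of p d'] d'(1)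
      topological_tendstoD[OF l4 W(1)] \<tau>_W[OF x] tendstoD[OF l1 \<kappa>]
    by (simp add: T_def eventually_conj_iff)
  then obtain Q where Q: "eventually Q (nhds x)" "\<And>y z. Q y \<Longrightarrow> Q z \<Longrightarrow>
      z \<in> K \<and> \<tau> y *\<^sub>R z \<in> ball p d' \<and> \<tau> y * norm z \<in> W \<and> dist (\<tau> y) T < \<kappa>"
    unfolding eventually_prod_same by auto
  obtain d where d: "d > 0" "\<And>y. y \<in> ball x d \<Longrightarrow> Q y"
    using Q(1) unfolding eventually_nhds_metric by (auto simp: dist_commute)
  have inc: "\<bar>energy_param c (\<tau> w *\<^sub>R y) - energy_param c (\<tau> w *\<^sub>R z) - G x (y - z)\<bar> \<le> e * norm (y - z)"
    if "Q w" "Q y" "Q z" for w y z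
  proof -
    have w: "\<tau> w > 0" "\<bar>\<tau> w - T\<bar> < \<kappa>" using Q(2)[OF that(1,1)] \<tau>_pos by (auto simp: dist_real_def)
    have "\<bar>energy_param c (\<tau> w *\<^sub>R y) - energy_param c (\<tau> w *\<^sub>R z) - D (\<tau> w *\<^sub>R y - \<tau> w *\<^sub>R z)\<bar>
        \<le> e / (4 * T) * norm (\<tau> w *\<^sub>R y - \<tau> w *\<^sub>R z)"
      using Q(2)[OF that(1,2)] Q(2)[OF that(1,3)] by (intro d'(3)) auto
    also have "\<dots> = e / (4 * T) * \<tau> w * norm (y - z)"
      using w by (simp flip: scaleR_right_diff_distrib)
    also have "\<dots> \<le> e / 2 * norm (y - z)"
    proof (rule mult_right_mono)
      have "e / (4 * T) * \<tau> w \<le> e / (4 * T) * (2 * T)"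
        using w e T by (intro mult_left_mono) (auto simp: \<kappa>_def)
      then show "e / (4 * T) * \<tau> w \<le> e / 2" using T by simp
    qed simp
    finally have 1: "\<bar>energy_param c (\<tau> w *\<^sub>R y) - energy_param c (\<tau> w *\<^sub>R z) - \<tau> w * D (y - z)\<bar>
        \<le> e / 2 * norm (y - z)"
      by (simp add: blinfun.scaleR_right flip: scaleR_right_diff_distrib)
    have "\<bar>(\<tau> w - T) * D (y - z)\<bar> \<le> \<kappa> * (norm D * norm (y - z))"
      unfolding abs_mult using w(2) norm_blinfun[of D "y - z"] \<kappa> by (intro mult_mono) auto
    also have "\<dots> \<le> e / 2 * norm (y - z)"
    proof -
      have "\<kappa> * norm D \<le> e / (2 * (norm D + 1)) * (norm D + 1)"
        using \<kappa> e by (intro mult_mono) (auto simp: \<kappa>_def)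
      also have "\<dots> = e / 2" by (simp add: field_simps add_nonneg_eq_0_iff)
      finally show ?thesis
        using mult_right_mono[of "\<kappa> * norm D" "e / 2" "norm (y - z)"] by (simp add: mult.assoc)
    qed
    finally have 2: "\<bar>(\<tau> w - T) * D (y - z)\<bar> \<le> e / 2 * norm (y - z)" .
    have "G x (y - z) = T * D (y - z)"
      by (simp add: reduced_deriv_def T_def p_def D_def blinfun.scaleR_left)
    then show ?thesis using 1 2 unfolding left_diff_distrib by linarith
  qed
  have "\<bar>J y - J z - G x (y - z)\<bar> \<le> e * norm (y - z)" if yz: "y \<in> ball x d" "z \<in> ball x d" for y z
  proof -
    have Qs: "Q y" "Q z" using d(2) yz by auto
    \<comment> \<open>Each extremal value is tested with the radius of the other point, which
      squeezes J y - J z between the increments at the radii \<open>\<tau> y\<close> and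
      \<open>\<tau> z\<close>.\<close>
    have "\<sigma> * J y \<le> \<sigma> * energy_param c (\<tau> z *\<^sub>R y)" "\<sigma> * J z \<le> \<sigma> * energy_param c (\<tau> y *\<^sub>R z)"
      using Q(2)[OF Qs(2,1)] Q(2)[OF Qs] by (auto intro: optimal)
    moreover have "J y = energy_param c (\<tau> y *\<^sub>R y)" "J z = energy_param c (\<tau> z *\<^sub>R z)"
      by (simp_all add: reduced_def)
    ultimately show ?thesis
      using \<sigma> inc[OF Qs(1) Qs] inc[OF Qs(2) Qs] by (auto simp: abs_le_iff)
  qed
  with d(1) show ?thesis by blast
qed

text \<open>Condition \<open>Z\<close> keeps sublevels off the boundary of the cone and
  \<open>bd\<close> confines the radii. Then rescaled Palais-Smale sequences are bounded, and the
  derivative of \<open>Phi\<close> there is a bounded multiple of \<open>G (x n)\<close>, so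
  \<open>PS\<close> applies.\<close>

lemma reduced_functional:
  assumes nonneg: "\<And>u. u \<in> K \<Longrightarrow> norm u = 1 \<Longrightarrow> 0 \<le> J u"
    and Z: "\<And>L. \<exists>Z. closed Z \<and> {u\<in>K. norm u = 1 \<and> J u \<le> L} \<subseteq> Z \<and> Z \<subseteq> K"
    and bd: "\<And>L. \<exists>a>0. \<forall>u\<in>K. norm u = 1 \<longrightarrow> J u \<le> L \<longrightarrow> a \<le> \<tau> u \<and> \<tau> u \<le> 1 / a"
  shows "even_cone_functional K J G"
proof
  show "open K" "0 \<notin> K" using K(1) K_nz by auto
  show "- x \<in> K" "J (- x) = J x" if "x \<in> K" for x using that K(2) J_minus by auto
  show "t *\<^sub>R x \<in> K" "J (t *\<^sub>R x) = J x" "G (t *\<^sub>R x) = (1 / t) *\<^sub>R G x" if "x \<in> K" "t > 0" for x t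
    using that K(3) J_scale G_scale by auto
  show "\<exists>d>0. \<forall>y\<in>ball x d. \<forall>z\<in>ball x d. \<bar>J y - J z - G x (y - z)\<bar> \<le> e * norm (y - z)"
    if "x \<in> K" "e > 0" for x e using strict_deriv_J that .
  show "0 \<le> J x" if x: "x \<in> K" for x
  proof -
    have n: "norm x > 0" using K_nz[OF x] by simp
    then have "0 \<le> J (inverse (norm x) *\<^sub>R x)" using K(3)[OF x] by (intro nonneg) auto
    then show ?thesis using J_scale[OF x] n by simp
  qed
  show "closed {x\<in>K. norm x = 1 \<and> J x \<le> L}" for L
  proof -
    obtain Z where Z: "closed Z" "{u\<in>K. norm u = 1 \<and> J u \<le> L} \<subseteq> Z" "Z \<subseteq> K" using assms(2) by blast
    have "closed (Z \<inter> J -` {..L})"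
      using continuous_on_subset[OF continuous_J Z(3)] by (intro continuous_closed_preimage Z(1)) auto
    moreover have "closed {x :: 'a. norm x = 1}" by (intro closed_Collect_eq continuous_intros)
    ultimately have "closed (Z \<inter> J -` {..L} \<inter> {x. norm x = 1})" by (rule closed_Int)
    also have "Z \<inter> J -` {..L} \<inter> {x. norm x = 1} = {x\<in>K. norm x = 1 \<and> J x \<le> L}" using Z by auto
    finally show ?thesis .
  qed
  fix x :: "nat \<Rightarrow> 'a" and l
  assume x: "\<And>n. x n \<in> K \<and> norm (x n) = 1" and Jl: "(\<lambda>n. J (x n)) \<longlonglongrightarrow> l" and G0: "(\<lambda>n. G (x n)) \<longlonglongrightarrow> 0"
  have bJ: "bounded (range (\<lambda>n. J (x n)))" using Jl by (rule convergent_imp_bounded)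
  then obtain L where "\<And>n. \<bar>J (x n)\<bar> \<le> L" unfolding bounded_real by auto
  then have L: "J (x n) \<le> L" for n using abs_le_D1 by blast
  obtain a where a: "a > 0" "\<And>u. u \<in> K \<Longrightarrow> norm u = 1 \<Longrightarrow> J u \<le> L \<Longrightarrow> a \<le> \<tau> u \<and> \<tau> u \<le> 1 / a"
    using bd by blast
  define v where "v n = \<tau> (x n) *\<^sub>R x n" for n
  have \<tau>a: "a \<le> \<tau> (x n)" "\<tau> (x n) \<le> 1 / a" for n using a(2) x L by auto
  have nv: "norm (v n) = \<tau> (x n)" for n
    using x \<tau>_pos[of "x n"] by (simp add: v_def)
  have Av: "A (v n) > 0" for n unfolding v_def using x \<tau>_K K(4) by blast
  have "\<exists>r y. strict_mono (r :: nat \<Rightarrow> nat) \<and> (v \<circ> r) \<longlonglongrightarrow> y"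
  proof (rule PS[OF bJ])
    show "bounded (range v)"
      using \<tau>a nv by (auto simp: bounded_iff)
    have "Phi \<eta> \<alpha> \<beta> N A B (J (x n)) (v n) = c" for n
      using Phi_energy_param[of "v n" c] Av[of n] by (simp add: reduced_def v_def)
    then show "bounded (range (\<lambda>n. Phi \<eta> \<alpha> \<beta> N A B (J (x n)) (v n)))" by simp
    have eq: "dual_deriv (Phi \<eta> \<alpha> \<beta> N A B (J (x n))) (v n) = (A (v n) / (\<alpha> * \<tau> (x n))) *\<^sub>R G (x n)" for n
      using Av[of n] exponents \<tau>_pos[of "x n"] x[of n]
      by (simp add: reduced_deriv_def energy_deriv_def reduced_def v_def)
    show "(\<lambda>n. dual_deriv (Phi \<eta> \<alpha> \<beta> N A B (J (x n))) (v n)) \<longlonglongrightarrow> 0"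
      unfolding eq
    proof (rule Lim_null_comparison)
      have "norm ((A (v n) / (\<alpha> * \<tau> (x n))) *\<^sub>R G (x n)) \<le> C * (1 / a) powr \<alpha> / (\<alpha> * a) * norm (G (x n))" for n
      proof -
        have "A (v n) \<le> C * norm (v n) powr \<alpha>" using bounds(3)[of "v n"] by simp
        also have "\<dots> \<le> C * (1 / a) powr \<alpha>"
          using C_pos exponents \<tau>a[of n] nv[of n] a(1) by (intro mult_left_mono powr_mono2) auto
        finally have "A (v n) / (\<alpha> * \<tau> (x n)) \<le> C * (1 / a) powr \<alpha> / (\<alpha> * a)"
          using Av[of n] \<tau>a(1)[of n] a(1) exponents by (intro frac_le mult_left_mono) auto
        moreover have "\<bar>A (v n) / (\<alpha> * \<tau> (x n))\<bar> = A (v n) / (\<alpha> * \<tau> (x n))"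
          using Av[of n] \<tau>_pos[of "x n"] x exponents by (simp add: abs_of_pos)
        ultimately show ?thesis by (simp only: norm_scaleR) (intro mult_right_mono, auto)
      qed
      then show "\<forall>\<^sub>F n in sequentially. norm ((A (v n) / (\<alpha> * \<tau> (x n))) *\<^sub>R G (x n))
          \<le> C * (1 / a) powr \<alpha> / (\<alpha> * a) * norm (G (x n))" by simp
      show "(\<lambda>n. C * (1 / a) powr \<alpha> / (\<alpha> * a) * norm (G (x n))) \<longlonglongrightarrow> 0"
        by (intro tendsto_mult_right_zero tendsto_norm_zero G0)
    qed
  qed
  then obtain r y where r: "strict_mono (r :: nat \<Rightarrow> nat)" "(v \<circ> r) \<longlonglongrightarrow> y" by blast
  \<comment> \<open>The lower radius bound excludes the limit 0, so convergence survives normalising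
    back to the unit vectors.\<close>
  have "a \<le> norm y"
    by (rule tendsto_lowerbound[OF tendsto_norm[OF r(2)]]) (use \<tau>a nv in auto)
  then have "(\<lambda>n. inverse (norm ((v \<circ> r) n)) *\<^sub>R (v \<circ> r) n) \<longlonglongrightarrow> inverse (norm y) *\<^sub>R y"
    using a(1) by (intro tendsto_intros r(2)) auto
  moreover have "inverse (norm ((v \<circ> r) n)) *\<^sub>R (v \<circ> r) n = (x \<circ> r) n" for n
    using \<tau>_pos[of "x (r n)"] x by (simp add: nv) (simp add: v_def)
  ultimately have "(x \<circ> r) \<longlonglongrightarrow> inverse (norm y) *\<^sub>R y" by (simp add: comp_def)
  then show "\<exists>r y. strict_mono (r :: nat \<Rightarrow> nat) \<and> (x \<circ> r) \<longlonglongrightarrow> y"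
    using r(1) by blast
qed

lemma critical_point:
  assumes x: "x \<in> K" "norm x = 1" "G x = 0"
  obtains v where "v \<in> K" "norm v = \<tau> x" "Phi \<eta> \<alpha> \<beta> N A B (J x) v = c"
    "dual_deriv (Phi \<eta> \<alpha> \<beta> N A B (J x)) v = 0"
proof
  let ?v = "\<tau> x *\<^sub>R x"
  show "?v \<in> K" by (rule \<tau>_K[OF x(1)])
  have A: "A ?v > 0" by (intro K(4) \<tau>_K x(1))
  show "norm ?v = \<tau> x" using \<tau>_pos[OF x(1)] x(2) by simp
  show "Phi \<eta> \<alpha> \<beta> N A B (J x) ?v = c"
    using Phi_energy_param[of ?v c] A by (simp add: reduced_def)
  show "dual_deriv (Phi \<eta> \<alpha> \<beta> N A B (J x)) ?v = 0"
    using x(3) A \<tau>_pos[OF x(1)] exponents by (simp add: reduced_deriv_def energy_deriv_def reduced_def)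
qed

end

section \<open>Turning points of the fibers\<close>

text \<open>Since f is nonincreasing and f x / (b - x) is nondecreasing, f y differs from f x by at
  most |y - x| / (b - x) times f x.\<close>

lemma continuous_on_antimono_ratio:
  fixes f :: "real \<Rightarrow> real"
  assumes anti: "\<And>x y. a < x \<Longrightarrow> x < y \<Longrightarrow> y < b \<Longrightarrow> f y \<le> f x"
    and ratio: "\<And>x y. a < x \<Longrightarrow> x < y \<Longrightarrow> y < b \<Longrightarrow> f x \<le> (b - x) / (b - y) * f y"
  shows "continuous_on {a<..<b} f"
  unfolding continuous_on_eq_continuous_at[OF open_greaterThanLessThan]
proof
  fix x assume x: "x \<in> {a<..<b}"
  have "((\<lambda>y. f y - f x) \<longlongrightarrow> 0) (at x)"
  proof (rule Lim_null_comparison)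
    show "((\<lambda>y. \<bar>y - x\<bar> / (b - x) * f x) \<longlongrightarrow> 0) (at x)"
      using x by (auto intro!: tendsto_eq_intros)
    have "\<forall>\<^sub>F y in at x. y \<in> {a<..<b}"
      using x by (intro eventually_at_in_open') auto
    then show "\<forall>\<^sub>F y in at x. norm (f y - f x) \<le> \<bar>y - x\<bar> / (b - x) * f x"
    proof eventually_elim
      case (elim y)
      have bx: "b - x > 0" "b - y > 0" using x elim by auto
      consider "y < x" | "y = x" | "x < y" by linarith
      then show ?case
      proof cases
        case 1
        have "f y \<le> (b - y) / (b - x) * f x" using ratio[of y x] elim x 1 by auto
        also have "(b - y) / (b - x) = 1 + (x - y) / (b - x)" using bx by (simp add: field_simps)
        finally have "f y \<le> f x + (x - y) / (b - x) * f x" by (simp add: distrib_right)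
        then show ?thesis using anti[of y x] elim x 1 by simp
      next
        case 3
        have "f x \<le> (b - x) / (b - y) * f y" using ratio[of x y] elim x 3 by auto
        then have "(b - y) / (b - x) * f x \<le> (b - y) / (b - x) * ((b - x) / (b - y) * f y)"
          using bx by (intro mult_left_mono) auto
        also have "\<dots> = f y" using bx by simp
        also have "(b - y) / (b - x) = 1 - (y - x) / (b - x)" using bx by (simp add: field_simps)
        finally have "f x - (y - x) / (b - x) * f x \<le> f y" by (simp add: left_diff_distrib)
        then show ?thesis using anti[of x y] elim x 3 by simp
      qed simp
    qed
  qed
  then show "isCont f x" unfolding isCont_def using Lim_null by blast
qed

lemma ex_powr_ge:
  fixes p b X :: real
  assumes "p > 0"
  shows "\<exists>t>b. X \<le> t powr p"
proof -
  define t where "t = max (b + 1) (max X 1 powr (1 / p))"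
  have "X \<le> (max X 1 powr (1 / p)) powr p" using assms by (simp add: powr_powr)
  also have "\<dots> \<le> t powr p" using assms by (intro powr_mono2) (auto simp: t_def)
  finally show ?thesis by (intro exI[of _ t]) (auto simp: t_def)
qed

context homogeneous_functionals
begin

lemma unit_bounds:
  assumes "norm u = 1"
  shows "N u \<le> C" "inverse C \<le> N u" "A u \<le> C" "B u \<le> C"
  using bounds[of u] assms by auto

text \<open>The energy enters affinely. Comparisons of two energies apply this identity on one ray
  at one radius.\<close>

lemma energy_param_shift:
  assumes "t > 0" "A u > 0"
  shows "energy_param c' (t *\<^sub>R u) = energy_param c (t *\<^sub>R u) - \<alpha> * (c' - c) / (t powr \<alpha> * A u)"
  using assms by (simp add: energy_param_def homog_eq diff_divide_distrib add_divide_distrib algebra_simps)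

text \<open>Up to the radius \<open>T\<close> the \<open>B\<close>-term of \<open>slope\<close> is dominated by half of the \<open>N\<close>-term, uniformly on the
  unit sphere; this separates the local minimum of the fiber from its local maximum.\<close>
definition T :: real where "T = ((\<eta> - \<alpha>) / (2 * C\<^sup>2 * (\<beta> - \<alpha>))) powr (1 / (\<beta> - \<eta>))"

text \<open>The energy at which the bound of \<open>slope_lower\<close> vanishes at t =
  \<open>T\<close>.\<close>

definition c_lo :: real where "c_lo = - ((\<eta> - \<alpha>) * T powr \<eta> / (2 * \<eta> * C * \<alpha>))"

text \<open>The lower bound of N/\<eta> - B/\<beta> at radius \<open>T\<close> from
  \<open>energy_numerator_lower\<close>; for smaller energies the maximum along a ray is
  positive.\<close>

definition c_hi :: real where "c_hi = T powr \<eta> / (2 * C * \<eta>)"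

lemma T_pos: "T > 0"
  using exponents C_pos by (simp add: T_def)

lemma c_lo_neg: "c_lo < 0" and c_hi_pos: "0 < c_hi"
  using exponents C_pos T_pos by (simp_all add: c_lo_def c_hi_def)

text \<open>\<open>T\<close> is the radius at which both sides agree; since \<beta> - \<eta> > 0,
  the inequality persists below it.\<close>

lemma B_dominated:
  assumes t: "0 < t" "t \<le> T"
  shows "(\<beta> - \<alpha>) * C * t powr \<beta> \<le> (\<eta> - \<alpha>) / (2 * C) * t powr \<eta>"
proof -
  have "t powr (\<beta> - \<eta>) \<le> T powr (\<beta> - \<eta>)" using t exponents by (intro powr_mono2) auto
  also have "\<dots> = (\<eta> - \<alpha>) / (2 * C\<^sup>2 * (\<beta> - \<alpha>))"
    using exponents C_pos by (simp add: T_def powr_powr)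
  finally have "(\<beta> - \<alpha>) * C * t powr \<eta> * t powr (\<beta> - \<eta>)
      \<le> (\<beta> - \<alpha>) * C * t powr \<eta> * ((\<eta> - \<alpha>) / (2 * C\<^sup>2 * (\<beta> - \<alpha>)))"
    using exponents C_pos by (intro mult_left_mono) auto
  also have "\<dots> = (\<eta> - \<alpha>) / (2 * C) * t powr \<eta>"
    using exponents C_pos by (simp add: field_simps power2_eq_square)
  also have "(\<beta> - \<alpha>) * C * t powr \<eta> * t powr (\<beta> - \<eta>) = (\<beta> - \<alpha>) * C * t powr \<beta>"
    by (simp add: mult.assoc flip: powr_add)
  finally show ?thesis .
qed

lemma B_dominated_unit:
  assumes t: "0 < t" "t \<le> T" and u: "norm u = 1"
  shows "(\<beta> - \<alpha>) * (t powr \<beta> * B u) \<le> (\<eta> - \<alpha>) / (2 * C) * t powr \<eta>"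
proof -
  have "(\<beta> - \<alpha>) * (t powr \<beta> * B u) \<le> (\<beta> - \<alpha>) * (t powr \<beta> * C)"
    using unit_bounds[OF u] exponents by (intro mult_left_mono) auto
  with B_dominated[OF t] show ?thesis by (simp add: mult_ac)
qed

lemma N_unit:
  assumes "norm u = 1"
  shows "t powr \<eta> / C \<le> t powr \<eta> * N u"
  using unit_bounds[OF assms] by (simp add: divide_inverse mult_left_mono)

text \<open>With q = (\<eta> - \<alpha>) t^\<eta> / (2 \<eta> C), the N-term is at least 2q and the
  B-term at most q; the latter also uses \<eta> < \<beta>.\<close>

lemma slope_lower:
  assumes t: "0 < t" "t \<le> T" and u: "norm u = 1"
  shows "(\<eta> - \<alpha>) * t powr \<eta> / (2 * \<eta> * C) + \<alpha> * c \<le> slope c u t"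
proof -
  have "(\<beta> - \<alpha>) * (t powr \<beta> * B u) / \<beta> \<le> (\<eta> - \<alpha>) / (2 * C) * t powr \<eta> / \<beta>"
    using B_dominated_unit[OF assms] exponents by (intro divide_right_mono) auto
  also have "\<dots> \<le> (\<eta> - \<alpha>) / (2 * C) * t powr \<eta> / \<eta>"
    using exponents C_pos by (intro divide_left_mono) auto
  finally have 1: "(\<beta> - \<alpha>) / \<beta> * t powr \<beta> * B u \<le> (\<eta> - \<alpha>) * t powr \<eta> / (2 * \<eta> * C)"
    by (simp add: mult_ac)
  have "(\<eta> - \<alpha>) / \<eta> * (t powr \<eta> / C) \<le> (\<eta> - \<alpha>) / \<eta> * (t powr \<eta> * N u)"
    using N_unit[OF u] exponents by (intro mult_left_mono) auto
  then have 2: "2 * ((\<eta> - \<alpha>) * t powr \<eta> / (2 * \<eta> * C)) \<le> (\<eta> - \<alpha>) / \<eta> * t powr \<eta> * N u"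
    by (simp add: mult_ac)
  show ?thesis using 1 2 unfolding slope_def by linarith
qed

lemma slope_T_pos:
  assumes "norm u = 1" "c_lo < c"
  shows "slope c u T > 0"
proof -
  have "\<alpha> * c_lo < \<alpha> * c" using assms(2) exponents by simp
  moreover have "\<alpha> * c_lo = - ((\<eta> - \<alpha>) * T powr \<eta> / (2 * \<eta> * C))"
    using exponents by (simp add: c_lo_def)
  ultimately show ?thesis using slope_lower[OF T_pos order_refl assms(1), of c] by linarith
qed

lemma DERIV_slope:
  assumes "t > 0"
  shows "(slope c u has_real_derivative t powr (\<eta> - 1) * ((\<eta> - \<alpha>) * N u - (\<beta> - \<alpha>) * t powr (\<beta> - \<eta>) * B u)) (at t)"
proof -
  have "(slope c u has_real_derivative (\<eta> - \<alpha>) / \<eta> * (\<eta> * t powr (\<eta> - 1)) * N u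
      - (\<beta> - \<alpha>) / \<beta> * (\<beta> * t powr (\<beta> - 1)) * B u) (at t)"
    unfolding slope_def[abs_def] using assms exponents by (auto intro!: derivative_eq_intros)
  moreover have "(\<eta> - \<alpha>) / \<eta> * (\<eta> * t powr (\<eta> - 1)) = (\<eta> - \<alpha>) * t powr (\<eta> - 1)"
    "(\<beta> - \<alpha>) / \<beta> * (\<beta> * t powr (\<beta> - 1)) = (\<beta> - \<alpha>) * t powr (\<beta> - 1)"
    using exponents by simp_all
  moreover have "t powr (\<beta> - 1) = t powr (\<eta> - 1) * t powr (\<beta> - \<eta>)" by (simp flip: powr_add)
  ultimately show ?thesis by (simp only:) (simp add: algebra_simps)
qed

lemma isCont_slope: "t > 0 \<Longrightarrow> isCont (slope c u) t"
  using DERIV_slope DERIV_isCont by blast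

lemma slope_strict_mono:
  assumes u: "norm u = 1" and st: "0 < s" "s < t" "t \<le> T"
  shows "slope c u s < slope c u t"
proof (rule DERIV_pos_imp_increasing[OF st(2)])
  fix x assume x: "s \<le> x" "x \<le> t"
  then have x0: "0 < x" "x \<le> T" using st by auto
  have "(\<beta> - \<alpha>) * (x powr \<beta> * B u) \<le> (\<eta> - \<alpha>) / (2 * C) * x powr \<eta>" by (rule B_dominated_unit[OF x0 u])
  also have "\<dots> < (\<eta> - \<alpha>) / C * x powr \<eta>"
    using exponents C_pos x0 by (simp add: field_simps)
  also have "\<dots> \<le> (\<eta> - \<alpha>) * (x powr \<eta> * N u)"
    using mult_left_mono[OF N_unit[OF u, of x], of "\<eta> - \<alpha>"] exponents by simp
  moreover have "x powr \<beta> = x powr \<eta> * x powr (\<beta> - \<eta>)" by (simp flip: powr_add)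
  ultimately have "x powr \<eta> * ((\<beta> - \<alpha>) * x powr (\<beta> - \<eta>) * B u) < x powr \<eta> * ((\<eta> - \<alpha>) * N u)"
    by (simp add: mult_ac)
  then have "(\<beta> - \<alpha>) * x powr (\<beta> - \<eta>) * B u < (\<eta> - \<alpha>) * N u"
    using x0 by (subst (asm) mult_less_cancel_left_pos) auto
  then have "0 < x powr (\<eta> - 1) * ((\<eta> - \<alpha>) * N u - (\<beta> - \<alpha>) * x powr (\<beta> - \<eta>) * B u)"
    using x0 by (intro mult_pos_pos) auto
  then show "\<exists>y. (slope c u has_real_derivative y) (at x) \<and> 0 < y"
    using DERIV_slope[OF x0(1)] by blast
qed

abbreviation "W_lo \<equiv> {0<..<T}"
abbreviation "W_hi \<equiv> {T<..}"

text \<open>The slope tends to \<alpha> c < 0 at radius 0 and is positive at \<open>T\<close>; its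
  strict growth in between leaves a single sign change.\<close>

lemma turning_lo:
  assumes u: "norm u = 1" and c: "c_lo < c" "c < 0"
  shows "\<exists>t. is_turn c 1 W_lo u t"
proof -
  have "((\<lambda>t. slope c u t) \<longlongrightarrow> (\<eta> - \<alpha>) / \<eta> * 0 * N u - (\<beta> - \<alpha>) / \<beta> * 0 * B u + \<alpha> * c) (at_right 0)"
    unfolding slope_def using exponents
    by (intro tendsto_intros tendsto_zero_powrI[where b = \<eta>] tendsto_zero_powrI[where b = \<beta>])
      (auto simp: eventually_at_right_less intro!: eventually_at_right_less[THEN eventually_mono])
  moreover have "\<alpha> * c < 0" using c exponents by (intro mult_pos_neg) auto
  ultimately have "\<forall>\<^sub>F t in at_right 0. slope c u t < 0"
    by (intro order_tendstoD(2)) auto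
  moreover have "\<forall>\<^sub>F t in at_right 0. t \<in> {0<..<T}" using T_pos by (rule eventually_at_right_real)
  ultimately have "\<forall>\<^sub>F t in at_right 0. slope c u t < 0 \<and> t \<in> {0<..<T}" by (rule eventually_conj)
  from eventually_happens'[OF trivial_limit_at_right_real this] obtain s where s: "slope c u s < 0" "0 < s" "s < T"
    by auto
  have "\<exists>t\<ge>s. t \<le> T \<and> slope c u t = 0"
    using s slope_T_pos[OF u c(1)] by (intro IVT) (auto intro: isCont_slope)
  then obtain t where t: "s \<le> t" "t \<le> T" "slope c u t = 0" by blast
  then have tT: "0 < t" "t < T" using s slope_T_pos[OF u c(1)] by (auto simp: less_le)
  have "is_turn c 1 W_lo u t"
    unfolding is_turn_def
  proof (intro conjI allI impI)
    show "t * norm u \<in> W_lo" using u tT by simp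
    fix r assume "r * norm u \<in> W_lo"
    then have r: "0 < r" "r < T" using u by auto
    show "1 * slope c u r < 0" if "r < t" using slope_strict_mono[OF u r(1) that, of c] tT t(3) by simp
    show "0 < 1 * slope c u r" if "t < r" using slope_strict_mono[OF u tT(1) that, of c] r t(3) by simp
  qed
  then show ?thesis by blast
qed

text \<open>Beyond \<open>T\<close> the slope may still rise, but the factor \<open>m\<close> of its
  derivative stays negative once it is negative, as B u > 0. A radius with nonpositive slope is
  preceded by one with negative \<open>m\<close>, so from there on the slope only falls.\<close>

lemma turning_hi:
  assumes u: "norm u = 1" "B u > 0" and c: "c_lo < c"
  shows "\<exists>t. is_turn c (- 1) W_hi u t"
proof -
  define m where "m t = (\<eta> - \<alpha>) * N u - (\<beta> - \<alpha>) * t powr (\<beta> - \<eta>) * B u" for t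
  have m_mono: "m t < 0" if "m s < 0" "0 < s" "s \<le> t" for s t
  proof -
    have "(\<beta> - \<alpha>) * s powr (\<beta> - \<eta>) * B u \<le> (\<beta> - \<alpha>) * t powr (\<beta> - \<eta>) * B u"
      using that exponents u by (intro mult_right_mono mult_left_mono powr_mono2) auto
    with that(1) show ?thesis by (simp add: m_def)
  qed
  have decr: "slope c u t < slope c u s" if "m z < 0" "0 < z" "z \<le> s" "s < t" for z s t
  proof (rule DERIV_neg_imp_decreasing[OF that(4)])
    fix x assume x: "s \<le> x" "x \<le> t"
    then have "m x < 0" "0 < x" using m_mono[OF that(1,2), of x] that by auto
    then have "x powr (\<eta> - 1) * m x < 0" by (intro mult_pos_neg) auto
    then show "\<exists>y. (slope c u has_real_derivative y) (at x) \<and> y < 0"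
      using DERIV_slope[OF \<open>0 < x\<close>, of c u] unfolding m_def by blast
  qed
  have mvt: "\<exists>z. T < z \<and> z < t \<and> m z < 0" if "T < t" "slope c u t \<le> 0" for t
  proof -
    obtain z where z: "T < z" "z < t" "slope c u t - slope c u T = (t - T) * (z powr (\<eta> - 1) * m z)"
      using MVT2[OF \<open>T < t\<close>, of "slope c u" "\<lambda>z. z powr (\<eta> - 1) * m z"] T_pos DERIV_slope unfolding m_def by force
    have "slope c u t - slope c u T < 0" using slope_T_pos[OF u(1) c] that(2) by simp
    then have "(t - T) * z powr (\<eta> - 1) * m z < 0" using z(3) by (simp add: mult.assoc)
    moreover have "(t - T) * z powr (\<eta> - 1) > 0" using that(1) z T_pos by (intro mult_pos_pos) auto
    ultimately have "m z < 0" using \<open>T < t\<close> by (simp add: mult_less_0_iff)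
    with z show ?thesis by blast
  qed
  have "\<exists>s>T. slope c u s < 0"
  proof -
    \<comment> \<open>For t^(\<beta> - \<eta>) above X the B-term exceeds the N-term by t^\<eta>
      (\<alpha> |c| + 1); with t \<ge> 1 the slope is at most -1.\<close>
    define X where "X = ((\<eta> - \<alpha>) / \<eta> * N u + \<alpha> * \<bar>c\<bar> + 1) / ((\<beta> - \<alpha>) / \<beta> * B u)"
    obtain t where t: "X \<le> t powr (\<beta> - \<eta>)" "t > max 1 T"
      using ex_powr_ge[of "\<beta> - \<eta>" "max 1 T" X] exponents by auto
    have q: "(\<beta> - \<alpha>) / \<beta> * B u > 0" using exponents u by simp
    have t1: "1 \<le> t powr \<eta>" using t exponents by (simp add: ge_one_powr_ge_zero)
    have "(\<eta> - \<alpha>) / \<eta> * N u + \<alpha> * \<bar>c\<bar> + 1 \<le> t powr (\<beta> - \<eta>) * ((\<beta> - \<alpha>) / \<beta> * B u)"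
      using t(1) unfolding X_def pos_divide_le_eq[OF q] .
    then have "t powr \<eta> * ((\<eta> - \<alpha>) / \<eta> * N u + \<alpha> * \<bar>c\<bar> + 1) \<le> t powr \<eta> * (t powr (\<beta> - \<eta>) * ((\<beta> - \<alpha>) / \<beta> * B u))"
      by (intro mult_left_mono) auto
    also have "\<dots> = (\<beta> - \<alpha>) / \<beta> * (t powr \<eta> * t powr (\<beta> - \<eta>)) * B u"
      by (simp add: mult_ac)
    also have "t powr \<eta> * t powr (\<beta> - \<eta>) = t powr \<beta>" by (simp flip: powr_add)
    finally have "slope c u t \<le> \<alpha> * c - t powr \<eta> * (\<alpha> * \<bar>c\<bar> + 1)"
      by (simp add: slope_def algebra_simps)
    also have "\<dots> \<le> \<alpha> * \<bar>c\<bar> - 1 * (\<alpha> * \<bar>c\<bar> + 1)"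
      using t1 exponents by (intro diff_mono mult_left_mono mult_right_mono) auto
    finally show ?thesis using t(2) by auto
  qed
  then obtain s where s: "T < s" "slope c u s < 0" by blast
  have "\<exists>t\<ge>T. t \<le> s \<and> slope c u t = 0"
    using s slope_T_pos[OF u(1) c] T_pos by (intro IVT2) (auto intro: isCont_slope)
  then obtain t where t: "T \<le> t" "t \<le> s" "slope c u t = 0" by blast
  then have Tt: "T < t" using slope_T_pos[OF u(1) c] by (auto simp: less_le)
  have "slope c u r < 0" if "t < r" for r
  proof -
    obtain z where "T < z" "z < t" "m z < 0" using mvt[OF Tt] t(3) by auto
    then show ?thesis using decr[of z t r] that t(3) T_pos by simp
  qed
  moreover have "slope c u r > 0" if "T < r" "r < t" for r
  proof (rule ccontr)
    assume "\<not> ?thesis"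
    then obtain z where "T < z" "z < r" "m z < 0" "slope c u r \<le> 0" using mvt[OF \<open>T < r\<close>] by auto
    then show False using decr[of z r t] \<open>r < t\<close> t(3) T_pos by simp
  qed
  ultimately have "is_turn c (- 1) W_hi u t"
    unfolding is_turn_def using u Tt by auto
  then show ?thesis by blast
qed

lemma open_pos_cone: "open (pos_cone A)" "open (pos_cone B)"
  unfolding pos_cone_def by (intro open_Collect_less continuous_intros continuous_NAB)+

lemma fibering_lo:
  assumes "c_lo < c" "c < 0"
  shows "fibering N A B \<alpha> \<eta> \<beta> C c 1 W_lo (pos_cone A)"
proof
  show "- u \<in> pos_cone A" "0 < A u" if "u \<in> pos_cone A" for u
    using that by (auto simp: pos_cone_def)
  show "t *\<^sub>R u \<in> pos_cone A" if "u \<in> pos_cone A" "t > 0" for u t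
    using that by (simp add: pos_cone_def homog_eq)
  show "\<exists>t. is_turn c 1 W_lo u t" if "u \<in> pos_cone A" "norm u = 1" for u
    using turning_lo that assms by blast
qed (auto simp: open_pos_cone is_interval_oo)

lemma fibering_hi:
  assumes "c_lo < c"
  shows "fibering N A B \<alpha> \<eta> \<beta> C c (- 1) W_hi (pos_cone A \<inter> pos_cone B)"
proof
  show "- u \<in> pos_cone A \<inter> pos_cone B" "0 < A u" if "u \<in> pos_cone A \<inter> pos_cone B" for u
    using that by (auto simp: pos_cone_def)
  show "t *\<^sub>R u \<in> pos_cone A \<inter> pos_cone B" if "u \<in> pos_cone A \<inter> pos_cone B" "t > 0" for u t
    using that by (simp add: pos_cone_def homog_eq)
  show "\<exists>t. is_turn c (- 1) W_hi u t" if "u \<in> pos_cone A \<inter> pos_cone B" "norm u = 1" for u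
    using turning_hi that assms by (auto simp: pos_cone_def)
qed (use T_pos in \<open>auto simp: open_pos_cone is_interval_1\<close>)

section \<open>Bounds and compactness for the two reduced functionals\<close>

abbreviation "K_lo \<equiv> pos_cone A"
abbreviation "K_hi \<equiv> pos_cone A \<inter> pos_cone B"
abbreviation "J_lo c \<equiv> reduced c 1 W_lo"
abbreviation "J_hi c \<equiv> reduced c (- 1) W_hi"

lemma energy_numerator_lower:
  assumes t: "0 < t" "t \<le> T" and u: "norm u = 1"
  shows "t powr \<eta> / (2 * C * \<eta>) \<le> t powr \<eta> * N u / \<eta> - t powr \<beta> * B u / \<beta>"
proof -
  have ab: "(\<eta> - \<alpha>) / (\<beta> - \<alpha>) \<le> 1" "0 \<le> (\<eta> - \<alpha>) / (\<beta> - \<alpha>)" using exponents by simp_all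
  have "t powr \<beta> * B u \<le> ((\<eta> - \<alpha>) / (2 * C) * t powr \<eta>) / (\<beta> - \<alpha>)"
    using B_dominated_unit[OF assms] exponents by (subst pos_le_divide_eq) (auto simp: mult.commute)
  also have "\<dots> = (\<eta> - \<alpha>) / (\<beta> - \<alpha>) * (t powr \<eta> / (2 * C))" by simp
  also have "\<dots> \<le> 1 * (t powr \<eta> / (2 * C))" using ab C_pos by (intro mult_right_mono) auto
  finally have "t powr \<beta> * B u / \<beta> \<le> t powr \<eta> / (2 * C) / \<beta>" using exponents by (intro divide_right_mono) auto
  also have "\<dots> \<le> t powr \<eta> / (2 * C) / \<eta>" using exponents C_pos by (intro divide_left_mono) auto
  finally have 1: "t powr \<beta> * B u / \<beta> \<le> t powr \<eta> / (2 * C * \<eta>)" by simp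
  have "t powr \<eta> / C / \<eta> \<le> t powr \<eta> * N u / \<eta>"
    using N_unit[OF u, of t] exponents by (intro divide_right_mono) auto
  then have "2 * (t powr \<eta> / (2 * C * \<eta>)) \<le> t powr \<eta> * N u / \<eta>" by simp
  with 1 show ?thesis by linarith
qed

lemma energy_param_lower:
  assumes t: "0 < t" "t \<le> T" and u: "norm u = 1" "A u > 0"
  shows "\<alpha> * (t powr \<eta> / (2 * C * \<eta>) - c) / (t powr \<alpha> * A u) \<le> energy_param c (t *\<^sub>R u)"
  unfolding energy_param_def homog_eq[OF t(1)]
  using energy_numerator_lower[OF t u(1)] u(2) t exponents
  by (intro divide_right_mono mult_left_mono) auto

lemma powr_A_le:
  assumes "0 < t" "t \<le> s" "norm u = 1" "A u > 0"
  shows "t powr \<alpha> * A u \<le> s powr \<alpha> * C" "0 < t powr \<alpha> * A u"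
  using assms unit_bounds(3)[OF assms(3)] exponents by (auto intro!: mult_mono powr_mono2)

lemma turn_lo:
  assumes c: "c_lo < c" "c < 0" and u: "u \<in> K_lo" "norm u = 1"
  shows "0 < turn c 1 W_lo u" "turn c 1 W_lo u < T"
    "J_lo c u = energy_param c (turn c 1 W_lo u *\<^sub>R u)"
    "\<And>t. 0 < t \<Longrightarrow> t < T \<Longrightarrow> J_lo c u \<le> energy_param c (t *\<^sub>R u)"
proof -
  interpret fibering N A B \<alpha> \<eta> \<beta> C c 1 W_lo K_lo by (rule fibering_lo[OF c])
  show "0 < turn c 1 W_lo u" "turn c 1 W_lo u < T" using \<tau>_W[OF u(1)] u(2) by auto
  show "J_lo c u = energy_param c (turn c 1 W_lo u *\<^sub>R u)" by (simp add: reduced_def)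
  show "J_lo c u \<le> energy_param c (t *\<^sub>R u)" if "0 < t" "t < T" for t
    using optimal[OF u(1), of t] u(2) that by simp
qed

lemma turn_hi:
  assumes c: "c_lo < c" and u: "u \<in> K_hi" "norm u = 1"
  shows "T < turn c (- 1) W_hi u"
    "J_hi c u = energy_param c (turn c (- 1) W_hi u *\<^sub>R u)"
    "\<And>t. T \<le> t \<Longrightarrow> energy_param c (t *\<^sub>R u) \<le> J_hi c u"
    "\<And>t. T < t \<Longrightarrow> t < turn c (- 1) W_hi u \<Longrightarrow> 0 < slope c u t"
proof -
  interpret fibering N A B \<alpha> \<eta> \<beta> C c "- 1" W_hi K_hi by (rule fibering_hi[OF c])
  show "T < turn c (- 1) W_hi u" using \<tau>_W[OF u(1)] u(2) by auto
  show "J_hi c u = energy_param c (turn c (- 1) W_hi u *\<^sub>R u)" by (simp add: reduced_def)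
  show "0 < slope c u t" if "T < t" "t < turn c (- 1) W_hi u" for t
    using turn[OF u(1)] u(2) that by (auto simp: is_turn_def)
  have *: "energy_param c (t *\<^sub>R u) \<le> J_hi c u" if "T < t" for t
    using optimal[OF u(1), of t] u(2) that by simp
  \<comment> \<open>The window omits \<open>T\<close>; continuity from the right extends optimality
    to \<open>T\<close>, the radius at which the lower bounds are evaluated.\<close>
  have "continuous_on {0<..} (\<lambda>t. energy_param c (t *\<^sub>R u))"
  proof (rule continuous_on_compose2[OF continuous_energy(1)[of K_hi c]])
    show "A v \<noteq> 0" if "v \<in> K_hi" for v using K(4)[OF that] by simp
    show "(\<lambda>t. t *\<^sub>R u) ` {0<..} \<subseteq> K_hi" using K(3)[OF u(1)] by auto
  qed (intro continuous_intros)
  then have "isCont (\<lambda>t. energy_param c (t *\<^sub>R u)) T"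
    using T_pos by (simp add: continuous_on_eq_continuous_at)
  then have "((\<lambda>t. energy_param c (t *\<^sub>R u)) \<longlongrightarrow> energy_param c (T *\<^sub>R u)) (at_right T)"
    unfolding isCont_def by (rule tendsto_within_subset) simp
  then have "energy_param c (T *\<^sub>R u) \<le> J_hi c u"
    by (rule tendsto_upperbound) (auto intro!: * eventually_at_right_less[THEN eventually_mono])
  with * show "energy_param c (t *\<^sub>R u) \<le> J_hi c u" if "T \<le> t" for t
    using that by (cases "T = t") auto
qed

text \<open>By domination below \<open>T\<close> the numerator at the turning point is at least
  \<alpha> (-c). The bound blows up when A u or the radius tends to 0.\<close>

lemma J_lo_lower:
  assumes c: "c_lo < c" "c < 0" and u: "u \<in> K_lo" "norm u = 1"
  shows "\<alpha> * (- c) / (turn c 1 W_lo u powr \<alpha> * A u) \<le> J_lo c u"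
proof -
  have A: "A u > 0" using u by (simp add: pos_cone_def)
  note t = turn_lo[OF c u]
  have "\<alpha> * (- c) / (turn c 1 W_lo u powr \<alpha> * A u)
      \<le> \<alpha> * (turn c 1 W_lo u powr \<eta> / (2 * C * \<eta>) - c) / (turn c 1 W_lo u powr \<alpha> * A u)"
    using t(1) A exponents C_pos by (intro divide_right_mono mult_left_mono) auto
  also have "\<dots> \<le> J_lo c u"
    unfolding t(3) using t(1,2) A u by (intro energy_param_lower) auto
  finally show ?thesis .
qed

lemma J_lo_pos:
  assumes c: "c_lo < c" "c < 0" and u: "u \<in> K_lo" "norm u = 1"
  shows "0 < J_lo c u"
proof -
  have "0 < \<alpha> * (- c) / (turn c 1 W_lo u powr \<alpha> * A u)"
    using u c exponents turn_lo(1)[OF c u] by (intro divide_pos_pos mult_pos_pos) (auto simp: pos_cone_def)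
  with J_lo_lower[OF assms] show ?thesis by linarith
qed

text \<open>The maximum is at least the value at \<open>T\<close>, which avoids the unknown turning
  radius.\<close>

lemma J_hi_lower:
  assumes c: "c_lo < c" and u: "u \<in> K_hi" "norm u = 1"
  shows "\<alpha> * (c_hi - c) / (T powr \<alpha> * A u) \<le> J_hi c u"
  using energy_param_lower[OF T_pos order_refl u(2), of c] turn_hi(3)[OF assms order_refl] u
  by (simp add: c_hi_def pos_cone_def)

lemma J_hi_pos:
  assumes c: "c_lo < c" "c < c_hi" and u: "u \<in> K_hi" "norm u = 1"
  shows "0 < J_hi c u"
proof -
  have "0 < \<alpha> * (c_hi - c) / (T powr \<alpha> * A u)"
    using u c exponents T_pos by (auto simp: pos_cone_def intro!: divide_pos_pos mult_pos_pos)
  with J_hi_lower[OF c(1) u] show ?thesis by linarith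
qed

text \<open>For tiny B u the N-term at a fixed large radius would push the maximum above L. Once B u
  \<ge> b, the slope is negative at a fixed R, so the turning point comes no later.\<close>

lemma J_hi_sublevel:
  "\<exists>b>0. \<exists>R. \<forall>c u. c_lo < c \<longrightarrow> c < c_hi \<longrightarrow> u \<in> K_hi \<longrightarrow> norm u = 1 \<longrightarrow> J_hi c u \<le> L \<longrightarrow>
     b \<le> B u \<and> turn c (- 1) W_hi u \<le> R"
proof -
  define D where "D = \<bar>L\<bar> * C / \<alpha>"
  \<comment> \<open>At radius s the N-term is at least (D + 1 + c_hi) s^\<alpha>, while L allows
    only D s^\<alpha> + c for its excess over the B-term. So the B-term is at least 1, which
    determines \<open>b\<close>.\<close>
  obtain s where s: "max 1 T < s" "C * \<eta> * (D + 1 + c_hi) \<le> s powr (\<eta> - \<alpha>)"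
    using ex_powr_ge[of "\<eta> - \<alpha>" "max 1 T" "C * \<eta> * (D + 1 + c_hi)"] exponents by auto
  define b where "b = \<beta> / s powr \<beta>"
  have b: "b > 0" using s exponents by (simp add: b_def)
  \<comment> \<open>Above this value of R^(\<beta> - \<eta>) the B-term of the slope outweighs the
    N-term and \<alpha> c, for all admissible energies at once.\<close>
  define X where "X = ((\<eta> - \<alpha>) / \<eta> * C + \<alpha> * c_hi) / ((\<beta> - \<alpha>) / \<beta> * b)"
  obtain R where R: "max 1 T < R" "X \<le> R powr (\<beta> - \<eta>)"
    using ex_powr_ge[of "\<beta> - \<eta>" "max 1 T" X] exponents by auto
  have "b \<le> B u \<and> turn c (- 1) W_hi u \<le> R"
    if c: "c_lo < c" "c < c_hi" and u: "u \<in> K_hi" "norm u = 1" and L: "J_hi c u \<le> L" for c u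
  proof
    have AB: "A u > 0" "B u > 0" using u by (auto simp: pos_cone_def)
    have s0: "s > 0" "s \<ge> 1" "T \<le> s" using s by auto
    have "energy_param c (s *\<^sub>R u) \<le> \<bar>L\<bar>" using turn_hi(3)[OF c(1) u s0(3)] L by simp
    then have "\<alpha> * (s powr \<eta> * N u / \<eta> - s powr \<beta> * B u / \<beta> - c) \<le> \<bar>L\<bar> * (s powr \<alpha> * A u)"
      using s0 AB by (simp add: energy_param_def homog_eq pos_divide_le_eq)
    also have "\<dots> \<le> \<bar>L\<bar> * (s powr \<alpha> * C)"
      by (rule mult_left_mono[OF powr_A_le(1)[OF s0(1) order_refl u(2) AB(1)] abs_ge_zero])
    also have "\<dots> = \<alpha> * (D * s powr \<alpha>)" using exponents by (simp add: D_def)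
    finally have 1: "s powr \<eta> * N u / \<eta> - s powr \<beta> * B u / \<beta> - c \<le> D * s powr \<alpha>"
      using exponents by simp
    have "(D + 1 + c_hi) * s powr \<alpha> \<le> s powr (\<eta> - \<alpha>) / (C * \<eta>) * s powr \<alpha>"
      using s(2) C_pos exponents by (intro mult_right_mono) (auto simp: field_simps)
    also have "\<dots> = s powr \<eta> / C / \<eta>"
      by (simp flip: powr_add)
    also have "\<dots> \<le> s powr \<eta> * N u / \<eta>"
      using N_unit[OF u(2), of s] exponents by (intro divide_right_mono) auto
    finally have 2: "(D + 1 + c_hi) * s powr \<alpha> \<le> s powr \<eta> * N u / \<eta>" .
    have "(1 + c_hi) * 1 \<le> (1 + c_hi) * s powr \<alpha>"
      using s0 exponents c_hi_pos by (intro mult_left_mono) (auto simp: ge_one_powr_ge_zero)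
    with 1 2 c have "1 \<le> s powr \<beta> * B u / \<beta>" by (simp add: distrib_right)
    then show bB: "b \<le> B u" using s0 exponents by (simp add: b_def field_simps)
    show "turn c (- 1) W_hi u \<le> R"
    proof (rule ccontr)
      assume "\<not> ?thesis"
      then have "0 < slope c u R" using turn_hi(4)[OF c(1) u, of R] R(1) by simp
      have q: "(\<beta> - \<alpha>) / \<beta> * b > 0" using exponents b by simp
      have R1: "1 \<le> R powr \<eta>" using R exponents by (simp add: ge_one_powr_ge_zero)
      have "(\<eta> - \<alpha>) / \<eta> * C + \<alpha> * c_hi \<le> R powr (\<beta> - \<eta>) * ((\<beta> - \<alpha>) / \<beta> * b)"
        using R(2) unfolding X_def pos_divide_le_eq[OF q] .
      then have "R powr \<eta> * ((\<eta> - \<alpha>) / \<eta> * C + \<alpha> * c_hi) \<le> R powr \<eta> * (R powr (\<beta> - \<eta>) * ((\<beta> - \<alpha>) / \<beta> * b))"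
        by (intro mult_left_mono) auto
      also have "\<dots> = (\<beta> - \<alpha>) / \<beta> * (R powr \<eta> * R powr (\<beta> - \<eta>)) * b" by (simp add: mult_ac)
      also have "R powr \<eta> * R powr (\<beta> - \<eta>) = R powr \<beta>" by (simp flip: powr_add)
      also have "(\<beta> - \<alpha>) / \<beta> * R powr \<beta> * b \<le> (\<beta> - \<alpha>) / \<beta> * R powr \<beta> * B u"
        using bB exponents by (intro mult_left_mono) auto
      finally have 3: "R powr \<eta> * ((\<eta> - \<alpha>) / \<eta> * C) + R powr \<eta> * (\<alpha> * c_hi) \<le> (\<beta> - \<alpha>) / \<beta> * R powr \<beta> * B u"
        by (simp only: distrib_left)
      have 4: "(\<eta> - \<alpha>) / \<eta> * R powr \<eta> * N u \<le> (\<eta> - \<alpha>) / \<eta> * R powr \<eta> * C"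
        using unit_bounds[OF u(2)] exponents by (intro mult_left_mono) auto
      have "1 * (\<alpha> * c_hi) \<le> R powr \<eta> * (\<alpha> * c_hi)"
        using R1 exponents c_hi_pos by (intro mult_right_mono) auto
      moreover have "\<alpha> * c < \<alpha> * c_hi" using c exponents by simp
      ultimately have "slope c u R < 0" using 3 4 unfolding slope_def by (simp add: mult_ac)
      with \<open>0 < slope c u R\<close> show False by simp
    qed
  qed
  with b show ?thesis by blast
qed

lemma denominator_lower_bound:
  assumes "0 < p" "0 < q" "p / (q * a) \<le> L" "0 < (a :: real)"
  shows "0 < L" "p / (q * L) \<le> a"
proof -
  have "0 < p / (q * a)" using assms by simp
  then show L: "0 < L" using assms(3) by linarith
  show "p / (q * L) \<le> a" using assms L by (simp add: field_simps)
qed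

text \<open>\<open>J_lo_lower\<close> is used twice: with the radius below \<open>T\<close> it
  bounds A u from below on sublevels, with A u \<le> C it bounds the radius from below.\<close>

lemma even_cone_functional_lo:
  assumes c: "c_lo < c" "c < 0"
  shows "even_cone_functional K_lo (J_lo c) (reduced_deriv c 1 W_lo)"
proof -
  interpret fibering N A B \<alpha> \<eta> \<beta> C c 1 W_lo K_lo by (rule fibering_lo[OF c])
  have p: "\<alpha> * (- c) > 0" using c exponents by (intro mult_pos_pos) auto
  have est: "\<alpha> * (- c) / (T powr \<alpha> * L) \<le> A u" "L > 0" "\<alpha> * (- c) / (C * L) \<le> \<tau> u powr \<alpha>"
    if u: "u \<in> K_lo" "norm u = 1" "J u \<le> L" for u L
  proof -
    have A: "A u > 0" using K(4)[OF u(1)] .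
    note t = turn_lo[OF c u(1,2)]
    have low: "\<alpha> * (- c) / (\<tau> u powr \<alpha> * A u) \<le> L" using J_lo_lower[OF c u(1,2)] u(3) by simp
    have "\<alpha> * (- c) / (T powr \<alpha> * A u) \<le> \<alpha> * (- c) / (\<tau> u powr \<alpha> * A u)"
      using p t A exponents by (intro divide_left_mono mult_right_mono powr_mono2 mult_pos_pos) auto
    with low have "\<alpha> * (- c) / (T powr \<alpha> * A u) \<le> L" by linarith
    from denominator_lower_bound[OF p _ this A] T_pos
    show "\<alpha> * (- c) / (T powr \<alpha> * L) \<le> A u" "L > 0" by auto
    have "\<alpha> * (- c) / (C * \<tau> u powr \<alpha>) \<le> \<alpha> * (- c) / (\<tau> u powr \<alpha> * A u)"
      using p t A C_pos unit_bounds(3)[OF u(2)]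
      by (subst mult.commute) (intro divide_left_mono mult_left_mono mult_pos_pos, auto)
    with low have "\<alpha> * (- c) / (C * \<tau> u powr \<alpha>) \<le> L" by linarith
    from denominator_lower_bound(2)[OF p C_pos this] t(1) show "\<alpha> * (- c) / (C * L) \<le> \<tau> u powr \<alpha>" by simp
  qed
  show ?thesis
  proof (rule reduced_functional)
    show "0 \<le> J u" if "u \<in> K_lo" "norm u = 1" for u using J_lo_pos[OF c that] by simp
    fix L
    show "\<exists>Z. closed Z \<and> {u\<in>K_lo. norm u = 1 \<and> J u \<le> L} \<subseteq> Z \<and> Z \<subseteq> K_lo"
    proof (cases "L > 0")
      case True
      let ?a = "\<alpha> * (- c) / (T powr \<alpha> * L)"
      have "?a > 0" using True T_pos by (intro divide_pos_pos p mult_pos_pos) auto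
      moreover have "closed {u. ?a \<le> A u}" by (intro closed_Collect_le continuous_intros continuous_NAB)
      ultimately show ?thesis
        using est(1) by (intro exI[of _ "{u. ?a \<le> A u}"]) (auto simp: pos_cone_def)
    next
      case False
      then have "{u\<in>K_lo. norm u = 1 \<and> J u \<le> L} = {}" using est(2) by blast
      then show ?thesis by (intro exI[of _ "{}"]) simp
    qed
    show "\<exists>a>0. \<forall>u\<in>K_lo. norm u = 1 \<longrightarrow> J u \<le> L \<longrightarrow> a \<le> \<tau> u \<and> \<tau> u \<le> 1 / a"
    proof (cases "L > 0")
      case True
      define m where "m = (\<alpha> * (- c) / (C * L)) powr (1 / \<alpha>)"
      define a where "a = min m (1 / T)"
      have "m > 0" using c exponents True C_pos by (simp add: m_def)
      then have a: "a > 0" using T_pos by (simp add: a_def)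
      have "a \<le> \<tau> u \<and> \<tau> u \<le> 1 / a" if u: "u \<in> K_lo" "norm u = 1" "J u \<le> L" for u
      proof
        note t = turn_lo[OF c u(1,2)]
        have "0 \<le> \<alpha> * (- c) / (C * L)" using p True C_pos by (intro divide_nonneg_pos mult_pos_pos) auto
        from powr_mono2[OF _ this est(3)[OF u], of "1 / \<alpha>"]
        have "m \<le> (\<tau> u powr \<alpha>) powr (1 / \<alpha>)" using exponents by (simp add: m_def)
        then show "a \<le> \<tau> u" using t(1) exponents by (simp add: powr_powr a_def)
        have "T \<le> 1 / a" using T_pos a by (simp add: a_def field_simps min_def)
        then show "\<tau> u \<le> 1 / a" using t(2) by simp
      qed
      with a show ?thesis by blast
    next
      case False
      then show ?thesis using est(2) by (intro exI[of _ 1]) auto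
    qed
  qed
qed

text \<open>A u is bounded below by \<open>J_hi_lower\<close>; \<open>J_hi_sublevel\<close> bounds B
  u below and the radius above, and radii exceed \<open>T\<close> anyway.\<close>

lemma even_cone_functional_hi:
  assumes c: "c_lo < c" "c < c_hi"
  shows "even_cone_functional K_hi (J_hi c) (reduced_deriv c (- 1) W_hi)"
proof -
  interpret fibering N A B \<alpha> \<eta> \<beta> C c "- 1" W_hi K_hi by (rule fibering_hi[OF c(1)])
  have p: "\<alpha> * (c_hi - c) > 0" using c exponents by (intro mult_pos_pos) auto
  have est: "\<alpha> * (c_hi - c) / (T powr \<alpha> * L) \<le> A u" "L > 0"
    if u: "u \<in> K_hi" "norm u = 1" "J u \<le> L" for u L
  proof -
    have "\<alpha> * (c_hi - c) / (T powr \<alpha> * A u) \<le> L" using J_hi_lower[OF c(1) u(1,2)] u(3) by simp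
    from denominator_lower_bound[OF p _ this K(4)[OF u(1)]] T_pos
    show "\<alpha> * (c_hi - c) / (T powr \<alpha> * L) \<le> A u" "L > 0" by auto
  qed
  show ?thesis
  proof (rule reduced_functional)
    show "0 \<le> J u" if "u \<in> K_hi" "norm u = 1" for u using J_hi_pos[OF c that] by simp
    fix L
    obtain b R where b: "b > 0" "\<And>u. u \<in> K_hi \<Longrightarrow> norm u = 1 \<Longrightarrow> J u \<le> L \<Longrightarrow> b \<le> B u \<and> \<tau> u \<le> R"
      using J_hi_sublevel[of L] c by blast
    show "\<exists>Z. closed Z \<and> {u\<in>K_hi. norm u = 1 \<and> J u \<le> L} \<subseteq> Z \<and> Z \<subseteq> K_hi"
    proof (cases "L > 0")
      case True
      let ?a = "\<alpha> * (c_hi - c) / (T powr \<alpha> * L)"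
      have "?a > 0" using p True T_pos by simp
      moreover have "closed ({u. ?a \<le> A u} \<inter> {u. b \<le> B u})"
        by (intro closed_Int closed_Collect_le continuous_intros continuous_NAB)
      ultimately show ?thesis
        using est(1) b by (intro exI[of _ "{u. ?a \<le> A u} \<inter> {u. b \<le> B u}"]) (auto simp: pos_cone_def)
    next
      case False
      then have "{u\<in>K_hi. norm u = 1 \<and> J u \<le> L} = {}" using est(2) by blast
      then show ?thesis by (intro exI[of _ "{}"]) simp
    qed
    define a where "a = min T (1 / max R 1)"
    have a: "a > 0" using T_pos by (simp add: a_def)
    have "a \<le> 1 / max R 1" by (simp add: a_def)
    then have "max R 1 * a \<le> 1" by (subst (asm) pos_le_divide_eq) (auto simp: mult.commute)
    then have "max R 1 \<le> 1 / a" using a by (simp only: pos_le_divide_eq)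
    then have "a \<le> \<tau> u \<and> \<tau> u \<le> 1 / a" if u: "u \<in> K_hi" "norm u = 1" "J u \<le> L" for u
      using b(2)[OF u] turn_hi(1)[OF c(1) u(1,2)] by (auto simp: a_def)
    with a show "\<exists>a>0. \<forall>u\<in>K_hi. norm u = 1 \<longrightarrow> J u \<le> L \<longrightarrow> a \<le> \<tau> u \<and> \<tau> u \<le> 1 / a" by blast
  qed
qed

end

section \<open>Dependence of the minimax levels on the energy\<close>

context homogeneous_functionals
begin

abbreviation "mm_lo c k \<equiv> minimax K_lo (J_lo c) k"
abbreviation "mm_hi c k \<equiv> minimax K_hi (J_hi c) k"

lemma minimax_sets_K:
  assumes "1 \<le> k"
  shows "enat k \<le> cone_genus K_lo \<Longrightarrow> minimax_sets K_lo k \<noteq> {}"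
    "enat k \<le> cone_genus K_hi \<Longrightarrow> minimax_sets K_hi k \<noteq> {}"
    "minimax_sets K_hi k \<noteq> {} \<Longrightarrow> minimax_sets K_lo k \<noteq> {}"
proof -
  have "A 0 \<le> 0" using bounds(3)[of 0] exponents by auto
  then have 0: "0 \<notin> K_lo" "0 \<notin> K_hi" by (auto simp: pos_cone_def)
  show "minimax_sets K_lo k \<noteq> {}" if "enat k \<le> cone_genus K_lo"
    by (rule minimax_sets_cone_genus[OF assms that 0(1)]) (simp add: pos_cone_def homog_eq)
  show "minimax_sets K_hi k \<noteq> {}" if "enat k \<le> cone_genus K_hi"
    by (rule minimax_sets_cone_genus[OF assms that 0(2)]) (simp add: pos_cone_def homog_eq)
  show "minimax_sets K_lo k \<noteq> {}" if "minimax_sets K_hi k \<noteq> {}"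
    using that minimax_sets_mono[OF order_refl, of K_hi K_lo k] by auto
qed

text \<open>The norm bound is what later sends the critical points to 0 as the energy tends to
  0.\<close>

lemma critical_lo:
  assumes c: "c_lo < c" "c < 0" and k: "1 \<le> k" "minimax_sets K_lo k \<noteq> {}"
  obtains v where "v \<in> K_lo" "Phi \<eta> \<alpha> \<beta> N A B (mm_lo c k) v = c"
    "dual_deriv (Phi \<eta> \<alpha> \<beta> N A B (mm_lo c k)) v = 0" "0 < mm_lo c k"
    "norm v \<le> 2 * (2 * \<eta> * C * \<alpha> / (\<eta> - \<alpha>) * (- c)) powr (1 / \<eta>)"
proof -
  interpret fibering N A B \<alpha> \<eta> \<beta> C c 1 W_lo K_lo by (rule fibering_lo[OF c])
  obtain x where x: "x \<in> K_lo" "norm x = 1" "J x = mm_lo c k" "G x = 0"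
    by (rule even_cone_functional.minimax_critical[OF even_cone_functional_lo[OF c] k])
  obtain v where v: "v \<in> K_lo" "norm v = \<tau> x" "Phi \<eta> \<alpha> \<beta> N A B (J x) v = c"
    "dual_deriv (Phi \<eta> \<alpha> \<beta> N A B (J x)) v = 0"
    by (rule critical_point[OF x(1,2,4)])
  note t = turn_lo[OF c x(1,2)]
  \<comment> \<open>Half the turning radius lies strictly before the sign change; there
    \<open>slope_lower\<close> bounds the radius by a multiple of (-c)^(1/\<eta>).\<close>
  have "slope c x (\<tau> x / 2) < 0"
    using turn[OF x(1)] x(2) t(1,2) by (simp add: is_turn_def)
  moreover have "(\<eta> - \<alpha>) * (\<tau> x / 2) powr \<eta> / (2 * \<eta> * C) + \<alpha> * c \<le> slope c x (\<tau> x / 2)"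
    using t(1,2) by (intro slope_lower x(2)) auto
  ultimately have "(\<eta> - \<alpha>) * (\<tau> x / 2) powr \<eta> / (2 * \<eta> * C) < \<alpha> * (- c)" by simp
  then have "(\<tau> x / 2) powr \<eta> \<le> 2 * \<eta> * C * \<alpha> / (\<eta> - \<alpha>) * (- c)"
    using exponents C_pos by (simp add: field_simps)
  then have "((\<tau> x / 2) powr \<eta>) powr (1 / \<eta>) \<le> (2 * \<eta> * C * \<alpha> / (\<eta> - \<alpha>) * (- c)) powr (1 / \<eta>)"
    using exponents by (intro powr_mono2) auto
  moreover have "((\<tau> x / 2) powr \<eta>) powr (1 / \<eta>) = \<tau> x / 2"
    using t(1) exponents by (simp add: powr_powr)
  ultimately have "norm v \<le> 2 * (2 * \<eta> * C * \<alpha> / (\<eta> - \<alpha>) * (- c)) powr (1 / \<eta>)"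
    using v(2) by simp
  then show thesis using that v x(3) J_lo_pos[OF c x(1,2)] by simp
qed

lemma critical_hi:
  assumes c: "c_lo < c" "c < c_hi" and k: "1 \<le> k" "minimax_sets K_hi k \<noteq> {}"
  obtains v where "v \<in> K_hi" "Phi \<eta> \<alpha> \<beta> N A B (mm_hi c k) v = c"
    "dual_deriv (Phi \<eta> \<alpha> \<beta> N A B (mm_hi c k)) v = 0" "0 < mm_hi c k"
proof -
  interpret fibering N A B \<alpha> \<eta> \<beta> C c "- 1" W_hi K_hi by (rule fibering_hi[OF c(1)])
  obtain x where x: "x \<in> K_hi" "norm x = 1" "J x = mm_hi c k" "G x = 0"
    by (rule even_cone_functional.minimax_critical[OF even_cone_functional_hi[OF c] k])
  obtain v where v: "v \<in> K_hi" "norm v = \<tau> x" "Phi \<eta> \<alpha> \<beta> N A B (J x) v = c"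
    "dual_deriv (Phi \<eta> \<alpha> \<beta> N A B (J x)) v = 0"
    by (rule critical_point[OF x(1,2,4)])
  then show thesis using that x(3) J_hi_pos[OF c x(1,2)] by simp
qed

text \<open>In the applications \<open>y\<close> is \<alpha> / (radius^\<alpha> A), \<open>j\<close>
  the reduced value at energy d, and the last assumption its lower bound.\<close>

lemma ratio_bound:
  fixes c d e x y j :: real
  assumes "c < d" "d < e" "x \<le> j + (d - c) * y" "(e - d) * y \<le> j"
  shows "x \<le> (e - c) / (e - d) * j"
proof -
  have "(d - c) * y \<le> (d - c) * (j / (e - d))"
    using assms by (intro mult_left_mono) (auto simp: pos_le_divide_eq mult.commute)
  then have "x \<le> j + (d - c) * (j / (e - d))" using assms(3) by linarith
  also have "\<dots> = (e - c) / (e - d) * j" using assms(2) by (simp add: field_simps)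
  finally show ?thesis .
qed

text \<open>The minimising radius at energy c competes at energy d. The gain is uniform: radii are
  below \<open>T\<close>, and A is at most \<open>C\<close> on unit vectors.\<close>

lemma mm_lo_decrease:
  assumes c: "c_lo < c" "c < d" "d < 0" and k: "1 \<le> k" "minimax_sets K_lo k \<noteq> {}"
  shows "mm_lo d k < mm_lo c k"
proof -
  have c': "c < 0" "c_lo < d" using c by auto
  let ?d = "\<alpha> * (d - c) / (T powr \<alpha> * C)"
  have "mm_lo d k \<le> mm_lo c k + - ?d"
  proof (rule minimax_compare[OF k order_refl])
    show "continuous_on K_lo (J_lo c)"
      by (rule even_cone_functional.continuous_J[OF even_cone_functional_lo[OF c(1) c'(1)]])
    show "0 \<le> J_lo d x" if "x \<in> K_lo" for x
      by (rule even_cone_functional.J_nonneg[OF even_cone_functional_lo[OF c'(2) c(3)] that])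
    show "mm_lo c k < mm_lo c k + 1" by simp
    fix x assume x: "x \<in> K_lo" "norm x = 1"
    have A: "A x > 0" using x by (simp add: pos_cone_def)
    note t = turn_lo[OF c(1) c'(1) x]
    let ?t = "turn c 1 W_lo x"
    have "J_lo d x \<le> energy_param d (?t *\<^sub>R x)"
      by (rule turn_lo(4)[OF c'(2) c(3) x t(1,2)])
    also have "\<dots> = J_lo c x - \<alpha> * (d - c) / (?t powr \<alpha> * A x)"
      using energy_param_shift[OF t(1) A, of d c] t(3) by simp
    also have "\<dots> \<le> J_lo c x - ?d"
      using powr_A_le[OF t(1) less_imp_le[OF t(2)] x(2) A] c exponents C_pos T_pos A t(1)
      by (intro diff_left_mono divide_left_mono mult_pos_pos) auto
    finally show "J_lo d x \<le> J_lo c x + - ?d" by simp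
  qed
  moreover have "?d > 0" using c exponents C_pos T_pos by (intro divide_pos_pos mult_pos_pos) auto
  ultimately show ?thesis by linarith
qed

text \<open>The minimising radius at energy d competes at energy c; \<open>J_lo_lower\<close> at
  energy d, linear in -d, absorbs the loss.\<close>

lemma mm_lo_ratio:
  assumes c: "c_lo < c" "c < d" "d < 0" and k: "1 \<le> k" "minimax_sets K_lo k \<noteq> {}"
  shows "mm_lo c k \<le> (0 - c) / (0 - d) * mm_lo d k"
proof -
  have c': "c < 0" "c_lo < d" using c by auto
  show ?thesis
  proof (rule minimax_compare_mult[OF k])
    show "continuous_on K_lo (J_lo d)"
      by (rule even_cone_functional.continuous_J[OF even_cone_functional_lo[OF c'(2) c(3)]])
    show "0 \<le> J_lo c x" if "x \<in> K_lo" for x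
      by (rule even_cone_functional.J_nonneg[OF even_cone_functional_lo[OF c(1) c'(1)] that])
    show "(0 - c) / (0 - d) > 0" using c c' by (intro divide_pos_pos) auto
    fix x assume x: "x \<in> K_lo" "norm x = 1"
    have A: "A x > 0" using x by (simp add: pos_cone_def)
    note t = turn_lo[OF c'(2) c(3) x]
    let ?t = "turn d 1 W_lo x"
    have "J_lo c x \<le> energy_param c (?t *\<^sub>R x)"
      by (rule turn_lo(4)[OF c(1) c'(1) x t(1,2)])
    also have "\<dots> = J_lo d x + (d - c) * (\<alpha> / (?t powr \<alpha> * A x))"
      using energy_param_shift[OF t(1) A, of d c] t(3) by simp
    finally show "J_lo c x \<le> (0 - c) / (0 - d) * J_lo d x"
      by (rule ratio_bound[OF c(2,3)]) (use J_lo_lower[OF c'(2) c(3) x] in \<open>simp add: mult.commute\<close>)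
  qed
qed

text \<open>For maxima it is the radius of the larger energy d that competes at energy c. Such radii
  are bounded only on sublevels, hence the level \<open>mm_hi c k + 1\<close>.\<close>

lemma mm_hi_decrease:
  assumes c: "c_lo < c" "c < d" "d < c_hi" and k: "1 \<le> k" "minimax_sets K_hi k \<noteq> {}"
  shows "mm_hi d k < mm_hi c k"
proof -
  have c': "c < c_hi" "c_lo < d" using c by auto
  obtain R where R: "\<And>u. u \<in> K_hi \<Longrightarrow> norm u = 1 \<Longrightarrow> J_hi d u \<le> mm_hi c k + 1 \<Longrightarrow> turn d (- 1) W_hi u \<le> R"
    using J_hi_sublevel[of "mm_hi c k + 1"] c(3) c'(2) by blast
  define S where "S = max R T"
  have S: "S > 0" using T_pos by (simp add: S_def)
  let ?d = "\<alpha> * (d - c) / (S powr \<alpha> * C)"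
  have "mm_hi d k \<le> mm_hi c k + - ?d"
  proof (rule minimax_compare[OF k order_refl])
    show "continuous_on K_hi (J_hi c)"
      by (rule even_cone_functional.continuous_J[OF even_cone_functional_hi[OF c(1) c'(1)]])
    show "0 \<le> J_hi d x" if "x \<in> K_hi" for x
      by (rule even_cone_functional.J_nonneg[OF even_cone_functional_hi[OF c'(2) c(3)] that])
    show "mm_hi c k < mm_hi c k + 1" by simp
    fix x assume x: "x \<in> K_hi" "norm x = 1" "J_hi c x \<le> mm_hi c k + 1"
    have A: "A x > 0" using x by (simp add: pos_cone_def)
    let ?t = "turn d (- 1) W_hi x"
    note t = turn_hi[OF c'(2) x(1,2)]
    have t0: "?t > 0" using t(1) T_pos by simp
    have "energy_param c (?t *\<^sub>R x) \<le> J_hi c x"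
      using turn_hi(3)[OF c(1) x(1,2)] t(1) by simp
    then have 1: "J_hi d x \<le> J_hi c x - \<alpha> * (d - c) / (?t powr \<alpha> * A x)"
      using energy_param_shift[OF t0 A, of d c] t(2) by simp
    moreover have "0 \<le> \<alpha> * (d - c) / (?t powr \<alpha> * A x)"
      using c exponents A by (intro divide_nonneg_nonneg mult_nonneg_nonneg) auto
    \<comment> \<open>Dropping the gain puts x into the sublevel at energy d, which bounds its
      radius; only then does the gain become uniform.\<close>
    ultimately have "J_hi d x \<le> mm_hi c k + 1" using x(3) by linarith
    then have "?t \<le> S" using R[OF x(1,2)] by (simp add: S_def)
    then have "?d \<le> \<alpha> * (d - c) / (?t powr \<alpha> * A x)"
      using powr_A_le[OF t0 \<open>?t \<le> S\<close> x(2) A] c exponents C_pos S A t0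
      by (intro divide_left_mono mult_pos_pos) auto
    with 1 show "J_hi d x \<le> J_hi c x + - ?d" by linarith
  qed
  moreover have "?d > 0" using c exponents C_pos S by (intro divide_pos_pos mult_pos_pos) auto
  ultimately show ?thesis by linarith
qed

text \<open>The maximising radius at energy c competes at energy d. It exceeds \<open>T\<close>, and
  \<open>J_hi_lower\<close> at energy d, linear in c_hi - d, absorbs the remaining term.\<close>

lemma mm_hi_ratio:
  assumes c: "c_lo < c" "c < d" "d < c_hi" and k: "1 \<le> k" "minimax_sets K_hi k \<noteq> {}"
  shows "mm_hi c k \<le> (c_hi - c) / (c_hi - d) * mm_hi d k"
proof -
  have c': "c < c_hi" "c_lo < d" using c by auto
  show ?thesis
  proof (rule minimax_compare_mult[OF k])
    show "continuous_on K_hi (J_hi d)"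
      by (rule even_cone_functional.continuous_J[OF even_cone_functional_hi[OF c'(2) c(3)]])
    show "0 \<le> J_hi c x" if "x \<in> K_hi" for x
      by (rule even_cone_functional.J_nonneg[OF even_cone_functional_hi[OF c(1) c'(1)] that])
    show "(c_hi - c) / (c_hi - d) > 0" using c c' by (intro divide_pos_pos) auto
    fix x assume x: "x \<in> K_hi" "norm x = 1"
    have A: "A x > 0" using x by (simp add: pos_cone_def)
    let ?t = "turn c (- 1) W_hi x"
    note t = turn_hi[OF c(1) x]
    have t0: "?t > 0" using t(1) T_pos by simp
    have "J_hi c x = energy_param d (?t *\<^sub>R x) + (d - c) * (\<alpha> / (?t powr \<alpha> * A x))"
      using energy_param_shift[OF t0 A, of d c] t(2) by simp
    also have "\<dots> \<le> J_hi d x + (d - c) * (\<alpha> / (T powr \<alpha> * A x))"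
    proof (intro add_mono mult_left_mono divide_left_mono mult_right_mono mult_pos_pos)
      show "energy_param d (?t *\<^sub>R x) \<le> J_hi d x" using turn_hi(3)[OF c'(2) x] t(1) by simp
      show "T powr \<alpha> \<le> ?t powr \<alpha>" using t(1) T_pos exponents by (intro powr_mono2) auto
    qed (use A T_pos t0 exponents c in auto)
    finally show "J_hi c x \<le> (c_hi - c) / (c_hi - d) * J_hi d x"
      by (rule ratio_bound[OF c(2,3)]) (use J_hi_lower[OF c'(2) x] in \<open>simp add: mult.commute\<close>)
  qed
qed

text \<open>On some interval [s, T] the slope has a positive lower bound common to all rays, so the
  fiber rises there by a fixed amount; the minimum is at most the value at s, the maximum at least
  the value at \<open>T\<close>.\<close>

lemma mm_lo_less_hi:
  assumes c: "c_lo < c" "c < 0" and k: "1 \<le> k" "minimax_sets K_hi k \<noteq> {}"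
  shows "mm_lo c k < mm_hi c k"
proof -
  have ch: "c < c_hi" using c c_hi_pos by simp
  define m where "m s = (\<eta> - \<alpha>) * s powr \<eta> / (2 * \<eta> * C) + \<alpha> * c" for s
  have "\<alpha> * c_lo < \<alpha> * c" using c exponents by simp
  moreover have "\<alpha> * c_lo = - ((\<eta> - \<alpha>) * T powr \<eta> / (2 * \<eta> * C))"
    using exponents by (simp add: c_lo_def)
  ultimately have "0 < m T" by (simp add: m_def)
  moreover have "(m \<longlongrightarrow> m T) (at_left T)"
    unfolding m_def using T_pos exponents C_pos by (intro tendsto_intros) auto
  ultimately have "\<forall>\<^sub>F s in at_left T. 0 < m s" by (rule order_tendstoD(1)[rotated])
  moreover have "\<forall>\<^sub>F s in at_left T. s \<in> {0<..<T}" using T_pos by (rule eventually_at_left_real)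
  ultimately have "\<forall>\<^sub>F s in at_left T. 0 < m s \<and> s \<in> {0<..<T}" by (rule eventually_conj)
  from eventually_happens'[OF trivial_limit_at_left_real this] obtain s where s: "0 < m s" "0 < s" "s < T"
    by auto
  \<comment> \<open>Mean value estimate of the rise: on [s, T] the power is smallest at
    \<open>T\<close> and \<open>m\<close> is smallest at s.\<close>
  define d where "d = (T - s) * (T powr (- \<alpha> - 1) * m s)"
  have d: "d > 0" using s T_pos by (simp add: d_def)
  have "mm_lo c k \<le> mm_hi c k + - (\<alpha> / C * d)"
  proof (rule minimax_compare[OF k])
    show "K_hi \<subseteq> K_lo" by auto
    show "continuous_on K_hi (J_hi c)"
      by (rule even_cone_functional.continuous_J[OF even_cone_functional_hi[OF c(1) ch]])
    show "0 \<le> J_lo c x" if "x \<in> K_lo" for x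
      by (rule even_cone_functional.J_nonneg[OF even_cone_functional_lo[OF c] that])
    show "mm_hi c k < mm_hi c k + 1" by simp
    fix x assume x: "x \<in> K_hi" "norm x = 1"
    have A: "A x > 0" "A x \<le> C" using x unit_bounds(3) by (auto simp: pos_cone_def)
    have "J_lo c x \<le> energy_param c (s *\<^sub>R x)" using turn_lo(4)[OF c _ x(2)] x(1) s by simp
    moreover have "energy_param c (T *\<^sub>R x) \<le> J_hi c x" using turn_hi(3)[OF c(1) x] by simp
    moreover have "\<alpha> / C * d \<le> energy_param c (T *\<^sub>R x) - energy_param c (s *\<^sub>R x)"
    proof -
      obtain z where z: "s < z" "z < T" "fiber c x T - fiber c x s = (T - s) * (z powr (- \<alpha> - 1) * slope c x z)"
        using MVT2[OF s(3), of "fiber c x" "\<lambda>z. z powr (- \<alpha> - 1) * slope c x z"] DERIV_fiber s(2) by force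
      have "m s \<le> m z"
        unfolding m_def using z s exponents C_pos
        by (intro add_mono divide_right_mono mult_left_mono powr_mono2) auto
      also have "m z \<le> slope c x z" unfolding m_def using z s by (intro slope_lower x(2)) auto
      finally have mz: "m s \<le> slope c x z" .
      have "d \<le> (T - s) * (z powr (- \<alpha> - 1) * slope c x z)"
        unfolding d_def using mz s z exponents T_pos
        by (intro mult_left_mono mult_mono powr_mono2') auto
      then have "d \<le> fiber c x T - fiber c x s" using z(3) by simp
      then have "\<alpha> / C * d \<le> \<alpha> / A x * (fiber c x T - fiber c x s)"
        using A exponents C_pos d by (intro mult_mono divide_left_mono mult_pos_pos) auto
      then show ?thesis using T_pos s(2) by (simp add: energy_param_scale right_diff_distrib)
    qed
    ultimately show "J_lo c x \<le> J_hi c x + - (\<alpha> / C * d)" by linarith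
  qed
  moreover have "\<alpha> / C * d > 0" using d exponents C_pos by simp
  ultimately show ?thesis by linarith
qed

text \<open>One fixed admissible set bounds the level. A small fixed radius makes the N- and
  B-contributions small; the remaining term vanishes with the energy.\<close>

lemma mm_lo_tendsto_0:
  assumes k: "1 \<le> k" "minimax_sets K_lo k \<noteq> {}"
  shows "((\<lambda>c. mm_lo c k) \<longlongrightarrow> 0) (at_left 0)"
proof (rule tendstoI)
  fix e :: real assume e: "e > 0"
  obtain M where M: "M \<in> minimax_sets K_lo k" using k by blast
  then have M': "compact M" "M \<subseteq> K_lo" "\<And>x. x \<in> M \<Longrightarrow> norm x = 1" "M \<noteq> {}"
    using minimax_sets_nonempty[OF M k(1)] by (auto simp: minimax_sets_def)
  obtain x0 where x0: "x0 \<in> M" "\<And>x. x \<in> M \<Longrightarrow> A x0 \<le> A x"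
    using continuous_attains_inf[OF M'(1,4) continuous_NAB(2)] by blast
  define a where "a = A x0"
  have a: "a > 0" using x0 M' by (auto simp: a_def pos_cone_def)
  have "((\<lambda>t. \<alpha> / a * (t powr (\<eta> - \<alpha>) * C / \<eta> + t powr (\<beta> - \<alpha>) * C / \<beta>)) \<longlongrightarrow>
      \<alpha> / a * (0 * C / \<eta> + 0 * C / \<beta>)) (at_right 0)"
    using exponents
    by (intro tendsto_intros tendsto_zero_powrI[where b = "\<eta> - \<alpha>"] tendsto_zero_powrI[where b = "\<beta> - \<alpha>"])
      (auto simp: eventually_at_right_less intro!: eventually_at_right_less[THEN eventually_mono])
  then have "\<forall>\<^sub>F t in at_right 0. \<alpha> / a * (t powr (\<eta> - \<alpha>) * C / \<eta> + t powr (\<beta> - \<alpha>) * C / \<beta>) < e / 2"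
    using e by (intro order_tendstoD(2)) auto
  moreover have "\<forall>\<^sub>F t in at_right 0. t \<in> {0<..<T}" using T_pos by (rule eventually_at_right_real)
  ultimately have "\<forall>\<^sub>F t in at_right 0. \<alpha> / a * (t powr (\<eta> - \<alpha>) * C / \<eta> + t powr (\<beta> - \<alpha>) * C / \<beta>) < e / 2
      \<and> t \<in> {0<..<T}" by (rule eventually_conj)
  from eventually_happens'[OF trivial_limit_at_right_real this] obtain t where
    t: "\<alpha> / a * (t powr (\<eta> - \<alpha>) * C / \<eta> + t powr (\<beta> - \<alpha>) * C / \<beta>) < e / 2" "0 < t" "t < T"
    by auto
  have "((\<lambda>c. \<alpha> / a * (- c * t powr (- \<alpha>))) \<longlongrightarrow> \<alpha> / a * (- 0 * t powr (- \<alpha>))) (at_left 0)"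
    by (intro tendsto_intros)
  then have "\<forall>\<^sub>F c in at_left 0. \<alpha> / a * (- c * t powr (- \<alpha>)) < e / 2"
    using e by (intro order_tendstoD(2)) auto
  moreover have "\<forall>\<^sub>F c in at_left 0. c \<in> {c_lo<..<0}" using c_lo_neg by (rule eventually_at_left_real)
  ultimately show "\<forall>\<^sub>F c in at_left 0. dist (mm_lo c k) 0 < e"
  proof eventually_elim
    case (elim c)
    then have c: "c_lo < c" "c < 0" by auto
    let ?b = "\<alpha> / a * (t powr (\<eta> - \<alpha>) * C / \<eta> + t powr (\<beta> - \<alpha>) * C / \<beta> + - c * t powr (- \<alpha>))"
    have "mm_lo c k \<le> ?b"
    proof (rule minimax_le[OF M k(1)])
      show "0 \<le> J_lo c x" if "x \<in> K_lo" for x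
        by (rule even_cone_functional.J_nonneg[OF even_cone_functional_lo[OF c] that])
      fix x assume x: "x \<in> M"
      have n: "norm x = 1" using M'(3)[OF x] .
      have xK: "x \<in> K_lo" using M'(2) x by blast
      have A: "a \<le> A x" using x0(2)[OF x] by (simp add: a_def)
      have "- B x \<le> C" using bounds(4)[of x] n by simp
      then have "t powr (\<beta> - \<alpha>) * (- B x) \<le> t powr (\<beta> - \<alpha>) * C" by (intro mult_left_mono) auto
      then have "t powr (\<beta> - \<alpha>) * (- B x) / \<beta> \<le> t powr (\<beta> - \<alpha>) * C / \<beta>"
        using exponents by (intro divide_right_mono) auto
      moreover have "t powr (\<eta> - \<alpha>) * N x / \<eta> \<le> t powr (\<eta> - \<alpha>) * C / \<eta>"
        using unit_bounds(1)[OF n] exponents by (intro divide_right_mono mult_left_mono) auto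
      ultimately have fb: "fiber c x t \<le> t powr (\<eta> - \<alpha>) * C / \<eta> + t powr (\<beta> - \<alpha>) * C / \<beta> + - c * t powr (- \<alpha>)"
        by (simp add: fiber_def)
      have "J_lo c x \<le> energy_param c (t *\<^sub>R x)" by (rule turn_lo(4)[OF c xK n t(2,3)])
      also have "\<dots> = \<alpha> / A x * fiber c x t" by (rule energy_param_scale[OF t(2)])
      also have "\<dots> \<le> \<alpha> / A x * (t powr (\<eta> - \<alpha>) * C / \<eta> + t powr (\<beta> - \<alpha>) * C / \<beta> + - c * t powr (- \<alpha>))"
        using fb A a exponents by (intro mult_left_mono) auto
      also have "\<dots> \<le> ?b"
        using A a exponents C_pos mult_nonpos_nonneg[OF less_imp_le[OF c(2)] powr_ge_zero[of t "- \<alpha>"]] by (intro mult_right_mono divide_left_mono mult_pos_pos add_nonneg_nonneg) auto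
      finally show "J_lo c x \<le> ?b" .
    qed
    also have "?b < e" using t(1) elim by (simp only: distrib_left)
    finally have "mm_lo c k < e" .
    moreover have "0 < mm_lo c k" by (rule critical_lo[OF c k])
    ultimately show ?case by simp
  qed
qed

lemma continuous_mm_lo:
  assumes "1 \<le> k" "minimax_sets K_lo k \<noteq> {}"
  shows "continuous_on {c_lo<..<0} (\<lambda>c. mm_lo c k)"
  using mm_lo_decrease[OF _ _ _ assms] mm_lo_ratio[OF _ _ _ assms]
  by (intro continuous_on_antimono_ratio) (auto intro: less_imp_le)

lemma continuous_mm_hi:
  assumes "1 \<le> k" "minimax_sets K_hi k \<noteq> {}"
  shows "continuous_on {c_lo<..<c_hi} (\<lambda>c. mm_hi c k)"
  using mm_hi_decrease[OF _ _ _ assms] mm_hi_ratio[OF _ _ _ assms]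
  by (intro continuous_on_antimono_ratio) (auto intro: less_imp_le)

end

theorem theorem1p3:
  fixes N A B :: "'a::banach \<Rightarrow> real"
    and \<alpha> \<eta> \<beta> :: real
    and \<Phi> :: "real \<Rightarrow> 'a \<Rightarrow> real"
  assumes "uniformly_convex_space TYPE('a)"
    and "C1_on (norm :: 'a \<Rightarrow> real) (UNIV - {0})"
    and "1 < \<alpha>" and "\<alpha> < \<eta>" and "\<eta> < \<beta>"
    and "C1_on N UNIV" and "C1_on A UNIV" and "C1_on B UNIV"
    and "even_functional N" and "even_functional A" and "even_functional B"
    and "homogeneous \<eta> N" and "homogeneous \<alpha> A" and "homogeneous \<beta> B"
    and "\<Phi> = Phi \<eta> \<alpha> \<beta> N A B"
    and "\<exists>C C'. C > 0 \<and> C' > 0 \<and>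
           (\<forall>u. C' * norm u powr \<eta> \<ge> N u \<and> N u \<ge> inverse C * norm u powr \<eta>
              \<and> \<bar>A u\<bar> \<le> C * norm u powr \<alpha> \<and> \<bar>B u\<bar> \<le> C * norm u powr \<beta>)"
    and "\<And>(l :: nat \<Rightarrow> real) (u :: nat \<Rightarrow> 'a).
           bounded (range l) \<Longrightarrow> bounded (range u) \<Longrightarrow> bounded (range (\<lambda>n. \<Phi> (l n) (u n))) \<Longrightarrow>
           (\<lambda>n. dual_deriv (\<Phi> (l n)) (u n)) \<longlonglongrightarrow> 0 \<Longrightarrow>
           \<exists>r x. strict_mono (r :: nat \<Rightarrow> nat) \<and> (u \<circ> r) \<longlonglongrightarrow> x"
  shows "\<exists>(c1 :: real) (c2 :: real) (lp :: real \<Rightarrow> nat \<Rightarrow> real) (lm :: real \<Rightarrow> nat \<Rightarrow> real)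
          (v :: real \<Rightarrow> nat \<Rightarrow> 'a) (u :: real \<Rightarrow> nat \<Rightarrow> 'a).
     c1 < 0 \<and> 0 < c2
     \<and> (\<forall>k. 1 \<le> k \<and> enat k \<le> cone_genus (pos_cone A) \<longrightarrow>
          (\<forall>c\<in>{c1<..<0}. lp c k > 0 \<and> v c k \<in> pos_cone A
              \<and> \<Phi> (lp c k) (v c k) = c \<and> dual_deriv (\<Phi> (lp c k)) (v c k) = 0))
     \<and> (\<forall>k. 1 \<le> k \<and> enat k \<le> cone_genus (pos_cone A) \<longrightarrow>
          continuous_on {c1<..<0} (\<lambda>c. lp c k) \<and> strict_antimono_on {c1<..<0} (\<lambda>c. lp c k)
          \<and> ((\<lambda>c. lp c k) \<longlongrightarrow> 0) (at_left 0))
     \<and> (cone_genus (pos_cone A) = \<infinity> \<longrightarrow>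
          (\<forall>c\<in>{c1<..<0}. (\<forall>k\<ge>1. 0 < lp c k \<and> lp c k \<le> lp c (k + 1))
              \<and> filterlim (\<lambda>k. lp c k) at_top sequentially))
     \<and> (cone_genus (pos_cone A) = \<infinity> \<longrightarrow>
          (\<forall>lam>0. (\<exists>(w :: nat \<Rightarrow> 'a) (c :: nat \<Rightarrow> real) (k :: nat \<Rightarrow> nat).
              (\<forall>n. w n \<in> pos_cone A \<and> c n \<in> {c1<..<0} \<and> 1 \<le> k n)
              \<and> c \<longlonglongrightarrow> 0 \<and> filterlim k at_top sequentially
              \<and> (\<forall>n. lam = lp (c n) (k n) \<and> \<Phi> lam (w n) = c n \<and> dual_deriv (\<Phi> lam) (w n) = 0)
              \<and> w \<longlonglongrightarrow> 0)
            \<and> bifurcation_point \<Phi> lam))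
     \<and> (\<forall>k. 1 \<le> k \<and> enat k \<le> cone_genus (pos_cone A \<inter> pos_cone B) \<longrightarrow>
          (\<forall>c\<in>{c1<..<c2}. lm c k > 0 \<and> u c k \<in> pos_cone A \<inter> pos_cone B
              \<and> \<Phi> (lm c k) (u c k) = c \<and> dual_deriv (\<Phi> (lm c k)) (u c k) = 0)
          \<and> (\<forall>c\<in>{c1<..<0}. lp c k < lm c k))
     \<and> (\<forall>k. 1 \<le> k \<and> enat k \<le> cone_genus (pos_cone A \<inter> pos_cone B) \<longrightarrow>
          continuous_on {c1<..<c2} (\<lambda>c. lm c k) \<and> strict_antimono_on {c1<..<c2} (\<lambda>c. lm c k))
     \<and> (cone_genus (pos_cone A \<inter> pos_cone B) = \<infinity> \<longrightarrow>
          (\<forall>c\<in>{c1<..<c2}. (\<forall>k\<ge>1. 0 < lm c k \<and> lm c k \<le> lm c (k + 1))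
              \<and> filterlim (\<lambda>k. lm c k) at_top sequentially))"
proof -
  obtain C0 C1 where C0: "C0 > 0" "C1 > 0" "\<forall>u. C1 * norm u powr \<eta> \<ge> N u \<and> N u \<ge> inverse C0 * norm u powr \<eta>
      \<and> \<bar>A u\<bar> \<le> C0 * norm u powr \<alpha> \<and> \<bar>B u\<bar> \<le> C0 * norm u powr \<beta>"
    using assms(16) by blast
  \<comment> \<open>Enlarging a constant weakens each bound, so the maximum serves for all
    four.\<close>
  define C where "C = max C0 C1"
  have C: "C > 0" "C0 \<le> C" "C1 \<le> C" using C0 by (auto simp: C_def)
  have bd: "N u \<le> C * norm u powr \<eta>" "N u \<ge> inverse C * norm u powr \<eta>"
      "\<bar>A u\<bar> \<le> C * norm u powr \<alpha>" "\<bar>B u\<bar> \<le> C * norm u powr \<beta>" for u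
  proof -
    have b: "N u \<le> C1 * norm u powr \<eta>" "inverse C0 * norm u powr \<eta> \<le> N u"
      "\<bar>A u\<bar> \<le> C0 * norm u powr \<alpha>" "\<bar>B u\<bar> \<le> C0 * norm u powr \<beta>" using C0(3) by auto
    have "C1 * norm u powr \<eta> \<le> C * norm u powr \<eta>" "inverse C * norm u powr \<eta> \<le> inverse C0 * norm u powr \<eta>"
      "C0 * norm u powr \<alpha> \<le> C * norm u powr \<alpha>" "C0 * norm u powr \<beta> \<le> C * norm u powr \<beta>"
      using C C0(1) by (intro mult_right_mono le_imp_inverse_le powr_ge_zero; simp)+
    with b show "N u \<le> C * norm u powr \<eta>" "N u \<ge> inverse C * norm u powr \<eta>"
      "\<bar>A u\<bar> \<le> C * norm u powr \<alpha>" "\<bar>B u\<bar> \<le> C * norm u powr \<beta>" by linarith+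
  qed
  interpret homogeneous_functionals N A B \<alpha> \<eta> \<beta> C
  proof
    show "\<exists>r x. strict_mono (r :: nat \<Rightarrow> nat) \<and> (us \<circ> r) \<longlonglongrightarrow> x"
      if "bounded (range l)" "bounded (range us)" "bounded (range (\<lambda>n. Phi \<eta> \<alpha> \<beta> N A B (l n) (us n)))"
        "(\<lambda>n. dual_deriv (Phi \<eta> \<alpha> \<beta> N A B (l n)) (us n)) \<longlonglongrightarrow> 0"
      for l and us :: "nat \<Rightarrow> 'a"
      using assms(17)[of l us] that unfolding assms(15) by blast
  qed (use assms(3-14) C(1) bd in auto)
  define \<kappa> where "\<kappa> = 2 * \<eta> * C * \<alpha> / (\<eta> - \<alpha>)"
  \<comment> \<open>The norm bound is part of the selection; the convergence to 0 in the bifurcation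
    claim is read off from it.\<close>
  define Pv where "Pv c k w \<longleftrightarrow> w \<in> K_lo \<and> \<Phi> (mm_lo c k) w = c \<and> dual_deriv (\<Phi> (mm_lo c k)) w = 0
      \<and> norm w \<le> 2 * (\<kappa> * (- c)) powr (1 / \<eta>)" for c k w
  define Pu where "Pu c k w \<longleftrightarrow> w \<in> K_hi \<and> \<Phi> (mm_hi c k) w = c \<and> dual_deriv (\<Phi> (mm_hi c k)) w = 0" for c k w
  define v where "v c k = (SOME w. Pv c k w)" for c k
  define u where "u c k = (SOME w. Pu c k w)" for c k
  have v: "Pv c k (v c k)" "0 < mm_lo c k" if "c_lo < c" "c < 0" "1 \<le> k" "minimax_sets K_lo k \<noteq> {}" for c k
  proof -
    note * = that
    obtain w where "Pv c k w" "0 < mm_lo c k"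
      by (rule critical_lo[OF *]) (auto simp: Pv_def assms(15) \<kappa>_def)
    then show "Pv c k (v c k)" "0 < mm_lo c k" unfolding v_def by (auto intro: someI)
  qed
  have u: "Pu c k (u c k)" "0 < mm_hi c k" if "c_lo < c" "c < c_hi" "1 \<le> k" "minimax_sets K_hi k \<noteq> {}" for c k
  proof -
    note * = that
    obtain w where "Pu c k w" "0 < mm_hi c k"
      by (rule critical_hi[OF *]) (auto simp: Pu_def assms(15))
    then show "Pu c k (u c k)" "0 < mm_hi c k" unfolding u_def by (auto intro: someI)
  qed
  \<comment> \<open>\<open>max k 1\<close> covers k = 0, which \<open>minimax_at_top\<close> also
    asks for.\<close>
  have inf_lo: "minimax_sets K_lo k \<noteq> {}" if "cone_genus K_lo = \<infinity>" for k
    using minimax_sets_K(1)[of "max k 1"] that minimax_sets_mono[of k "max k 1" K_lo K_lo] by auto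
  have inf_hi: "minimax_sets K_hi k \<noteq> {}" if "cone_genus K_hi = \<infinity>" for k
    using minimax_sets_K(2)[of "max k 1"] that minimax_sets_mono[of k "max k 1" K_hi K_hi] by auto
  have top_lo: "filterlim (\<lambda>k. mm_lo c k) at_top sequentially"
    if "cone_genus K_lo = \<infinity>" "c_lo < c" "c < 0" for c
    by (rule even_cone_functional.minimax_at_top[OF even_cone_functional_lo[OF that(2,3)] inf_lo[OF that(1)]])
  have small: "\<exists>(w :: nat \<Rightarrow> 'a) (c :: nat \<Rightarrow> real) (k :: nat \<Rightarrow> nat).
      (\<forall>n. w n \<in> K_lo \<and> c n \<in> {c_lo<..<0} \<and> 1 \<le> k n)
      \<and> c \<longlonglongrightarrow> 0 \<and> filterlim k at_top sequentially
      \<and> (\<forall>n. lam = mm_lo (c n) (k n) \<and> \<Phi> lam (w n) = c n \<and> dual_deriv (\<Phi> lam) (w n) = 0)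
      \<and> w \<longlonglongrightarrow> 0"
    if g: "cone_genus K_lo = \<infinity>" and lam: "lam > 0" for lam
  proof -
    \<comment> \<open>Energies increasing to 0; the requirement s n \<le> c n < 0 makes the selected
      energies tend to 0.\<close>
    define s where "s n = c_lo / (real n + 2)" for n
    have s: "c_lo < s n" "s n < 0" for n
      using c_lo_neg by (simp_all add: s_def field_simps add_neg_nonpos mult_nonneg_nonpos)
    \<comment> \<open>For large k the level at energy s n exceeds lam, and for this k the level
      tends to 0 as the energy rises to 0; the intermediate value theorem in the energy hits
      lam.\<close>
    have "\<exists>c k. s n \<le> c \<and> c < 0 \<and> n \<le> k \<and> 1 \<le> k \<and> mm_lo c k = lam" for n
    proof -
      have "\<forall>\<^sub>F k in sequentially. lam < mm_lo (s n) k"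
        using top_lo[OF g s] by (simp add: filterlim_at_top_dense)
      then have "\<forall>\<^sub>F k in sequentially. lam < mm_lo (s n) k \<and> n + 1 \<le> k"
        using eventually_ge_at_top by (rule eventually_conj)
      then obtain k where k: "lam < mm_lo (s n) k" "n + 1 \<le> k"
        unfolding eventually_sequentially by blast
      then have k1: "1 \<le> k" by simp
      have "\<forall>\<^sub>F c in at_left 0. mm_lo c k < lam"
        by (rule order_tendstoD(2)[OF mm_lo_tendsto_0[OF k1 inf_lo[OF g]] lam])
      moreover have "\<forall>\<^sub>F c in at_left 0. c \<in> {s n<..<0}" using s(2) by (rule eventually_at_left_real)
      ultimately have "\<forall>\<^sub>F c in at_left 0. mm_lo c k < lam \<and> c \<in> {s n<..<0}" by (rule eventually_conj)
      from eventually_happens'[OF trivial_limit_at_left_real this] obtain d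
        where d: "mm_lo d k < lam" "s n < d" "d < 0" by auto
      have "continuous_on {s n..d} (\<lambda>c. mm_lo c k)"
        by (rule continuous_on_subset[OF continuous_mm_lo[OF k1 inf_lo[OF g]]]) (use s[of n] d in auto)
      then have "\<exists>c\<ge>s n. c \<le> d \<and> mm_lo c k = lam"
        using k d by (intro IVT2') auto
      then obtain c where "s n \<le> c" "c \<le> d" "mm_lo c k = lam" by blast
      then show ?thesis using d k by (intro exI[of _ c] exI[of _ k]) auto
    qed
    then have "\<forall>n. \<exists>q. s n \<le> fst q \<and> fst q < 0 \<and> n \<le> snd q \<and> 1 \<le> snd q \<and> mm_lo (fst q) (snd q) = lam"
      by simp
    from choice[OF this] obtain q where q: "\<And>n. s n \<le> fst (q n)" "\<And>n. fst (q n) < 0"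
      "\<And>n. n \<le> snd (q n)" "\<And>n. 1 \<le> snd (q n)" "\<And>n. mm_lo (fst (q n)) (snd (q n)) = lam" by blast
    define c where "c n = fst (q n)" for n
    define k where "k n = snd (q n)" for n
    have c: "c_lo < c n" "c n < 0" "s n \<le> c n" for n using q s[of n] by (auto simp: c_def less_le_trans)
    have k: "1 \<le> k n" "n \<le> k n" "mm_lo (c n) (k n) = lam" for n using q by (auto simp: c_def k_def)
    have P: "Pv (c n) (k n) (v (c n) (k n))" for n
      by (rule v(1)[OF c(1,2) k(1) inf_lo[OF g]])
    have s0: "s \<longlonglongrightarrow> 0" unfolding s_def by real_asymp
    have c0: "c \<longlonglongrightarrow> 0"
      by (rule tendsto_sandwich[OF _ _ s0 tendsto_const]) (use c(3) less_imp_le[OF c(2)] in auto)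
    have kt: "filterlim k at_top sequentially"
      by (rule filterlim_at_top_mono[OF filterlim_ident]) (use k in auto)
    have \<kappa>: "\<kappa> > 0" using exponents C_pos by (simp add: \<kappa>_def)
    have "(\<lambda>n. \<kappa> * (- c n)) \<longlonglongrightarrow> 0"
      using tendsto_mult[OF tendsto_const[of \<kappa>] tendsto_minus[OF c0]] by simp
    then have "(\<lambda>n. (\<kappa> * (- c n)) powr (1 / \<eta>)) \<longlonglongrightarrow> 0"
      using \<kappa> c exponents
      by (intro tendsto_zero_powrI[OF _ tendsto_const]) (auto simp: mult_nonneg_nonpos less_imp_le)
    then have "(\<lambda>n. 2 * (\<kappa> * (- c n)) powr (1 / \<eta>)) \<longlonglongrightarrow> 0"
      by (rule tendsto_mult_right_zero)
    then have w0: "(\<lambda>n. v (c n) (k n)) \<longlonglongrightarrow> 0"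
      by (rule Lim_null_comparison[rotated]) (use P in \<open>simp add: Pv_def\<close>)
    show ?thesis
      by (rule exI[of _ "\<lambda>n. v (c n) (k n)"], rule exI[of _ c], rule exI[of _ k])
        (use P c k c0 kt w0 in \<open>simp add: Pv_def\<close>)
  qed
  have nz: "w \<noteq> 0" if "w \<in> K_lo" for w
    using that bounds(3)[of 0] exponents by (auto simp: pos_cone_def)
  show ?thesis
  proof (rule exI[of _ c_lo], rule exI[of _ c_hi], rule exI[of _ mm_lo], rule exI[of _ mm_hi],
      rule exI[of _ v], rule exI[of _ u], intro conjI)
    show "c_lo < 0" "0 < c_hi" by (rule c_lo_neg, rule c_hi_pos)
    show "\<forall>k. 1 \<le> k \<and> enat k \<le> cone_genus K_lo \<longrightarrow>
          (\<forall>c\<in>{c_lo<..<0}. mm_lo c k > 0 \<and> v c k \<in> K_lo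
              \<and> \<Phi> (mm_lo c k) (v c k) = c \<and> dual_deriv (\<Phi> (mm_lo c k)) (v c k) = 0)"
      using v minimax_sets_K(1) unfolding Pv_def by auto
    show "\<forall>k. 1 \<le> k \<and> enat k \<le> cone_genus K_lo \<longrightarrow>
          continuous_on {c_lo<..<0} (\<lambda>c. mm_lo c k) \<and> strict_antimono_on {c_lo<..<0} (\<lambda>c. mm_lo c k)
          \<and> ((\<lambda>c. mm_lo c k) \<longlongrightarrow> 0) (at_left 0)"
      using continuous_mm_lo mm_lo_tendsto_0 mm_lo_decrease minimax_sets_K(1)
      by (auto intro!: monotone_onI)
    show "cone_genus K_lo = \<infinity> \<longrightarrow>
          (\<forall>c\<in>{c_lo<..<0}. (\<forall>k\<ge>1. 0 < mm_lo c k \<and> mm_lo c k \<le> mm_lo c (k + 1))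
              \<and> filterlim (\<lambda>k. mm_lo c k) at_top sequentially)"
      using v(2) inf_lo top_lo even_cone_functional.minimax_le_level[OF even_cone_functional_lo] by auto
    show "cone_genus K_lo = \<infinity> \<longrightarrow>
          (\<forall>lam>0. (\<exists>(w :: nat \<Rightarrow> 'a) (c :: nat \<Rightarrow> real) (k :: nat \<Rightarrow> nat).
              (\<forall>n. w n \<in> K_lo \<and> c n \<in> {c_lo<..<0} \<and> 1 \<le> k n)
              \<and> c \<longlonglongrightarrow> 0 \<and> filterlim k at_top sequentially
              \<and> (\<forall>n. lam = mm_lo (c n) (k n) \<and> \<Phi> lam (w n) = c n \<and> dual_deriv (\<Phi> lam) (w n) = 0)
              \<and> w \<longlonglongrightarrow> 0)
            \<and> bifurcation_point \<Phi> lam)"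
    proof (intro impI allI)
      fix lam :: real assume g: "cone_genus K_lo = \<infinity>" and lam: "lam > 0"
      note sm = small[OF g lam]
      from sm obtain w where "\<And>n. w n \<in> K_lo" "\<And>n. dual_deriv (\<Phi> lam) (w n) = 0" "w \<longlonglongrightarrow> 0" by blast
      then have "bifurcation_point \<Phi> lam"
        unfolding bifurcation_point_def using nz by (intro exI[of _ "\<lambda>_. lam"] exI[of _ w]) auto
      with sm show "(\<exists>(w :: nat \<Rightarrow> 'a) (c :: nat \<Rightarrow> real) (k :: nat \<Rightarrow> nat).
              (\<forall>n. w n \<in> K_lo \<and> c n \<in> {c_lo<..<0} \<and> 1 \<le> k n)
              \<and> c \<longlonglongrightarrow> 0 \<and> filterlim k at_top sequentially
              \<and> (\<forall>n. lam = mm_lo (c n) (k n) \<and> \<Phi> lam (w n) = c n \<and> dual_deriv (\<Phi> lam) (w n) = 0)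
              \<and> w \<longlonglongrightarrow> 0)
            \<and> bifurcation_point \<Phi> lam" by (rule conjI)
    qed
    show "\<forall>k. 1 \<le> k \<and> enat k \<le> cone_genus K_hi \<longrightarrow>
          (\<forall>c\<in>{c_lo<..<c_hi}. mm_hi c k > 0 \<and> u c k \<in> K_hi
              \<and> \<Phi> (mm_hi c k) (u c k) = c \<and> dual_deriv (\<Phi> (mm_hi c k)) (u c k) = 0)
          \<and> (\<forall>c\<in>{c_lo<..<0}. mm_lo c k < mm_hi c k)"
      using u minimax_sets_K(2) mm_lo_less_hi unfolding Pu_def by auto
    show "\<forall>k. 1 \<le> k \<and> enat k \<le> cone_genus K_hi \<longrightarrow>
          continuous_on {c_lo<..<c_hi} (\<lambda>c. mm_hi c k) \<and> strict_antimono_on {c_lo<..<c_hi} (\<lambda>c. mm_hi c k)"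
      using continuous_mm_hi mm_hi_decrease minimax_sets_K(2) by (auto intro!: monotone_onI)
    show "cone_genus K_hi = \<infinity> \<longrightarrow>
          (\<forall>c\<in>{c_lo<..<c_hi}. (\<forall>k\<ge>1. 0 < mm_hi c k \<and> mm_hi c k \<le> mm_hi c (k + 1))
              \<and> filterlim (\<lambda>k. mm_hi c k) at_top sequentially)"
      using u(2) inf_hi even_cone_functional.minimax_le_level[OF even_cone_functional_hi]
        even_cone_functional.minimax_at_top[OF even_cone_functional_hi] by auto
  qed
qed

end
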